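(* Let $\mathcal{D}$ be a totally definite quaternion algebra over $\mathbb{Q}$ and let $G$ be an imprimitive absolutely irreducible maximal finite subgroup of $GL_3(\mathcal{D})$. Then either $\mathcal{D}=D_{2,\infty}$ and $G\cong SL_2(\mathbb{F}_3)\wr\mathrm{Sym}_3$, or $\mathcal{D}=D_{3,\infty}$ and $G\cong\mathrm{Dic}_{12}\wr\mathrm{Sym}_3$.
   Context: $D_{p,\infty}$ is the quaternion algebra over $\mathbb{Q}$ ramified exactly at $p$ and $\infty$. For a finite subgroup $G\le GL_3(\mathcal{D})$, its enveloping $\mathbb{Q}$-algebra is $\overline{G}=\{\sum_{x\in G}l_x x: l_x\in\mathbb{Q}\}\subseteq M_3(\mathcal{D})$; $G$ is absolutely irreducible if $\overline{G}=M_3(\mathcal{D})$, and irreducible if the centralizer $C_{M_3(\mathcal{D})}(G)$ is a division algebra. An irreducible $G$ is imprimitive if $V=\mathcal{D}^{1\times3}$ (a $\mathcal{D}$-$G$-bimodule) decomposes as $V=V_1\oplus\cdots\oplus V_s$, $s>1$, into nonzero left $\mathcal{D}$-submodules permuted by $G$ (for every $x\in G$ and $i$ there is $j$ with $V_ix\subseteq V_j$). $\mathrm{Dic}_{12}$ is the dicyclic group of order 12, $\wr$ the wreath product. *)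

theory Defs
  imports
    "Jordan_Normal_Form.Matrix"
    "Jordan_Normal_Form.Determinant"
    "HOL-Algebra.QuotRing"
    "HOL-Algebra.Sym_Groups"
    "HOL-Algebra.Algebraic_Closure_Type"
    "HOL-Library.Numeral_Type"
begin

section \<open>Quaternion algebras over the rationals\<close>

text \<open>A \<open>\<rat>\<close>-algebra is a type of class \<open>ring_1\<close> together with a rational scalar multiplication.\<close>

definition rat_algebra :: "(rat \<Rightarrow> 'd::ring_1 \<Rightarrow> 'd) \<Rightarrow> bool" where
  "rat_algebra scale \<longleftrightarrow> vector_space scale \<and>
     (\<forall>c x y. scale c (x * y) = scale c x * y \<and> scale c (x * y) = x * scale c y)"

text \<open>\<open>i\<close> and \<open>j\<close> present the algebra as \<open>(a, b / \<rat>)\<close>; bijectivity says that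
  \<open>1, i, j, ij\<close> is a \<open>\<rat>\<close>-basis.\<close>

definition quaternion_generators ::
    "(rat \<Rightarrow> 'd::ring_1 \<Rightarrow> 'd) \<Rightarrow> rat \<Rightarrow> rat \<Rightarrow> 'd \<Rightarrow> 'd \<Rightarrow> bool" where
  "quaternion_generators scale a b i j \<longleftrightarrow>
     a \<noteq> 0 \<and> b \<noteq> 0 \<and>
     i * i = scale a 1 \<and> j * j = scale b 1 \<and> j * i = - (i * j) \<and>
     bij (\<lambda>(t, x, y, z). scale t 1 + scale x i + scale y j + scale z (i * j))"

definition quaternion_algebra :: "(rat \<Rightarrow> 'd::ring_1 \<Rightarrow> 'd) \<Rightarrow> bool" where
  "quaternion_algebra scale \<longleftrightarrow>
     rat_algebra scale \<and> (\<exists>a b i j. quaternion_generators scale a b i j)"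

section \<open>Scalar extension and ramification\<close>

text \<open>\<open>(a, b / K)\<close> for a commutative ring \<open>K\<close> and \<open>a, b \<in> K\<close>: the tuple \<open>(t, x, y, z)\<close> stands for
  \<open>t + xi + yj + zij\<close>, where \<open>i\<^sup>2 = a\<close>, \<open>j\<^sup>2 = b\<close>, \<open>ji = -ij\<close>.\<close>

definition quat_alg :: "('k, 'm) ring_scheme \<Rightarrow> 'k \<Rightarrow> 'k \<Rightarrow> ('k \<times> 'k \<times> 'k \<times> 'k) ring" where
  "quat_alg K a b =
     \<lparr>carrier = carrier K \<times> carrier K \<times> carrier K \<times> carrier K,
      monoid.mult = (\<lambda>(t, x, y, z) (t', x', y', z').
        (t \<otimes>\<^bsub>K\<^esub> t' \<oplus>\<^bsub>K\<^esub> a \<otimes>\<^bsub>K\<^esub> x \<otimes>\<^bsub>K\<^esub> x' \<oplus>\<^bsub>K\<^esub> b \<otimes>\<^bsub>K\<^esub> y \<otimes>\<^bsub>K\<^esub> y' \<ominus>\<^bsub>K\<^esub> a \<otimes>\<^bsub>K\<^esub> b \<otimes>\<^bsub>K\<^esub> z \<otimes>\<^bsub>K\<^esub> z',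
         t \<otimes>\<^bsub>K\<^esub> x' \<oplus>\<^bsub>K\<^esub> x \<otimes>\<^bsub>K\<^esub> t' \<oplus>\<^bsub>K\<^esub> b \<otimes>\<^bsub>K\<^esub> z \<otimes>\<^bsub>K\<^esub> y' \<ominus>\<^bsub>K\<^esub> b \<otimes>\<^bsub>K\<^esub> y \<otimes>\<^bsub>K\<^esub> z',
         t \<otimes>\<^bsub>K\<^esub> y' \<oplus>\<^bsub>K\<^esub> y \<otimes>\<^bsub>K\<^esub> t' \<oplus>\<^bsub>K\<^esub> a \<otimes>\<^bsub>K\<^esub> x \<otimes>\<^bsub>K\<^esub> z' \<ominus>\<^bsub>K\<^esub> a \<otimes>\<^bsub>K\<^esub> z \<otimes>\<^bsub>K\<^esub> x',
         t \<otimes>\<^bsub>K\<^esub> z' \<oplus>\<^bsub>K\<^esub> z \<otimes>\<^bsub>K\<^esub> t' \<oplus>\<^bsub>K\<^esub> x \<otimes>\<^bsub>K\<^esub> y' \<ominus>\<^bsub>K\<^esub> y \<otimes>\<^bsub>K\<^esub> x')),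
      one = (\<one>\<^bsub>K\<^esub>, \<zero>\<^bsub>K\<^esub>, \<zero>\<^bsub>K\<^esub>, \<zero>\<^bsub>K\<^esub>),
      ring.zero = (\<zero>\<^bsub>K\<^esub>, \<zero>\<^bsub>K\<^esub>, \<zero>\<^bsub>K\<^esub>, \<zero>\<^bsub>K\<^esub>),
      add = (\<lambda>(t, x, y, z) (t', x', y', z').
        (t \<oplus>\<^bsub>K\<^esub> t', x \<oplus>\<^bsub>K\<^esub> x', y \<oplus>\<^bsub>K\<^esub> y', z \<oplus>\<^bsub>K\<^esub> z'))\<rparr>"

definition division_algebra :: "('r, 'm) ring_scheme \<Rightarrow> bool" where
  "division_algebra R \<longleftrightarrow> Ring.ring R \<and> \<one>\<^bsub>R\<^esub> \<noteq> \<zero>\<^bsub>R\<^esub> \<and> Units R = carrier R - {\<zero>\<^bsub>R\<^esub>}"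

text \<open>\<open>\<D> \<otimes>\<^sub>\<rat> K\<close> is a division algebra, for a field \<open>K\<close> into which \<open>emb\<close> embeds \<open>\<rat>\<close>.
  If \<open>\<D> = (a, b / \<rat>)\<close> then \<open>\<D> \<otimes>\<^sub>\<rat> K = (a, b / K)\<close>, so up to isomorphism the right-hand
  side does not depend on the presentation chosen.\<close>

definition division_over ::
    "(rat \<Rightarrow> 'd::ring_1 \<Rightarrow> 'd) \<Rightarrow> ('k, 'm) ring_scheme \<Rightarrow> (rat \<Rightarrow> 'k) \<Rightarrow> bool" where
  "division_over scale K emb \<longleftrightarrow>
     (\<exists>a b i j. quaternion_generators scale a b i j \<and> division_algebra (quat_alg K (emb a) (emb b)))"

text \<open>The field of \<open>p\<close>-adic numbers is the completion of \<open>\<rat>\<close> for the \<open>p\<close>-adic absolute value: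
  Cauchy sequences modulo null sequences.\<close>

definition padic_abs :: "nat \<Rightarrow> rat \<Rightarrow> rat" where
  "padic_abs p x = (if x = 0 then 0 else
     of_nat p powi (int (multiplicity (int p) (snd (quotient_of x)))
                  - int (multiplicity (int p) (fst (quotient_of x)))))"

definition padic_cauchy :: "nat \<Rightarrow> (nat \<Rightarrow> rat) set" where
  "padic_cauchy p = {u. \<forall>e>0. \<exists>N. \<forall>m\<ge>N. \<forall>n\<ge>N. padic_abs p (u m - u n) < e}"

definition padic_null :: "nat \<Rightarrow> (nat \<Rightarrow> rat) set" where
  "padic_null p = {u. \<forall>e>0. \<exists>N. \<forall>n\<ge>N. padic_abs p (u n) < e}"

definition padic_cauchy_ring :: "nat \<Rightarrow> (nat \<Rightarrow> rat) ring" where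
  "padic_cauchy_ring p =
     \<lparr>carrier = padic_cauchy p,
      monoid.mult = (\<lambda>u v n. u n * v n),
      one = (\<lambda>n. 1),
      ring.zero = (\<lambda>n. 0),
      add = (\<lambda>u v n. u n + v n)\<rparr>"

definition padic_field :: "nat \<Rightarrow> (nat \<Rightarrow> rat) set ring" where
  "padic_field p = padic_cauchy_ring p Quot padic_null p"

definition padic_of_rat :: "nat \<Rightarrow> rat \<Rightarrow> (nat \<Rightarrow> rat) set" where
  "padic_of_rat p x = padic_null p +>\<^bsub>padic_cauchy_ring p\<^esub> (\<lambda>n. x)"

definition ramified_at_prime :: "(rat \<Rightarrow> 'd::ring_1 \<Rightarrow> 'd) \<Rightarrow> nat \<Rightarrow> bool" where
  "ramified_at_prime scale p \<longleftrightarrow> division_over scale (padic_field p) (padic_of_rat p)"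

definition ramified_at_infinity :: "(rat \<Rightarrow> 'd::ring_1 \<Rightarrow> 'd) \<Rightarrow> bool" where
  "ramified_at_infinity scale \<longleftrightarrow> division_over scale (ring_of_type_algebra :: real ring) of_rat"

text \<open>Totally definite means ramified at every infinite place; \<open>\<rat>\<close> has only one.\<close>

definition totally_definite_quaternion_algebra :: "(rat \<Rightarrow> 'd::ring_1 \<Rightarrow> 'd) \<Rightarrow> bool" where
  "totally_definite_quaternion_algebra scale \<longleftrightarrow>
     quaternion_algebra scale \<and> ramified_at_infinity scale"

text \<open>\<open>\<D> = D\<^bsub>p,\<infinity>\<^esub>\<close>, as an isomorphism class.\<close>

definition is_quaternion_D_p_inf :: "(rat \<Rightarrow> 'd::ring_1 \<Rightarrow> 'd) \<Rightarrow> nat \<Rightarrow> bool" where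
  "is_quaternion_D_p_inf scale p \<longleftrightarrow>
     quaternion_algebra scale \<and> ramified_at_infinity scale \<and>
     (\<forall>q. Factorial_Ring.prime q \<longrightarrow> (ramified_at_prime scale q \<longleftrightarrow> q = p))"

section \<open>Matrix groups over a ring\<close>

definition GL :: "'d::ring_1 itself \<Rightarrow> nat \<Rightarrow> 'd mat monoid" where
  "GL ty n = units_of (ring_mat ty n ())"

definition maximal_finite_subgroup :: "'g set \<Rightarrow> ('g, 'm) monoid_scheme \<Rightarrow> bool" where
  "maximal_finite_subgroup G A \<longleftrightarrow> subgroup G A \<and> finite G \<and>
     (\<forall>H. subgroup H A \<and> finite H \<and> G \<subseteq> H \<longrightarrow> H = G)"

definition enveloping_algebra ::
    "(rat \<Rightarrow> 'd::ring_1 \<Rightarrow> 'd) \<Rightarrow> nat \<Rightarrow> 'd mat set \<Rightarrow> 'd mat set" where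
  "enveloping_algebra scale n G =
     {\<Oplus>\<^bsub>ring_mat TYPE('d) n ()\<^esub>x\<in>G. map_mat (scale (l x)) x | l. True}"

definition absolutely_irreducible ::
    "(rat \<Rightarrow> 'd::ring_1 \<Rightarrow> 'd) \<Rightarrow> nat \<Rightarrow> 'd mat set \<Rightarrow> bool" where
  "absolutely_irreducible scale n G \<longleftrightarrow> enveloping_algebra scale n G = carrier_mat n n"

definition mat_centralizer :: "nat \<Rightarrow> 'd::ring_1 mat set \<Rightarrow> 'd mat set" where
  "mat_centralizer n G = {A \<in> carrier_mat n n. \<forall>x\<in>G. x * A = A * x}"

definition irreducible_mat_group :: "nat \<Rightarrow> 'd::ring_1 mat set \<Rightarrow> bool" where
  "irreducible_mat_group n G \<longleftrightarrow>
     division_algebra (ring_mat TYPE('d) n () \<lparr>carrier := mat_centralizer n G\<rparr>)"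

text \<open>Row vectors are \<open>1 \<times> n\<close> matrices: scalars act on the left and matrices by multiplication on
  the right. The summands are indexed by \<open>0, \<dots>, s - 1\<close>, and the unique family \<open>f\<close> expresses that
  their sum is direct and equal to the whole space.\<close>

definition imprimitive :: "nat \<Rightarrow> 'd::ring_1 mat set \<Rightarrow> bool" where
  "imprimitive n G \<longleftrightarrow> irreducible_mat_group n G \<and>
     (let V = module_mat TYPE('d) 1 n in
      \<exists>s>1. \<exists>W :: nat \<Rightarrow> 'd mat set.
        (\<forall>i<s. submodule (W i) (ring_of_type_algebra :: 'd ring) V \<and> W i \<noteq> {\<zero>\<^bsub>V\<^esub>}) \<and>
        (\<forall>v\<in>carrier V. \<exists>!f. f \<in> (\<Pi>\<^sub>E i\<in>{..<s}. W i) \<and> v = (\<Oplus>\<^bsub>V\<^esub>i\<in>{..<s}. f i)) \<and>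
        (\<forall>x\<in>G. \<forall>i<s. \<exists>j<s. (\<lambda>v. v * x) ` W i \<subseteq> W j))"

section \<open>The groups in the classification\<close>

definition SL :: "'a::comm_ring_1 itself \<Rightarrow> nat \<Rightarrow> 'a mat monoid" where
  "SL ty n = \<lparr>carrier = {A \<in> carrier_mat n n. det A = 1}, monoid.mult = (*), one = 1\<^sub>m n\<rparr>"

text \<open>The group \<open>\<langle>a, b | a\<^sup>2\<^sup>n = 1, b\<^sup>2 = a\<^sup>n, b a b\<^sup>-\<^sup>1 = a\<^sup>-\<^sup>1\<rangle>\<close> of order \<open>4n\<close>; the pair \<open>(k, s)\<close> stands for
  \<open>a\<^sup>k\<close> if \<open>s\<close> is false and for \<open>a\<^sup>k b\<close> if \<open>s\<close> is true.\<close>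

definition dicyclic_group :: "nat \<Rightarrow> (int \<times> bool) monoid" where
  "dicyclic_group n =
     \<lparr>carrier = {0..<2 * int n} \<times> UNIV,
      monoid.mult = (\<lambda>(k, s) (l, t).
        ((k + (if s then - l else l) + (if s \<and> t then int n else 0)) mod (2 * int n), s \<noteq> t)),
      one = (0, False)\<rparr>"

abbreviation Dic12 :: "(int \<times> bool) monoid" where
  "Dic12 \<equiv> dicyclic_group 3"

text \<open>The wreath product \<open>H \<wr> Sym\<^sub>n = H\<^sup>n \<rtimes> Sym\<^sub>n\<close>, where a permutation \<open>\<pi>\<close> sends the
  \<open>i\<close>-th factor of \<open>H\<^sup>n\<close> to the \<open>\<pi> i\<close>-th one.\<close>

definition wreath_sym ::
    "('h, 'm) monoid_scheme \<Rightarrow> nat \<Rightarrow> ((nat \<Rightarrow> 'h) \<times> (nat \<Rightarrow> nat)) monoid" where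
  "wreath_sym H n =
     \<lparr>carrier = ({1..n} \<rightarrow>\<^sub>E carrier H) \<times> carrier (sym_group n),
      monoid.mult = (\<lambda>(f, \<pi>) (g, \<sigma>).
        (\<lambda>i\<in>{1..n}. f i \<otimes>\<^bsub>H\<^esub> g (inv_into UNIV \<pi> i), \<pi> \<otimes>\<^bsub>sym_group n\<^esub> \<sigma>)),
      one = (\<lambda>i\<in>{1..n}. \<one>\<^bsub>H\<^esub>, \<one>\<^bsub>sym_group n\<^esub>)\<rparr>"

end

theory Submission
  imports Defs
begin

text \<open>An imprimitive absolutely irreducible group permutes three lines of \<open>\<D>\<^sup>3\<close> transitively, so it is
  monomial with entries in a finite group \<open>H\<close> of nonzero quaternions, noncommutative since \<open>G\<close> spans
  \<open>M\<^sub>3(\<D>)\<close>. Elements of \<open>H\<close> have reduced norm 1 and reduced trace in \<open>{-2, \<dots>, 2}\<close>, and the trace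
  form then leaves two possibilities: either \<open>H\<close> lies in the group of 24 Hurwitz units, which is
  \<open>SL\<^sub>2(3)\<close> and forces \<open>\<D> = (-1, -1)\<close>, or \<open>H\<close> lies in a dicyclic group of order 12 and
  \<open>\<D> = (-1, -3)\<close>. In both cases all monomial matrices over the larger group form a finite group
  containing \<open>G\<close>, and maximality makes it equal to \<open>G\<close>.\<close>

section \<open>Rational quaternion algebras\<close>

text \<open>Transitivity comes from absolute irreducibility: the rational span of the orbit of any
  nonzero row is the whole space. All summands are then alike, so one of dimension 2 would need
  another beside it, giving 4 independent rows; hence lines. Taking the three basis rows in a single
  orbit of \<open>G\<close> puts all matrix entries into one group \<open>H\<close>, the scalars by
  which \<open>G\<close> acts on the first line. \<open>H\<close> itself is never determined. After
  adjoining -1, the dividing question is whether it contains two anticommuting square roots of -1.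
  If so, traces against them make the doubled coordinates integers; if not, there is an element
  \<open>w\<close> of order 6, and projecting to \<open>\<rat>(w)\<close> leaves only its powers and
  elements that invert it. Ramification is the other obstacle: \<open>division_over\<close> asserts
  that some presentation works, so a prime is unramified only after every presentation is excluded,
  and the field is a quotient of Cauchy sequences, so one computes on representatives. Zeros of norm
  forms come from Hensel lifting, their absence from a congruence modulo \<open>p ^ 3\<close> and
  descent.\<close>

locale rational_algebra = vector_space scale
  for scale :: "rat \<Rightarrow> 'd::ring_1 \<Rightarrow> 'd" +
  assumes scale_mult_left: "scale c x * y = scale c (x * y)"
    and scale_mult_right: "x * scale c y = scale c (x * y)"
begin

definition quat :: "'d \<Rightarrow> 'd \<Rightarrow> rat \<Rightarrow> rat \<Rightarrow> rat \<Rightarrow> rat \<Rightarrow> 'd" where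
  "quat i j t x y z = scale t 1 + scale x i + scale y j + scale z (i * j)"

lemma quat_mult:
  assumes ii: "i * i = scale a 1" and jj: "j * j = scale b 1" and ji: "j * i = - (i * j)"
  shows "quat i j t x y z * quat i j t' x' y' z' =
    quat i j (t * t' + a * x * x' + b * y * y' - a * b * z * z')
      (t * x' + x * t' + b * z * y' - b * y * z')
      (t * y' + y * t' + a * x * z' - a * z * x')
      (t * z' + z * t' + x * y' - y * x')"
proof -
  have iij: "i * (i * j) = scale a j"
    by (simp add: mult.assoc[symmetric] ii scale_mult_left)
  have jij: "j * (i * j) = scale (- b) i"
    using ji jj by (simp add: mult.assoc[symmetric]) (simp add: mult.assoc scale_mult_right)
  have iji: "i * j * i = scale (- a) j"
    using ji by (simp add: mult.assoc iij)
  have ijj: "i * j * j = scale b i"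
    by (simp add: mult.assoc jj scale_mult_right)
  have ijij: "i * j * (i * j) = scale (- (a * b)) 1"
    by (simp add: mult.assoc jij scale_mult_right ii mult.commute)
  show ?thesis
    unfolding quat_def
    by (simp only: distrib_left distrib_right scale_mult_left scale_mult_right ii jj ji iij jij iji
        ijj ijij mult_1_left mult_1_right scale_scale scale_minus_right scale_left_distrib
        scale_left_diff_distrib scale_minus_left)
      (simp add: algebra_simps)
qed

end

text \<open>Definiteness is used through the signs of \<open>a\<close> and \<open>b\<close>, which
  make all four terms of the norm form nonnegative. The passage from the real place to these signs
  is \<open>real_quaternions_definite\<close>.\<close>

locale definite_quaternions = rational_algebra scale
  for scale :: "rat \<Rightarrow> 'd::ring_1 \<Rightarrow> 'd" +
  fixes a b :: rat and i j :: 'd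
  assumes generators: "quaternion_generators scale a b i j" and neg: "a < 0" "b < 0"
begin

lemma relations: "i * i = scale a 1" "j * j = scale b 1" "j * i = - (i * j)"
  using generators unfolding quaternion_generators_def by auto

lemmas qmult = quat_mult[OF relations]

lemma bij_quat: "bij (\<lambda>(t, x, y, z). quat i j t x y z)"
  using generators unfolding quaternion_generators_def quat_def by auto

lemma quat_eq_iff: "quat i j t x y z = quat i j t' x' y' z' \<longleftrightarrow> t = t' \<and> x = x' \<and> y = y' \<and> z = z'"
  using bij_is_inj[OF bij_quat, THEN inj_eq, of "(t, x, y, z)" "(t', x', y', z')"] by simp

lemma quat_cases: obtains t x y z where "d = quat i j t x y z"
  using bij_is_surj[OF bij_quat] by (metis (no_types, lifting) case_prod_conv surj_def surj_pair)

text \<open>A description by coordinates is unambiguous because 1, \<open>i\<close>,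
  \<open>j\<close>, \<open>i * j\<close> is a basis (\<open>quat_eq_iff\<close>). Identities for
  trace, norm and conjugate thus become coordinate computations with
  \<open>quat_simps\<close>.\<close>

definition trd :: "'d \<Rightarrow> rat" where
  "trd d = (THE s. \<exists>t x y z. d = quat i j t x y z \<and> s = 2 * t)"

definition nrd :: "'d \<Rightarrow> rat" where
  "nrd d = (THE s. \<exists>t x y z. d = quat i j t x y z \<and>
     s = t * t - a * x * x - b * y * y + a * b * z * z)"

definition conjq :: "'d \<Rightarrow> 'd" where
  "conjq d = (THE s. \<exists>t x y z. d = quat i j t x y z \<and> s = quat i j t (- x) (- y) (- z))"

lemma trd_quat: "trd (quat i j t x y z) = 2 * t"
  unfolding trd_def by (rule the_equality) (auto simp: quat_eq_iff)

lemma nrd_quat: "nrd (quat i j t x y z) = t * t - a * x * x - b * y * y + a * b * z * z"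
  unfolding nrd_def by (rule the_equality) (auto simp: quat_eq_iff)

lemma conjq_quat: "conjq (quat i j t x y z) = quat i j t (- x) (- y) (- z)"
  unfolding conjq_def by (rule the_equality) (auto simp: quat_eq_iff)

lemma quat_add: "quat i j t x y z + quat i j t' x' y' z' = quat i j (t + t') (x + x') (y + y') (z + z')"
  by (simp add: quat_def algebra_simps)

lemma quat_scale: "scale c (quat i j t x y z) = quat i j (c * t) (c * x) (c * y) (c * z)"
  by (simp add: quat_def algebra_simps)

lemma scale_one_quat: "scale c 1 = quat i j c 0 0 0"
  by (simp add: quat_def)

lemma zero_quat: "0 = quat i j 0 0 0 0" and one_quat: "1 = quat i j 1 0 0 0"
  by (simp_all add: quat_def)

lemma quat_uminus: "- quat i j t x y z = quat i j (- t) (- x) (- y) (- z)"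
  by (simp add: quat_def algebra_simps)

lemmas quat_simps = quat_add quat_scale quat_uminus trd_quat nrd_quat conjq_quat qmult quat_eq_iff

lemma trd_add: "trd (d + e) = trd d + trd e"
  by (cases d rule: quat_cases, cases e rule: quat_cases) (simp add: quat_simps)

lemma trd_scale: "trd (scale c d) = c * trd d"
  by (cases d rule: quat_cases) (simp add: quat_simps)

lemma trd_uminus: "trd (- d) = - trd d"
  by (cases d rule: quat_cases) (simp add: quat_simps)

lemma trd_diff: "trd (d - e) = trd d - trd e"
  using trd_add[of d "- e"] by (simp add: trd_uminus)

lemma trd_one: "trd 1 = 2"
  by (simp add: one_quat quat_simps)

lemma trd_mult_commute: "trd (d * e) = trd (e * d)"
  by (cases d rule: quat_cases, cases e rule: quat_cases) (simp add: quat_simps)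

lemma conjq_mult: "conjq (d * e) = conjq e * conjq d"
  by (cases d rule: quat_cases, cases e rule: quat_cases) (simp add: quat_simps)

lemma add_conjq: "d + conjq d = scale (trd d) 1"
  by (cases d rule: quat_cases) (simp add: quat_simps scale_one_quat)

lemma conjq_eq: "conjq d = scale (trd d) 1 - d"
  using add_conjq[of d] by (simp add: algebra_simps)

lemma mult_conjq: "d * conjq d = scale (nrd d) 1" and conjq_mult_self: "conjq d * d = scale (nrd d) 1"
  by (cases d rule: quat_cases, simp add: quat_simps scale_one_quat algebra_simps)+

lemma nrd_one: "nrd 1 = 1"
  by (simp add: one_quat quat_simps)

lemma nrd_mult: "nrd (d * e) = nrd d * nrd e"
  by (cases d rule: quat_cases, cases e rule: quat_cases) (simp add: quat_simps algebra_simps)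

lemma nrd_terms_nonneg:
  fixes x y z :: rat
  shows "0 \<le> - a * x * x" "0 \<le> - b * y * y" "0 \<le> a * b * z * z"
proof -
  have "0 \<le> - a" "0 \<le> - b" "0 \<le> a * b"
    using neg by (simp_all add: mult_nonpos_nonpos)
  then have "0 \<le> - a * (x * x)" "0 \<le> - b * (y * y)" "0 \<le> a * b * (z * z)"
    using zero_le_square[of x] zero_le_square[of y] zero_le_square[of z]
    by (blast intro: mult_nonneg_nonneg)+
  then show "0 \<le> - a * x * x" "0 \<le> - b * y * y" "0 \<le> a * b * z * z"
    by (simp_all add: mult.assoc)
qed

lemma nrd_nonneg: "0 \<le> nrd d"
proof (cases d rule: quat_cases)
  case (1 t x y z)
  then show ?thesis using nrd_terms_nonneg(1)[of x] nrd_terms_nonneg(2)[of y] nrd_terms_nonneg(3)[of z] zero_le_square[of t]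
    unfolding 1 nrd_quat by linarith
qed

lemma nrd_eq_0_iff: "nrd d = 0 \<longleftrightarrow> d = 0"
proof (cases d rule: quat_cases)
  case (1 t x y z)
  show ?thesis
  proof
    assume "nrd d = 0"
    then have *: "t * t - a * x * x - b * y * y + a * b * z * z = 0" using 1 by (simp add: nrd_quat)
    from * nrd_terms_nonneg(1)[of x] nrd_terms_nonneg(2)[of y] nrd_terms_nonneg(3)[of z] zero_le_square[of t]
    have "t * t = 0" "- a * x * x = 0" "- b * y * y = 0" "a * b * z * z = 0" by linarith+
    then show "d = 0" using 1 neg by (simp add: zero_quat)
  qed (simp add: zero_quat nrd_quat)
qed

text \<open>The discriminant of the reduced characteristic polynomial is not positive. For norm 1
  this bounds the trace by 2.\<close>

lemma trd_square_le: "trd d * trd d \<le> 4 * nrd d"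
proof (cases d rule: quat_cases)
  case (1 t x y z)
  then show ?thesis using nrd_terms_nonneg(1)[of x] nrd_terms_nonneg(2)[of y] nrd_terms_nonneg(3)[of z] by (simp add: nrd_quat trd_quat)
qed

lemma nrd_diff_scalar: "nrd (d - scale c 1) = nrd d - c * trd d + c * c"
proof -
  have "d - scale c 1 = d + scale (- c) 1" by simp
  then show ?thesis
    by (cases d rule: quat_cases) (simp only: scale_one_quat quat_simps, simp add: algebra_simps)
qed

text \<open>Cayley-Hamilton for quaternions. In norm 1 it turns traces into relations: trace 0 means
  \<open>d * d = - 1\<close> and trace 1 means \<open>d * d = d - 1\<close>.\<close>

lemma square_eq: "d * d = scale (trd d) d - scale (nrd d) 1"
proof -
  have "d = scale (trd d) 1 - conjq d" using conjq_eq[of d] by simp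
  then have "d * d = d * (scale (trd d) 1 - conjq d)" by simp
  then show ?thesis by (simp add: right_diff_distrib mult_conjq scale_mult_right)
qed

lemma mult_eq_0_iff: "d * e = 0 \<longleftrightarrow> d = 0 \<or> e = (0 :: 'd)"
  using nrd_eq_0_iff[of "d * e"] by (auto simp: nrd_mult nrd_eq_0_iff)

lemma inverse_exists:
  fixes d :: 'd
  assumes "d \<noteq> 0" shows "\<exists>e. d * e = 1 \<and> e * d = 1"
proof -
  have "nrd d \<noteq> 0" using assms nrd_eq_0_iff by simp
  then show ?thesis
    by (intro exI[of _ "scale (inverse (nrd d)) (conjq d)"])
      (simp add: scale_mult_left scale_mult_right mult_conjq conjq_mult_self)
qed

lemma scale_one_eq_iff: "scale c 1 = scale e (1::'d) \<longleftrightarrow> c = e"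
  by (simp add: scale_one_quat quat_eq_iff)

lemma noncommutative: "i * j \<noteq> j * i"
proof
  assume "i * j = j * i"
  then have "i * j + i * j = 0" using relations(3) by (simp add: eq_neg_iff_add_eq_0)
  then have "quat i j 0 0 0 2 = quat i j 0 0 0 0"
    by (simp add: quat_def scale_left_distrib[of 1 1, simplified])
  then show False by (simp add: quat_eq_iff)
qed

text \<open>Conjugation by \<open>v\<close> preserves the trace and sends \<open>u\<close> to
  \<open>- u\<close>; \<open>v\<close> is invertible because its square is a nonzero scalar.\<close>

lemma trd_generator:
  assumes "v * v = scale e 1" "e \<noteq> 0" "v * u = - (u * v)"
  shows "trd u = 0"
proof -
  have "trd (v * (u * v)) = e * trd u"
    using assms(1) by (simp add: trd_mult_commute[of v] mult.assoc scale_mult_right trd_scale)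
  moreover have "trd (v * (u * v)) = trd (- (u * v * v))"
    using assms(3) by (simp add: mult.assoc[symmetric])
  moreover have "trd (- (u * v * v)) = - (e * trd u)"
    using assms(1) by (simp add: mult.assoc scale_mult_right trd_uminus trd_scale)
  ultimately show ?thesis using assms(2) by simp
qed

text \<open>Quaternion conjugation is negation on trace 0 elements and reverses products, so
  \<open>u * g\<close> is the conjugate of \<open>g * u\<close>, and the sum of the two is a
  trace.\<close>

lemma anticommute:
  assumes "trd g = 0" "trd u = 0" "trd (g * u) = 0"
  shows "g * u = - (u * g)"
proof -
  have "conjq (g * u) = u * g" by (simp only: conjq_mult) (simp add: conjq_eq assms)
  then show ?thesis using add_conjq[of "g * u"] assms by (simp add: eq_neg_iff_add_eq_0)
qed

section \<open>Other generators of the same algebra\<close>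

context
  fixes c e u v
  assumes uu: "u * u = scale c 1" and vv: "v * v = scale e 1" and vu: "v * u = - (u * v)"
    and c: "c < 0" and e: "e < 0"
begin

lemma trd_quat': "trd (quat u v t x y z) = 2 * t"
proof -
  have u: "trd u = 0" using trd_generator[OF vv _ vu] e by simp
  have uv: "u * v = - (v * u)" using vu by simp
  have v: "trd v = 0" using trd_generator[OF uu _ uv] c by simp
  have "trd (v * u) = - trd (u * v)" by (simp add: vu trd_uminus)
  then have "trd (u * v) = 0" using trd_mult_commute[of u v] by simp
  then show ?thesis using u v by (simp add: quat_def trd_add trd_scale trd_one)
qed

lemma trd_quat_mult':
  "trd (quat u v t x y z * u) = 2 * (c * x)"
  "trd (quat u v t x y z * v) = 2 * (e * y)"
  "trd (quat u v t x y z * (u * v)) = - 2 * (c * e * z)"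
proof -
  have "u = quat u v 0 1 0 0" "v = quat u v 0 0 1 0" "u * v = quat u v 0 0 0 1"
    by (simp_all add: quat_def)
  then have "trd (quat u v t x y z * u) = trd (quat u v t x y z * quat u v 0 1 0 0)"
    "trd (quat u v t x y z * v) = trd (quat u v t x y z * quat u v 0 0 1 0)"
    "trd (quat u v t x y z * (u * v)) = trd (quat u v t x y z * quat u v 0 0 0 1)"
    by simp_all
  then show "trd (quat u v t x y z * u) = 2 * (c * x)"
    "trd (quat u v t x y z * v) = 2 * (e * y)"
    "trd (quat u v t x y z * (u * v)) = - 2 * (c * e * z)"
    by (simp_all only: quat_mult[OF uu vv vu] trd_quat') simp_all
qed

text \<open>The difference \<open>g\<close> of both sides is trace-orthogonal to 1,
  \<open>u\<close>, \<open>v\<close> and \<open>u * v\<close>, hence anticommutes with the last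
  three. But anticommuting with \<open>u\<close> and \<open>v\<close> means commuting with
  \<open>u * v\<close>, so \<open>g = 0\<close>. This replaces a dimension count.\<close>

lemma orthogonal_expansion:
  "d = quat u v (trd d / 2) (trd (d * u) / (2 * c)) (trd (d * v) / (2 * e)) (- trd (d * (u * v)) / (2 * (c * e)))"
proof -
  define g where "g = d - quat u v (trd d / 2) (trd (d * u) / (2 * c)) (trd (d * v) / (2 * e))
    (- trd (d * (u * v)) / (2 * (c * e)))"
  have g: "trd g = 0" "trd (g * u) = 0" "trd (g * v) = 0" "trd (g * (u * v)) = 0"
    using c e by (simp_all add: g_def left_diff_distrib trd_diff trd_quat' trd_quat_mult')
  have t: "trd u = 0" "trd v = 0" "trd (u * v) = 0"
    using trd_quat'[of 0 1 0 0] trd_quat'[of 0 0 1 0] trd_quat'[of 0 0 0 1] by (simp_all add: quat_def)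
  have "g * (u * v) = - (u * g) * v"
    using anticommute[OF g(1) t(1) g(2)] by (simp add: mult.assoc[symmetric])
  also have "\<dots> = u * v * g" using anticommute[OF g(1) t(2) g(3)] by (simp add: mult.assoc)
  finally have "u * v * g = - (u * v * g)" using anticommute[OF g(1) t(3) g(4)] by simp
  then have "scale 2 (u * v * g) = 0"
    by (metis add.left_inverse one_add_one scale_left_distrib scale_one)
  then have "u * v * g = 0" by simp
  moreover have "u \<noteq> 0" "v \<noteq> 0" using uu vv c e by auto
  ultimately have "g = 0" by (auto simp: mult_eq_0_iff)
  then show ?thesis by (simp add: g_def)
qed

text \<open>Surjectivity is the expansion above; injectivity holds because each coordinate can be
  read off as a trace.\<close>

lemma generators': "quaternion_generators scale c e u v"
proof -
  have "bij (\<lambda>(t, x, y, z). quat u v t x y z)"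
  proof (rule bijI)
    show "surj (\<lambda>(t, x, y, z). quat u v t x y z)"
    proof (rule surjI)
      show "(\<lambda>(t, x, y, z). quat u v t x y z) (trd d / 2, trd (d * u) / (2 * c),
        trd (d * v) / (2 * e), - trd (d * (u * v)) / (2 * (c * e))) = d" for d
        using orthogonal_expansion[of d] by simp
    qed
    show "inj (\<lambda>(t, x, y, z). quat u v t x y z)"
    proof (rule injI)
      fix p q :: "rat \<times> rat \<times> rat \<times> rat"
      assume pq: "(case p of (t, x, y, z) \<Rightarrow> quat u v t x y z) = (case q of (t, x, y, z) \<Rightarrow> quat u v t x y z)"
      obtain t x y z t' x' y' z' where p: "p = (t, x, y, z)" and q: "q = (t', x', y', z')"
        by (metis prod_cases4)
      have eq: "quat u v t x y z = quat u v t' x' y' z'" using pq p q by simp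
      have "2 * t = 2 * t'" using arg_cong[OF eq, of trd] by (simp only: trd_quat')
      moreover have "2 * (c * x) = 2 * (c * x')"
        using arg_cong[OF eq, of "\<lambda>d. trd (d * u)"] by (simp only: trd_quat_mult')
      moreover have "2 * (e * y) = 2 * (e * y')"
        using arg_cong[OF eq, of "\<lambda>d. trd (d * v)"] by (simp only: trd_quat_mult')
      moreover have "- 2 * (c * e * z) = - 2 * (c * e * z')"
        using arg_cong[OF eq, of "\<lambda>d. trd (d * (u * v))"] by (simp only: trd_quat_mult')
      ultimately show "p = q" using c e p q by simp
    qed
  qed
  then show ?thesis using c e uu vv vu by (simp add: quaternion_generators_def quat_def)
qed

end

end

lemma (in definite_quaternions) change_generators:
  assumes "u * u = scale c 1" "v * v = scale e 1" "v * u = - (u * v)" "c < 0" "e < 0"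
  shows "definite_quaternions scale c e u v"
  using rational_algebra_axioms generators'[OF assms] assms(4,5)
  unfolding definite_quaternions_def definite_quaternions_axioms_def by blast

section \<open>Finite groups of quaternions\<close>

locale finite_quaternion_group = definite_quaternions scale a b i j
  for scale :: "rat \<Rightarrow> 'd::ring_1 \<Rightarrow> 'd" and a b i j +
  fixes H :: "'d set"
  assumes fin: "finite H" and closed: "\<And>x y. x \<in> H \<Longrightarrow> y \<in> H \<Longrightarrow> x * y \<in> H"
    and one: "1 \<in> H" and zero: "0 \<notin> H"
begin

lemma power_closed: "h \<in> H \<Longrightarrow> h ^ n \<in> H"
  by (induction n) (auto simp: one closed)

text \<open>A positive rational with only finitely many powers is 1, and the norm of a nonzero
  element is positive by definiteness.\<close>

lemma nrd_finite: assumes "h \<in> H" shows "nrd h = 1"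
proof -
  have nrd_power: "nrd (h ^ n) = nrd h ^ n" for n
    by (induction n) (simp_all add: nrd_one nrd_mult)
  have "range (\<lambda>n. nrd h ^ n) \<subseteq> nrd ` H"
    using power_closed[OF assms] by (auto simp: nrd_power[symmetric])
  then have "finite (range (\<lambda>n. nrd h ^ n))" using fin finite_surj by blast
  then have "\<not> inj (\<lambda>n. nrd h ^ n)" using range_inj_infinite by blast
  then obtain m n where "m \<noteq> n" "nrd h ^ m = nrd h ^ n" by (auto simp: inj_def)
  then obtain m n where mn: "m < n" "nrd h ^ m = nrd h ^ n" by (metis nat_neq_iff)
  have pos: "0 < nrd h" using assms zero nrd_nonneg[of h] nrd_eq_0_iff[of h] by (metis order_le_less)
  have "nrd h ^ m * nrd h ^ (n - m) = nrd h ^ m * 1"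
    by (subst power_add[symmetric]) (use mn in simp)
  then have "nrd h ^ (n - m) = 1" using pos by (subst (asm) mult_left_cancel) auto
  then show ?thesis using mn pos power_eq_imp_eq_base[of "nrd h" "n - m" 1] by simp
qed

text \<open>A finite cancellative monoid contains inverses, and in norm 1 the inverse is the
  conjugate.\<close>

lemma conjq_closed: assumes "h \<in> H" shows "conjq h \<in> H"
proof -
  have "inj_on ((*) h) H"
  proof (rule inj_onI)
    fix x y assume "h * x = h * y"
    then have "h * (x - y) = 0" by (simp add: right_diff_distrib)
    then show "x = y" using assms zero by (auto simp: mult_eq_0_iff)
  qed
  then have "(*) h ` H = H" using fin assms closed
    by (intro endo_inj_surj) auto
  then obtain k where k: "k \<in> H" "h * k = 1" using one by (metis imageE)
  have "conjq h * (h * k) = k"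
    by (simp add: mult.assoc[symmetric] conjq_mult_self nrd_finite[OF assms] )
  then show ?thesis using k by simp
qed

text \<open>Squaring an element replaces its trace \<open>t\<close> by \<open>t\<^sup>2 - 2\<close>, which squares the denominator
  of \<open>t\<close>; the largest denominator of a trace is therefore 1.\<close>

lemma trd_finite:
  assumes "h \<in> H" obtains m :: int where "trd h = of_int m" "\<bar>m\<bar> \<le> 2"
proof -
  define den where "den x = snd (quotient_of x)" for x :: rat
  define M where "M = Max ((\<lambda>h. den (trd h)) ` H)"
  have den_pos: "den x > 0" for x by (simp add: den_def quotient_of_denom_pos')
  \<comment> \<open>If \<open>x = p / q\<close> in lowest terms, then
    \<open>(p * p - 2 * (q * q)) / (q * q)\<close> is again in lowest terms, since the numerator is
    congruent to \<open>p * p\<close> modulo \<open>q\<close>.\<close>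
  have den_square: "den (x * x - 2) = den x * den x" for x
  proof -
    obtain p q where pq: "quotient_of x = (p, q)" by (cases "quotient_of x")
    have q: "q > 0" "coprime p q" "x = of_int p / of_int q"
      using pq quotient_of_denom_pos quotient_of_coprime quotient_of_div by blast+
    have "x * x - 2 = of_int (p * p - 2 * (q * q)) / of_int (q * q)"
      using q by (simp add: field_simps)
    also have "\<dots> = Rat.Fract (p * p - 2 * (q * q)) (q * q)" by (rule Fract_of_int_quotient[symmetric])
    finally have eq: "x * x - 2 = Rat.Fract (p * p - 2 * (q * q)) (q * q)" .
    have "coprime (p * p) (q * q)" using q by simp
    then have "coprime (p * p - 2 * (q * q)) (q * q)"
      by (metis coprime_iff_gcd_eq_1 gcd_diff1 gcd_add_mult diff_add_cancel gcd.commute add.commute)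
    then have "Rat.normalize (p * p - 2 * (q * q), q * q) = (p * p - 2 * (q * q), q * q)"
      using q by (intro normalize_stable) auto
    then show ?thesis using pq by (simp add: den_def eq quotient_of_Fract)
  qed
  have "M \<in> (\<lambda>h. den (trd h)) ` H" unfolding M_def using fin one by (intro Max_in) auto
  then obtain k where k: "k \<in> H" "M = den (trd k)" by auto
  have "trd (k * k) = trd k * trd k - 2"
    by (subst square_eq) (simp add: trd_diff trd_scale trd_one nrd_finite[OF k(1)])
  then have "M * M = den (trd (k * k))" using den_square k by simp
  also have "\<dots> \<le> M" unfolding M_def using fin closed k by (intro Max_ge) auto
  finally have "M \<le> 1" using den_pos[of "trd k"] k(2) by simp
  moreover have "den (trd h) \<le> M" unfolding M_def using fin assms by (intro Max_ge) auto
  ultimately have "den (trd h) = 1" using den_pos[of "trd h"] by linarith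
  then obtain m where m: "quotient_of (trd h) = (m, 1)"
    by (metis den_def prod.collapse)
  then have tr: "trd h = of_int m" using quotient_of_div[OF m] by simp
  have "of_int (m * m) \<le> (of_int 4 :: rat)"
    using trd_square_le[of h] nrd_finite[OF assms] tr by simp
  then have "m * m \<le> 2 * 2" by (simp only: of_int_le_iff)
  then have "\<bar>m\<bar> * \<bar>m\<bar> \<le> 2 * 2" by (simp only: abs_mult_self_eq)
  then have "\<bar>m\<bar> \<le> 2" using mult_strict_mono[of 2 "\<bar>m\<bar>" 2 "\<bar>m\<bar>"] by linarith
  then show ?thesis using that tr by blast
qed

lemma trd_cases:
  assumes "h \<in> H" shows "trd h \<in> {-2, -1, 0, 1, 2}"
proof -
  obtain m :: int where m: "trd h = of_int m" "\<bar>m\<bar> \<le> 2" using trd_finite[OF assms] .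
  then have "m \<in> {-2, -1, 0, 1, 2}" by auto
  then show ?thesis using m by auto
qed

end

section \<open>Elements of order 6 and the hexagonal lattice\<close>

definition dic_elt :: "'d::ring_1 \<Rightarrow> 'd \<Rightarrow> int \<times> bool \<Rightarrow> 'd" where
  "dic_elt w y = (\<lambda>(k, s). w ^ nat k * (if s then y else 1))"

context definite_quaternions
begin

context
  fixes w
  assumes trw: "trd w = 1" and ww: "w * w = w - 1"
begin

text \<open>Orthogonal projection to \<open>\<rat>(w)\<close>, where \<open>w\<close> is a primitive
  sixth root of unity with conjugate \<open>1 - w\<close>. The Gram matrix of 1 and \<open>w\<close>
  for the trace form has rows (2, 1) and (1, 2); its inverse is the source of the thirds. The
  remainder \<open>g\<close> is orthogonal to 1 and \<open>w\<close>, which gives both the twisted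
  commutation and Pythagoras for the norms.\<close>

lemma eisenstein_projection:
  obtains g where
    "h = scale ((2 * trd h - trd (h * (1 - w))) / 3) 1 + scale ((2 * trd (h * (1 - w)) - trd h) / 3) w + g"
    "trd g = 0" "g * w = (1 - w) * g"
    "nrd g = nrd h - (trd h * trd h - trd h * trd (h * (1 - w)) + trd (h * (1 - w)) * trd (h * (1 - w))) / 3"
proof -
  define m n where "m = trd h" and "n = trd (h * (1 - w))"
  have hw: "trd (h * w) = m - n" by (simp add: m_def n_def right_diff_distrib trd_diff)
  define s t where "s = (2 * m - n) / 3" and "t = (2 * n - m) / 3"
  define g where "g = h - scale s 1 - scale t w"
  have trww: "trd (w * w) = - 1" by (simp add: ww trd_diff trw trd_one)
  have g0: "trd g = 0"
    by (simp add: g_def trd_diff trd_scale trw trd_one) (simp add: s_def t_def m_def[symmetric] field_simps)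
  have gw: "trd (g * w) = 0"
    by (simp add: g_def left_diff_distrib trd_diff scale_mult_left trd_scale trw trww hw)
      (simp add: s_def t_def field_simps)
  have "conjq (g * w) = (1 - w) * - g"
    by (simp only: conjq_mult) (simp add: conjq_eq trw g0)
  then have gw': "g * w = (1 - w) * g" using add_conjq[of "g * w"] gw by simp
  have "trd (g * g) = trd (g * h)"
    by (subst (2) g_def) (simp add: right_diff_distrib trd_diff scale_mult_right trd_scale g0 gw)
  also have "\<dots> = trd (h * h) - s * m - t * (m - n)"
    by (simp add: g_def left_diff_distrib trd_diff scale_mult_left trd_scale m_def[symmetric] trd_mult_commute[of w h] hw)
  also have "trd (h * h) = m * m - 2 * nrd h"
    by (subst square_eq) (simp add: trd_diff trd_scale trd_one m_def)
  finally have "trd (g * g) = m * m - 2 * nrd h - s * m - t * (m - n)" .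
  moreover have "trd (g * g) = - 2 * nrd g"
    by (subst square_eq) (simp add: trd_uminus trd_scale trd_one g0)
  ultimately have "nrd g = nrd h - (m * m - m * n + n * n) / 3"
    by (simp add: s_def t_def field_simps)
  then show ?thesis using that[of g] g0 gw' by (simp add: g_def s_def t_def m_def n_def)
qed

end

end

text \<open>Closure under negation lets the sign of a trace be changed, so that traces 1 and -1 need
  no separate treatment. A given group is enlarged by its negatives before this locale is applied to
  it.\<close>

locale finite_symmetric_quaternion_group = finite_quaternion_group +
  assumes uminus: "\<And>x. x \<in> H \<Longrightarrow> - x \<in> H"
begin

lemma square_eq_minus_one: "u \<in> H \<Longrightarrow> trd u = 0 \<Longrightarrow> u * u = - 1"
  by (subst square_eq) (simp add: nrd_finite)

lemma orthogonal_pair: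
  assumes "u \<in> H" "v \<in> H" "trd u = 0" "trd v = 0" "trd (u * v) = 0"
  shows "\<exists>u\<in>H. \<exists>v\<in>H. u * u = - 1 \<and> v * v = - 1 \<and> v * u = - (u * v)"
  using assms anticommute[of u v] square_eq_minus_one by (intro bexI[of _ u] bexI[of _ v]) auto

lemma eq_one: assumes "h \<in> H" "trd h = 2" shows "h = 1"
  using nrd_diff_scalar[of h 1] nrd_finite[OF assms(1)] assms(2) nrd_eq_0_iff[of "h - 1"] by simp

lemma eq_minus_one: assumes "h \<in> H" "trd h = - 2" shows "h = - 1"
  using eq_one[of "- h"] uminus[OF assms(1)] assms(2) by (simp add: trd_uminus minus_equation_iff)

text \<open>Conjugation by \<open>w\<close> is a rotation of order 3, and the condition on
  \<open>trd (k * w)\<close> puts the axes of \<open>k\<close> and \<open>w\<close> at the angle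
  between an edge and a diagonal of a cube. The rotated element \<open>w * k * (1 - w)\<close> is
  therefore orthogonal to \<open>k\<close>.\<close>

lemma orthogonal_pair_of_order_3:
  assumes w: "w \<in> H" "trd w = 1" "w * w = w - 1" and k: "k \<in> H" "trd k = 0" "trd (k * w) \<in> {1, -1}"
  shows "\<exists>u\<in>H. \<exists>v\<in>H. u * u = - 1 \<and> v * v = - 1 \<and> v * u = - (u * v)"
proof -
  have kk: "k * k = - 1" using square_eq_minus_one k by simp
  have w': "1 - w \<in> H" using conjq_closed[OF w(1)] w(2) by (simp add: conjq_eq)
  have "(1 - w) * w = 1" using w(3) by (simp add: left_diff_distrib)
  then have "trd (w * k * (1 - w)) = 0"
    using trd_mult_commute[of w "k * (1 - w)"] k(2) by (simp add: mult.assoc)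
  \<comment> \<open>This trace is \<open>trd (k * w * k) - trd (k * w * (k * w))\<close>, with value
    -1 - (1 - 2).\<close>
  moreover have "trd (k * (w * k * (1 - w))) = 0"
  proof -
    have "trd (k * w * k) = trd (k * k * w)"
      using trd_mult_commute[of "k * w" k] by (simp add: mult.assoc)
    then have "trd (k * w * k) = - 1" using kk w(2) by (simp add: trd_uminus)
    moreover have "trd (k * w * (k * w)) = trd (k * w) * trd (k * w) - 2"
      using nrd_finite[OF closed[OF k(1) w(1)]] by (subst square_eq) (simp add: trd_diff trd_scale trd_one)
    moreover have "k * (w * k * (1 - w)) = k * w * k - k * w * (k * w)"
      by (simp add: algebra_simps)
    ultimately show ?thesis using k(3) by (auto simp: trd_diff)
  qed
  ultimately show ?thesis using orthogonal_pair[of k "w * k * (1 - w)"] k w(1) w' closed by blast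
qed

text \<open>Without trace 1, hence without trace -1, all traces are -2, 0 or 2, and the extreme
  values occur only at the central elements -1 and 1. So \<open>x\<close>, \<open>y\<close> and
  \<open>x * y\<close> have trace 0, which makes \<open>x\<close>, \<open>y\<close> an anticommuting
  pair.\<close>

lemma exists_order_6:
  assumes no_pair: "\<not> (\<exists>u\<in>H. \<exists>v\<in>H. u * u = - 1 \<and> v * v = - 1 \<and> v * u = - (u * v))"
    and xy: "x \<in> H" "y \<in> H" "x * y \<noteq> y * x"
  obtains w where "w \<in> H" "trd w = 1" "w * w = w - 1"
proof -
  have "\<exists>w\<in>H. trd w = 1"
  proof (rule ccontr)
    assume no: "\<not> (\<exists>w\<in>H. trd w = 1)"
    have tr: "trd h \<in> {-2, 0, 2}" if "h \<in> H" for h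
      using trd_cases[OF that] no that uminus[OF that] trd_uminus[of h] by force
    have x0: "trd x = 0" and y0: "trd y = 0"
      using tr[OF xy(1)] tr[OF xy(2)] eq_one eq_minus_one xy by force+
    \<comment> \<open>If \<open>x * y\<close> were 1 or -1, this would make \<open>y\<close> equal
      to \<open>x\<close> up to sign, and the two would commute.\<close>
    have y: "y = - (x * (x * y))"
      using square_eq_minus_one[OF xy(1) x0] by (simp add: mult.assoc[symmetric])
    have "x * y \<noteq> 1" "x * y \<noteq> - 1"
      using y xy(3) by (metis mult_1_right mult_minus_left mult_minus_right minus_minus)+
    then have "trd (x * y) = 0"
      using tr[OF closed[OF xy(1,2)]] eq_one eq_minus_one closed[OF xy(1,2)] by force
    then show False using orthogonal_pair[OF xy(1,2) x0 y0] no_pair by blast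
  qed
  then obtain w where w: "w \<in> H" "trd w = 1" by blast
  have "w * w = w - 1" by (subst square_eq) (simp add: w nrd_finite[OF w(1)])
  then show ?thesis using that w by blast
qed

text \<open>With respect to the trace form the orthogonal projections of elements of \<open>H\<close> to \<open>\<rat>(w)\<close> lie in
  the dual of the hexagonal lattice \<open>\<int>[w]\<close>, whose elements of norm at most 1 have norm 0, 1/3 or 1.\<close>

lemma hexagonal_dichotomy:
  assumes no_pair: "\<not> (\<exists>u\<in>H. \<exists>v\<in>H. u * u = - 1 \<and> v * v = - 1 \<and> v * u = - (u * v))"
    and w: "w \<in> H" "trd w = 1" "w * w = w - 1" and h: "h \<in> H"
  shows "h \<in> {1, w, w - 1, - 1, - w, 1 - w} \<or> trd h = 0 \<and> h * w = (1 - w) * h"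
proof -
  define m n where "m = trd h" and "n = trd (h * (1 - w))"
  have w': "1 - w \<in> H" using conjq_closed[OF w(1)] w(2) by (simp add: conjq_eq)
  have hw: "trd (h * w) = m - n" by (simp add: m_def n_def right_diff_distrib trd_diff)
  have cases: "m \<in> {-2, -1, 0, 1, 2}" "n \<in> {-2, -1, 0, 1, 2}"
    unfolding m_def n_def using trd_cases h closed[OF h w'] by blast+
  obtain g where g: "h = scale ((2 * m - n) / 3) 1 + scale ((2 * n - m) / 3) w + g"
    "trd g = 0" "g * w = (1 - w) * g" "nrd g = nrd h - (m * m - m * n + n * n) / 3"
    using eisenstein_projection[OF w(2,3), of h] unfolding m_def n_def by blast
  have nrdg: "nrd g = 1 - (m * m - m * n + n * n) / 3" using g(4) nrd_finite[OF h] by simp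
  have "m * m - m * n + n * n \<le> 3" using nrd_nonneg[of g] nrdg by simp
  \<comment> \<open>The cases are the values 0, 1 and 3 of \<open>m * m - m * n + n * n\<close>; the
    value 2 is not represented.\<close>
  then consider (zero) "m = 0" "n = 0" | (dual) "(m, n) \<in> {(0, 1), (0, -1), (1, 0), (-1, 0), (1, 1), (-1, -1)}"
    | (inside) "(m, n) \<in> {(1, 2), (2, 1), (1, -1), (-1, -2), (-2, -1), (-1, 1)}"
    using cases by auto
  then show ?thesis
  proof cases
    case zero
    then show ?thesis using g(1,2,3) by simp
  next
    case dual
    have "(1 - w) * w = 1" using w(3) by (simp add: left_diff_distrib)
    then have "h * (1 - w) * w = h" by (simp add: mult.assoc)
    moreover have "h * w * w = h * w - h" by (simp add: mult.assoc w(3) right_diff_distrib)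
    ultimately have tr: "trd (h * (1 - w) * w) = m" "trd (h * w * w) = - n"
      by (simp_all add: trd_diff hw m_def)
    consider "m = 0" "n \<in> {1, - 1}" | "n = 0" "m \<in> {1, - 1}" | "m = n" "n \<in> {1, - 1}"
      using dual by auto
    \<comment> \<open>Powers of \<open>w\<close> rotate the six shortest dual vectors: one of
      \<open>h\<close>, \<open>h * (1 - w)\<close>, \<open>h * w\<close> has trace 0, and its
      product with \<open>w\<close> has trace 1 or -1. The cube argument then yields the excluded
      pair.\<close>
    then have "\<exists>k\<in>H. trd k = 0 \<and> trd (k * w) \<in> {1, -1}"
    proof cases
      case 1
      then show ?thesis using h hw by (intro bexI[of _ h]) (auto simp: m_def)
    next
      case 2
      then show ?thesis using tr(1) closed[OF h w'] by (intro bexI[of _ "h * (1 - w)"]) (auto simp: n_def)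
    next
      case 3
      then show ?thesis using tr(2) hw closed[OF h w(1)] by (intro bexI[of _ "h * w"]) auto
    qed
    then show ?thesis using orthogonal_pair_of_order_3[OF w] no_pair by blast
  next
    case inside
    then have "nrd g = 0" using nrdg by auto
    then have "g = 0" by (simp add: nrd_eq_0_iff)
    then show ?thesis using inside g(1) by auto
  qed
qed

text \<open>If there is no anticommuting pair, every element is a power of \<open>w\<close> or
  conjugates \<open>w\<close> to its inverse, and the product of two elements of the second kind is
  of the first kind. So the powers of \<open>w\<close> and a single coset of them cover
  \<open>H\<close>.\<close>

theorem finite_noncommutative_cases:
  assumes xy: "x \<in> H" "y \<in> H" "x * y \<noteq> y * x"
  shows "(\<exists>u\<in>H. \<exists>v\<in>H. u * u = - 1 \<and> v * v = - 1 \<and> v * u = - (u * v)) \<or>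
    (\<exists>w y. w * w = w - 1 \<and> y * y = - 1 \<and> y * w = (1 - w) * y \<and> H \<subseteq> dic_elt w y ` ({0..<6} \<times> UNIV))"
proof (rule disjE[OF excluded_middle disjI2 disjI1])
  assume no_pair: "\<not> (\<exists>u\<in>H. \<exists>v\<in>H. u * u = - 1 \<and> v * v = - 1 \<and> v * u = - (u * v))"
  obtain w where w: "w \<in> H" "trd w = 1" "w * w = w - 1" using exists_order_6[OF no_pair xy] .
  let ?C = "{1, w, w - 1, - 1, - w, 1 - w}"
  note dich = hexagonal_dichotomy[OF no_pair w]
  have comm: "p * q = q * p" if "p \<in> ?C" "q \<in> ?C" for p q
    using that by (elim insertE emptyE; hypsubst; simp add: algebra_simps)
  have "\<not> H \<subseteq> ?C" using comm[of x y] xy by blast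
  then obtain y where y: "y \<in> H" "trd y = 0" "y * w = (1 - w) * y" using dich by blast
  have yy: "y * y = - 1" using square_eq_minus_one y by simp
  have coset: "h \<in> ?C \<or> (\<exists>c\<in>?C. h = c * y)" if h: "h \<in> H" for h
  proof (cases "h \<in> ?C")
    case False
    then have hw: "h * w = (1 - w) * h" using dich[OF h] by blast
    have "h * y * w = h * (1 - w) * y" by (simp add: mult.assoc y(3))
    also have "h * (1 - w) = w * h" using hw by (simp add: algebra_simps)
    also have "w * h * y = w * (h * y)" by (rule mult.assoc)
    finally have comm: "h * y * w = w * (h * y)" .
    have k: "- (h * y) \<in> H" using uminus closed h y(1) by blast
    \<comment> \<open>The element commutes with \<open>w\<close>; if it also inverted
      \<open>w\<close>, then \<open>w + w = 1\<close>, which contradicts the traces.\<close>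
    have "\<not> - (h * y) * w = (1 - w) * - (h * y)"
    proof
      assume "- (h * y) * w = (1 - w) * - (h * y)"
      then have "(w + w - 1) * (h * y) = 0" using comm by (simp add: algebra_simps)
      moreover have "h * y \<noteq> 0" using k zero by auto
      ultimately have "w + w = 1" by (simp add: mult_eq_0_iff)
      then have "trd (w * (w + w)) = trd w" by simp
      then show False using w(2) by (simp add: distrib_left w(3) trd_add trd_diff trd_one)
    qed
    then have "- (h * y) \<in> ?C" using dich[OF k] by blast
    moreover have "h = - (h * y) * y" by (simp add: mult.assoc yy)
    ultimately show ?thesis by blast
  qed simp
  \<comment> \<open>The list \<open>?C\<close> runs through the powers of \<open>w\<close> with
    exponents 0 to 5 in this order.\<close>
  have sub: "?C \<subseteq> (\<lambda>k. w ^ nat k) ` {0..<6}"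
  proof -
    have w2: "w ^ 2 = w - 1" by (simp add: power2_eq_square w(3))
    have w3: "w ^ 3 = - 1" by (simp add: power3_eq_cube w(3) left_diff_distrib)
    have "w ^ 4 = w ^ 3 * w" "w ^ 5 = w ^ 3 * w ^ 2" by (simp_all add: power_add[symmetric] power_Suc2[symmetric])
    then have w4: "w ^ 4 = - w" and w5: "w ^ 5 = 1 - w" by (simp_all add: w2 w3)
    have img: "w ^ nat k \<in> (\<lambda>k. w ^ nat k) ` {0..<6}" if "0 \<le> k" "k < 6" for k using that by simp
    have "1 \<in> (\<lambda>k. w ^ nat k) ` {0..<6}" "w \<in> (\<lambda>k. w ^ nat k) ` {0..<6}"
      "w - 1 \<in> (\<lambda>k. w ^ nat k) ` {0..<6}" "- 1 \<in> (\<lambda>k. w ^ nat k) ` {0..<6}"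
      "- w \<in> (\<lambda>k. w ^ nat k) ` {0..<6}" "1 - w \<in> (\<lambda>k. w ^ nat k) ` {0..<6}"
      using img[of 0] img[of 1] img[of 2] img[of 3] img[of 4] img[of 5]
      by (simp_all add: w2 w3 w4 w5)
    then show ?thesis by (simp only: insert_subset empty_subsetI simp_thms)
  qed
  have powers: "h \<in> (\<lambda>k. w ^ nat k) ` {0..<6} \<or> (\<exists>c\<in>(\<lambda>k. w ^ nat k) ` {0..<6}. h = c * y)"
    if "h \<in> H" for h using coset[OF that] subsetD[OF sub] by blast
  have "H \<subseteq> dic_elt w y ` ({0..<6} \<times> UNIV)"
  proof
    fix h assume "h \<in> H"
    then consider k where "k \<in> {0..<6}" "h = w ^ nat k" | k where "k \<in> {0..<6}" "h = w ^ nat k * y"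
      using powers by blast
    then obtain k s where "k \<in> {0..<6}" "h = w ^ nat k * (if s then y else 1)"
    proof cases
      case 1
      then show ?thesis using that[of k False] by simp
    next
      case 2
      then show ?thesis using that[of k True] by simp
    qed
    then show "h \<in> dic_elt w y ` ({0..<6} \<times> UNIV)"
      by (intro image_eqI[of _ _ "(k, s)"]) (simp_all add: dic_elt_def)
  qed
  then show "\<exists>w y. w * w = w - 1 \<and> y * y = - 1 \<and> y * w = (1 - w) * y \<and> H \<subseteq> dic_elt w y ` ({0..<6} \<times> UNIV)"
    using w(3) yy y(3) by blast
qed

end

section \<open>Hurwitz units modulo 3\<close>

lemma three_eq_zero: "(3::3) = 0"
  by simp

lemma exhaust_mod_3: "x = 0 \<or> x = 1 \<or> x = (-1 :: 3)"
proof (cases x rule: bit1_cases)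
  case (of_int z)
  then have "z = 0 \<or> z = 1 \<or> z = 2" by auto
  then show ?thesis using of_int(1) by auto
qed

lemma of_int_mod_3_eq_iff: "(of_int x :: 3) = of_int y \<longleftrightarrow> 3 dvd x - y"
  using of_int_eq_0_iff_char_dvd[where 'a = 3, of "x - y"] by simp

text \<open>Doubled coordinates of a Hurwitz unit. The parity condition of the Hurwitz order is
  automatic, since 4 is a sum of four squares only as 1 + 1 + 1 + 1 or 4 + 0 + 0 + 0.\<close>

definition hurwitz_coords :: "(int \<times> int \<times> int \<times> int) set" where
  "hurwitz_coords = {(a, b, c, d). a * a + b * b + c * c + d * d = 4}"

lemma hurwitz_coords_cases:
  assumes "(a, b, c, d) \<in> hurwitz_coords"
  shows "a \<in> {1, -1} \<and> b \<in> {1, -1} \<and> c \<in> {1, -1} \<and> d \<in> {1, -1} \<or>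
    (a, b, c, d) \<in> {(2,0,0,0), (-2,0,0,0), (0,2,0,0), (0,-2,0,0), (0,0,2,0), (0,0,-2,0), (0,0,0,2), (0,0,0,-2)}"
proof -
  have sum: "a * a + b * b + c * c + d * d = 4" using assms by (simp add: hurwitz_coords_def)
  have le: "x \<in> {-2, -1, 0, 1, 2}" if "x * x \<le> 4" for x :: int
  proof -
    have "\<bar>x\<bar> * \<bar>x\<bar> \<le> 2 * 2" using that by simp
    then have "\<bar>x\<bar> \<le> 2" using mult_strict_mono[of 2 "\<bar>x\<bar>" 2 "\<bar>x\<bar>"] by linarith
    then show ?thesis by auto
  qed
  have "a * a \<le> 4" "b * b \<le> 4" "c * c \<le> 4" "d * d \<le> 4"
    using sum zero_le_square[of a] zero_le_square[of b] zero_le_square[of c] zero_le_square[of d] by linarith+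
  then have bounds: "a \<in> {-2, -1, 0, 1, 2}" "b \<in> {-2, -1, 0, 1, 2}" "c \<in> {-2, -1, 0, 1, 2}" "d \<in> {-2, -1, 0, 1, 2}"
    using le by blast+
  consider "a \<in> {2, -2}" | "b \<in> {2, -2}" | "c \<in> {2, -2}" | "d \<in> {2, -2}"
    | "a \<in> {-1, 0, 1}" "b \<in> {-1, 0, 1}" "c \<in> {-1, 0, 1}" "d \<in> {-1, 0, 1}" using bounds by blast
  then show ?thesis
  proof cases
    case 1
    then have "b * b + c * c + d * d = 0" using sum by auto
    then have "b * b = 0" "c * c = 0" "d * d = 0"
      using zero_le_square[of b] zero_le_square[of c] zero_le_square[of d] by linarith+
    then show ?thesis using 1 by simp
  next
    case 2
    then have "a * a + c * c + d * d = 0" using sum by auto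
    then have "a * a = 0" "c * c = 0" "d * d = 0"
      using zero_le_square[of a] zero_le_square[of c] zero_le_square[of d] by linarith+
    then show ?thesis using 2 by simp
  next
    case 3
    then have "a * a + b * b + d * d = 0" using sum by auto
    then have "a * a = 0" "b * b = 0" "d * d = 0"
      using zero_le_square[of a] zero_le_square[of b] zero_le_square[of d] by linarith+
    then show ?thesis using 3 by simp
  next
    case 4
    then have "a * a + b * b + c * c = 0" using sum by auto
    then have "a * a = 0" "b * b = 0" "c * c = 0"
      using zero_le_square[of a] zero_le_square[of b] zero_le_square[of c] by linarith+
    then show ?thesis using 4 by simp
  next
    case 5
    have sq: "u * u \<le> 1" "u * u = 1 \<Longrightarrow> u \<in> {1, -1}" if "u \<in> {-1, 0, 1}" for u :: int using that by auto
    have "a * a = 1" "b * b = 1" "c * c = 1" "d * d = 1" using sum sq(1)[OF 5(1)] sq(1)[OF 5(2)] sq(1)[OF 5(3)] sq(1)[OF 5(4)] by linarith+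
    then have "a \<in> {1, -1}" "b \<in> {1, -1}" "c \<in> {1, -1}" "d \<in> {1, -1}" using sq(2) 5 by blast+
    then show ?thesis by blast
  qed
qed

text \<open>Prepares injectivity of reduction modulo 3. After the shift by 1 the residue 1 marks a
  coordinate 0, which separates the eight quadruples with a single 2 or -2 from the sixteen without
  zeros; within each type the residues determine the signs.\<close>

lemma hurwitz_coords_residue:
  "\<exists>g. \<forall>a b c d. (a, b, c, d) \<in> hurwitz_coords \<longrightarrow>
    (a, b, c, d) = g ((a + 1) mod 3) ((b + 1) mod 3) ((c + 1) mod 3) ((d + 1) mod 3)"
proof -
  define g where "g x y z t = (if x = 1 \<or> y = 1 \<or> z = 1 \<or> t = 1
    then (2 - 2 * x, 2 - 2 * y, 2 - 2 * z, 2 - 2 * t) else (x - 1, y - 1, z - 1, t - 1 :: int))" for x y z t :: int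
  have "(a, b, c, d) = g ((a + 1) mod 3) ((b + 1) mod 3) ((c + 1) mod 3) ((d + 1) mod 3)"
    if "(a, b, c, d) \<in> hurwitz_coords" for a b c d
    using hurwitz_coords_cases[OF that]
  proof
    assume "a \<in> {1, -1} \<and> b \<in> {1, -1} \<and> c \<in> {1, -1} \<and> d \<in> {1, -1}"
    then show ?thesis by (elim conjE insertE emptyE; simp add: g_def)
  qed (auto simp: g_def)
  then show ?thesis by blast
qed

lemma finite_hurwitz_coords: "finite hurwitz_coords"
proof (rule finite_subset)
  show "hurwitz_coords \<subseteq> {-2..2} \<times> {-2..2} \<times> {-2..2} \<times> {-2..2}"
    using hurwitz_coords_cases by fastforce
qed simp

text \<open>The product for \<open>i * i = j * j = - 1\<close> in doubled coordinates: of the two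
  factors 1/2 one is absorbed by doubling the result. The division is exact on
  \<open>hurwitz_coords\<close>, by parity.\<close>

definition hurwitz_mult :: "int \<times> int \<times> int \<times> int \<Rightarrow> int \<times> int \<times> int \<times> int \<Rightarrow> int \<times> int \<times> int \<times> int" where
  "hurwitz_mult = (\<lambda>(t, x, y, z) (t', x', y', z').
    ((t * t' - x * x' - y * y' - z * z') div 2, (t * x' + x * t' - z * y' + y * z') div 2,
     (t * y' + y * t' - x * z' + z * x') div 2, (t * z' + z * t' + x * y' - y * x') div 2))"

lemma hurwitz_mult_twice:
  assumes "(t, x, y, z) \<in> hurwitz_coords" "(t', x', y', z') \<in> hurwitz_coords"
    and "hurwitz_mult (t, x, y, z) (t', x', y', z') = (a, b, c, d)"
  shows "2 * a = t * t' - x * x' - y * y' - z * z'" "2 * b = t * x' + x * t' - z * y' + y * z'"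
    "2 * c = t * y' + y * t' - x * z' + z * x'" "2 * d = t * z' + z * t' + x * y' - y * x'"
proof -
  have "even x \<longleftrightarrow> even t" "even y \<longleftrightarrow> even t" "even z \<longleftrightarrow> even t" using hurwitz_coords_cases[OF assms(1)] by auto
  moreover have "even x' \<longleftrightarrow> even t'" "even y' \<longleftrightarrow> even t'" "even z' \<longleftrightarrow> even t'" using hurwitz_coords_cases[OF assms(2)] by auto
  ultimately have "even (t * t' - x * x' - y * y' - z * z')" "even (t * x' + x * t' - z * y' + y * z')"
    "even (t * y' + y * t' - x * z' + z * x')" "even (t * z' + z * t' + x * y' - y * x')"
    by (cases "even t"; cases "even t'"; simp)+
  moreover have "a = (t * t' - x * x' - y * y' - z * z') div 2" "b = (t * x' + x * t' - z * y' + y * z') div 2"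
    "c = (t * y' + y * t' - x * z' + z * x') div 2" "d = (t * z' + z * t' + x * y' - y * x') div 2"
    using assms(3) by (simp_all add: hurwitz_mult_def)
  ultimately show "2 * a = t * t' - x * x' - y * y' - z * z'" "2 * b = t * x' + x * t' - z * y' + y * z'"
    "2 * c = t * y' + y * t' - x * z' + z * x'" "2 * d = t * z' + z * t' + x * y' - y * x'"
    by (simp_all only: dvd_mult_div_cancel)
qed

text \<open>The four-square identity, applied to norms that are all 4 in doubled
  coordinates.\<close>

lemma hurwitz_mult_closed:
  assumes "p \<in> hurwitz_coords" "q \<in> hurwitz_coords"
  shows "hurwitz_mult p q \<in> hurwitz_coords"
proof -
  obtain t x y z t' x' y' z' where pq: "p = (t, x, y, z)" "q = (t', x', y', z')" by (metis prod_cases4)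
  obtain a b c d where m: "hurwitz_mult p q = (a, b, c, d)" by (metis prod_cases4)
  note tw = hurwitz_mult_twice[OF assms[unfolded pq] m[unfolded pq]]
  have "4 * (a * a + b * b + c * c + d * d) = (2 * a) * (2 * a) + (2 * b) * (2 * b) + (2 * c) * (2 * c) + (2 * d) * (2 * d)"
    by (simp add: algebra_simps)
  also have "\<dots> = (t * t + x * x + y * y + z * z) * (t' * t' + x' * x' + y' * y' + z' * z')"
    unfolding tw by (simp add: algebra_simps)
  also have "\<dots> = 16" using assms pq by (simp add: hurwitz_coords_def)
  finally show ?thesis by (simp add: m hurwitz_coords_def)
qed

text \<open>Reduction modulo 3 of \<open>(a + bi + cj + dk) / 2\<close>, where \<open>i\<close> and \<open>j\<close> go to the matrices
  with rows \<open>(0, -1), (1, 0)\<close> and \<open>(1, 1), (1, -1)\<close>, and \<open>1 / 2\<close> to \<open>-1\<close>.\<close>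

definition hurwitz_mod_3 :: "int \<times> int \<times> int \<times> int \<Rightarrow> 3 mat" where
  "hurwitz_mod_3 = (\<lambda>(a, b, c, d). mat 2 2 (\<lambda>(r, s). of_int
     (if r = 0 then if s = 0 then d - a - c else b - c - d else if s = 0 then - b - c - d else c - a - d)))"

lemma hurwitz_mod_3_carrier: "hurwitz_mod_3 q \<in> carrier_mat 2 2"
  by (cases q rule: prod_cases4) (simp add: hurwitz_mod_3_def)

lemma hurwitz_mod_3_index:
  "hurwitz_mod_3 (a, b, c, d) $$ (0, 0) = of_int (d - a - c)"
  "hurwitz_mod_3 (a, b, c, d) $$ (0, 1) = of_int (b - c - d)"
  "hurwitz_mod_3 (a, b, c, d) $$ (1, 0) = of_int (- b - c - d)"
  "hurwitz_mod_3 (a, b, c, d) $$ (1, 1) = of_int (c - a - d)"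
  by (simp_all add: hurwitz_mod_3_def)

lemma mat_2_eqI:
  assumes "A \<in> carrier_mat 2 2" "B \<in> carrier_mat 2 2"
    "A $$ (0,0) = B $$ (0,0)" "A $$ (0,1) = B $$ (0,1)" "A $$ (1,0) = B $$ (1,0)" "A $$ (1,1) = B $$ (1,1)"
  shows "A = B"
proof (rule eq_matI)
  fix r s assume "r < dim_row B" "s < dim_col B"
  then have "r = 0 \<or> r = 1" "s = 0 \<or> s = 1" using assms(2) by auto
  then show "A $$ (r, s) = B $$ (r, s)" using assms(3-6) by metis
qed (use assms in simp_all)

lemma mult_mat_2:
  assumes "A \<in> carrier_mat 2 2" "B \<in> carrier_mat 2 2" "r < 2" "s < 2"
  shows "(A * B) $$ (r, s) = A $$ (r, 0) * B $$ (0, s) + A $$ (r, 1) * B $$ (1, s)"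
proof -
  have "{0..<2} = {0, 1::nat}" by auto
  then show ?thesis using assms by (simp add: scalar_prod_def)
qed

lemma det_mat_2:
  fixes A :: "'a::comm_ring_1 mat"
  assumes "A \<in> carrier_mat 2 2"
  shows "det A = A $$ (0,0) * A $$ (1,1) - A $$ (0,1) * A $$ (1,0)"
proof -
  have single: "det (mat_delete A 0 0) = A $$ (1,1)" "det (mat_delete A 0 1) = A $$ (1,0)"
    using assms by (subst det_single; simp add: mat_delete_def)+
  have "det A = (\<Sum>j<2. A $$ (0,j) * cofactor A 0 j)"
    using laplace_expansion_row[OF assms, of 0] by simp
  also have "\<dots> = A $$ (0,0) * A $$ (1,1) - A $$ (0,1) * A $$ (1,0)"
    using single by (simp add: cofactor_def numeral_2_eq_2)
  finally show ?thesis .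
qed

lemma hurwitz_mod_3_mult:
  assumes "p \<in> hurwitz_coords" "q \<in> hurwitz_coords"
  shows "hurwitz_mod_3 (hurwitz_mult p q) = hurwitz_mod_3 p * hurwitz_mod_3 q"
proof -
  obtain t x y z t' x' y' z' where pq: "p = (t, x, y, z)" "q = (t', x', y', z')" by (metis prod_cases4)
  obtain a b c d where m: "hurwitz_mult p q = (a, b, c, d)" by (metis prod_cases4)
  note tw = hurwitz_mult_twice[OF assms[unfolded pq] m[unfolded pq]]
  \<comment> \<open>Since 2 is -1 modulo 3, equality can be tested on twice the left side, which
    avoids the division in \<open>hurwitz_mult\<close>.\<close>
  have minus_two: "(of_int v :: 3) = of_int w" if "3 dvd 2 * v + w" for v w
  proof -
    have "3 dvd 3 * v - (2 * v + w)" using that by (intro dvd_diff) auto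
    then show ?thesis by (simp add: of_int_mod_3_eq_iff)
  qed
  have twice: "2 * (d - a - c) + ((z - t - y) * (z' - t' - y') + (x - y - z) * (- x' - y' - z')) = 3 * (y * y' + z * z')"
    "2 * (b - c - d) + ((z - t - y) * (x' - y' - z') + (x - y - z) * (y' - t' - z')) = 3 * (y * z' - z * y')"
    "2 * (- b - c - d) + ((- x - y - z) * (z' - t' - y') + (y - t - z) * (- x' - y' - z')) = 3 * (z * y' - y * z')"
    "2 * (c - a - d) + ((- x - y - z) * (x' - y' - z') + (y - t - z) * (y' - t' - z')) = 3 * (y * y' + z * z')"
    by (simp_all only: right_diff_distrib mult_minus_right tw) (simp_all add: algebra_simps)
  have entries: "(of_int (d - a - c) :: 3) = of_int ((z - t - y) * (z' - t' - y') + (x - y - z) * (- x' - y' - z'))"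
    "(of_int (b - c - d) :: 3) = of_int ((z - t - y) * (x' - y' - z') + (x - y - z) * (y' - t' - z'))"
    "(of_int (- b - c - d) :: 3) = of_int ((- x - y - z) * (z' - t' - y') + (y - t - z) * (- x' - y' - z'))"
    "(of_int (c - a - d) :: 3) = of_int ((- x - y - z) * (x' - y' - z') + (y - t - z) * (y' - t' - z'))"
    by (rule minus_two, subst twice, simp only: dvd_triv_left)+
  show ?thesis
  proof (rule mat_2_eqI[OF hurwitz_mod_3_carrier mult_carrier_mat[OF hurwitz_mod_3_carrier hurwitz_mod_3_carrier]])
    have index_mult: "(hurwitz_mod_3 p * hurwitz_mod_3 q) $$ (r, s) = hurwitz_mod_3 p $$ (r, 0) * hurwitz_mod_3 q $$ (0, s)
        + hurwitz_mod_3 p $$ (r, 1) * hurwitz_mod_3 q $$ (1, s)" if "r < 2" "s < 2" for r s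
      using mult_mat_2[OF hurwitz_mod_3_carrier hurwitz_mod_3_carrier that] .
    have less: "0 < (2::nat)" "1 < (2::nat)" by simp_all
    show "hurwitz_mod_3 (hurwitz_mult p q) $$ (0, 0) = (hurwitz_mod_3 p * hurwitz_mod_3 q) $$ (0, 0)"
      unfolding index_mult[OF less(1) less(1)] m
      unfolding pq hurwitz_mod_3_index
      by (rule entries[unfolded of_int_add of_int_mult])
    show "hurwitz_mod_3 (hurwitz_mult p q) $$ (0, 1) = (hurwitz_mod_3 p * hurwitz_mod_3 q) $$ (0, 1)"
      unfolding index_mult[OF less(1) less(2)] m
      unfolding pq hurwitz_mod_3_index
      by (rule entries[unfolded of_int_add of_int_mult])
    show "hurwitz_mod_3 (hurwitz_mult p q) $$ (1, 0) = (hurwitz_mod_3 p * hurwitz_mod_3 q) $$ (1, 0)"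
      unfolding index_mult[OF less(2) less(1)] m
      unfolding pq hurwitz_mod_3_index
      by (rule entries[unfolded of_int_add of_int_mult])
    show "hurwitz_mod_3 (hurwitz_mult p q) $$ (1, 1) = (hurwitz_mod_3 p * hurwitz_mod_3 q) $$ (1, 1)"
      unfolding index_mult[OF less(2) less(2)] m
      unfolding pq hurwitz_mod_3_index
      by (rule entries[unfolded of_int_add of_int_mult])
  qed
qed

lemma SL_mod_3_carrier: "A \<in> carrier (SL TYPE(3) 2) \<longleftrightarrow> A \<in> carrier_mat 2 2 \<and> det A = 1"
  by (simp add: SL_def)

text \<open>The determinant is \<open>a * a + b * b - 2 * (c * c + d * d)\<close>, which is modulo 3
  the sum of the four squares, that is 4 and hence 1.\<close>

lemma hurwitz_mod_3_in_SL:
  assumes "q \<in> hurwitz_coords" shows "hurwitz_mod_3 q \<in> carrier (SL TYPE(3) 2)"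
proof -
  obtain a b c d where q: "q = (a, b, c, d)" by (metis prod_cases4)
  have eq: "(d - a - c) * (c - a - d) - (b - c - d) * (- b - c - d) = 1 - 3 * (c * c + d * d - 1)"
    using assms by (simp add: q hurwitz_coords_def algebra_simps)
  have "det (hurwitz_mod_3 q) = of_int ((d - a - c) * (c - a - d) - (b - c - d) * (- b - c - d))"
    by (subst det_mat_2[OF hurwitz_mod_3_carrier]) (simp add: q hurwitz_mod_3_def)
  also have "\<dots> = of_int 1" unfolding eq by (subst of_int_mod_3_eq_iff) simp
  finally show ?thesis by (simp add: SL_mod_3_carrier hurwitz_mod_3_carrier)
qed

lemma inj_on_hurwitz_mod_3: "inj_on hurwitz_mod_3 hurwitz_coords"
proof (rule inj_onI)
  fix p q assume p: "p \<in> hurwitz_coords" and q: "q \<in> hurwitz_coords" and eq: "hurwitz_mod_3 p = hurwitz_mod_3 q"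
  obtain t x y z t' x' y' z' where pq: "p = (t, x, y, z)" "q = (t', x', y', z')" by (metis prod_cases4)
  have "hurwitz_mod_3 p $$ (r, s) = hurwitz_mod_3 q $$ (r, s)" for r s using eq by simp
  from this[of 0 0] this[of 0 1] this[of 1 0] this[of 1 1]
  have "3 dvd (z - t - y) - (z' - t' - y')" "3 dvd (x - y - z) - (x' - y' - z')"
    "3 dvd (- x - y - z) - (- x' - y' - z')" "3 dvd (y - t - z) - (y' - t' - z')"
    unfolding of_int_mod_3_eq_iff[symmetric] by (simp_all add: pq hurwitz_mod_3_def)
  then have "3 dvd t - t'" "3 dvd x - x'" "3 dvd y - y'" "3 dvd z - z'" by presburger+
  then have "(t + 1) mod 3 = (t' + 1) mod 3" "(x + 1) mod 3 = (x' + 1) mod 3"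
    "(y + 1) mod 3 = (y' + 1) mod 3" "(z + 1) mod 3 = (z' + 1) mod 3"
    by presburger+
  moreover obtain g where "\<And>a b c d. (a, b, c, d) \<in> hurwitz_coords \<Longrightarrow>
      (a, b, c, d) = g ((a + 1) mod 3) ((b + 1) mod 3) ((c + 1) mod 3) ((d + 1) mod 3)"
    using hurwitz_coords_residue by blast
  note this[OF p[unfolded pq]] this[OF q[unfolded pq]]
  ultimately show "p = q" unfolding pq by (elim ssubst) simp
qed

text \<open>Nonzero squares modulo 3 are 1, so the hypothesis says that one or four coordinates are
  nonzero. A single nonzero coordinate lifts to 2 or -2 by \<open>l1\<close>, where the class 1 goes
  to -2; four of them lift to 1 or -1 by \<open>l2\<close>.\<close>

lemma hurwitz_lift:
  fixes t x y z :: 3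
  assumes "t * t + x * x + y * y + z * z = 1"
  shows "\<exists>a b c d. (a, b, c, d) \<in> hurwitz_coords \<and> of_int a = t \<and> of_int b = x \<and> of_int c = y \<and> of_int d = z"
proof -
  define l1 l2 :: "3 \<Rightarrow> int" where "l1 u = (if u = 0 then 0 else if u = 1 then - 2 else 2)"
    and "l2 u = (if u = 0 then 0 else if u = 1 then 1 else - 1)" for u
  have l: "of_int (l1 u) = u" "of_int (l2 u) = u" for u
    using exhaust_mod_3[of u] by (auto simp: l1_def l2_def)
  define e :: "3 \<Rightarrow> int" where "e u = (if u = 0 then 0 else 1)" for u
  have "of_int (e u) = u * u" for u
    using exhaust_mod_3[of u] by (auto simp: e_def)
  then have "of_int (e t + e x + e y + e z) = (of_int 1 :: 3)" using assms by simp
  then have "3 dvd e t + e x + e y + e z - 1" unfolding of_int_mod_3_eq_iff .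
  moreover have "0 \<le> e u" "e u \<le> 1" for u by (simp_all add: e_def)
  note this[of t] this[of x] this[of y] this[of z]
  ultimately have "e t + e x + e y + e z = 1 \<or> e t + e x + e y + e z = 4" by presburger
  moreover have "l1 u * l1 u = 4 * e u" "l2 u * l2 u = e u" for u
    by (simp_all add: l1_def l2_def e_def)
  ultimately have "l1 t * l1 t + l1 x * l1 x + l1 y * l1 y + l1 z * l1 z = 4 \<or> l2 t * l2 t + l2 x * l2 x + l2 y * l2 y + l2 z * l2 z = 4"
    by simp linarith
  then have "(l1 t, l1 x, l1 y, l1 z) \<in> hurwitz_coords \<or> (l2 t, l2 x, l2 y, l2 z) \<in> hurwitz_coords"
    unfolding hurwitz_coords_def by simp
  then show ?thesis using l by blast
qed

text \<open>Modulo 3, \<open>p + s\<close>, \<open>r - q\<close>, \<open>s - p - q - r\<close>,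
  \<open>p - s - q - r\<close> are the coordinates of the preimage under
  \<open>hurwitz_mod_3\<close> of the matrix with rows (p, q), (r, s). The first four identities
  verify this, and the last compares the sum of squares with the determinant.\<close>

lemma lift_identities:
  fixes p q r s :: "'a::comm_ring_1"
  shows "p - s - q - r - (p + s) - (s - p - q - r) = p - 3 * s"
    "r - q - (s - p - q - r) - (p - s - q - r) = q + 3 * r"
    "- (r - q) - (s - p - q - r) - (p - s - q - r) = r + 3 * q"
    "s - p - q - r - (p + s) - (p - s - q - r) = s - 3 * p"
    "(p + s) * (p + s) + (r - q) * (r - q) + (s - p - q - r) * (s - p - q - r) + (p - s - q - r) * (p - s - q - r)
      = 3 * (p * p + q * q + r * r + s * s - (p * s - q * r)) + (p * s - q * r)"
  by (simp_all add: algebra_simps)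

lemma bij_betw_hurwitz_mod_3: "bij_betw hurwitz_mod_3 hurwitz_coords (carrier (SL TYPE(3) 2))"
proof (rule bij_betwI')
  show "hurwitz_mod_3 p = hurwitz_mod_3 q \<longleftrightarrow> p = q" if "p \<in> hurwitz_coords" "q \<in> hurwitz_coords" for p q
    using inj_on_hurwitz_mod_3 that by (rule inj_on_eq_iff)
next
  fix A :: "3 mat" assume "A \<in> carrier (SL TYPE(3) 2)"
  then have A: "A \<in> carrier_mat 2 2" and det: "det A = 1" by (simp_all add: SL_mod_3_carrier)
  define p q r s where "p = A $$ (0,0)" and "q = A $$ (0,1)" and "r = A $$ (1,0)" and "s = A $$ (1,1)"
  have "p * s - q * r = 1" using det det_mat_2[OF A] by (simp add: p_def q_def r_def s_def)
  then have "(p + s) * (p + s) + (r - q) * (r - q) + (s - p - q - r) * (s - p - q - r) + (p - s - q - r) * (p - s - q - r) = 1"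
    unfolding lift_identities(5) by (simp only: three_eq_zero mult_zero_left) simp
  then obtain a b c d where abcd: "(a, b, c, d) \<in> hurwitz_coords" "of_int a = p + s" "of_int b = r - q"
    "of_int c = s - p - q - r" "of_int d = p - s - q - r" using hurwitz_lift by metis
  have "A = hurwitz_mod_3 (a, b, c, d)"
  proof (rule mat_2_eqI[OF A hurwitz_mod_3_carrier])
    have "of_int (d - a - c) = p - 3 * s" "of_int (b - c - d) = q + 3 * r"
      "of_int (- b - c - d) = r + 3 * q" "of_int (c - a - d) = s - 3 * p"
      by (simp_all only: of_int_diff of_int_minus abcd(2-5) lift_identities)
    then show "A $$ (0, 0) = hurwitz_mod_3 (a, b, c, d) $$ (0, 0)" "A $$ (0, 1) = hurwitz_mod_3 (a, b, c, d) $$ (0, 1)"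
      "A $$ (1, 0) = hurwitz_mod_3 (a, b, c, d) $$ (1, 0)" "A $$ (1, 1) = hurwitz_mod_3 (a, b, c, d) $$ (1, 1)"
      by (simp_all only: hurwitz_mod_3_index three_eq_zero p_def q_def r_def s_def)
        (simp_all only: mult_zero_left diff_zero add_0_right)
  qed
  then show "\<exists>q\<in>hurwitz_coords. A = hurwitz_mod_3 q" using abcd(1) by blast
qed (rule hurwitz_mod_3_in_SL)

text \<open>Common interface of \<open>SL TYPE(3) 2\<close> and \<open>Dic12\<close>: the properties
  of the image by which monomial matrices over it form a finite group, and the injectivity behind
  the isomorphism with the wreath product.\<close>

definition ring_representation :: "('h, 'm) monoid_scheme \<Rightarrow> ('h \<Rightarrow> 'd::ring_1) \<Rightarrow> bool" where
  "ring_representation K \<phi> \<longleftrightarrow> finite (carrier K) \<and> inj_on \<phi> (carrier K) \<and>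
     (\<forall>x\<in>carrier K. \<forall>y\<in>carrier K. x \<otimes>\<^bsub>K\<^esub> y \<in> carrier K \<and> \<phi> (x \<otimes>\<^bsub>K\<^esub> y) = \<phi> x * \<phi> y) \<and>
     1 \<in> \<phi> ` carrier K \<and> 0 \<notin> \<phi> ` carrier K"

context rational_algebra
begin

definition hurwitz_elt :: "'d \<Rightarrow> 'd \<Rightarrow> int \<times> int \<times> int \<times> int \<Rightarrow> 'd" where
  "hurwitz_elt u v = (\<lambda>(t, x, y, z). quat u v (of_int t / 2) (of_int x / 2) (of_int y / 2) (of_int z / 2))"

end

text \<open>Up to sign the doubled coordinates of \<open>h\<close> are the traces of
  \<open>h\<close>, \<open>h * i\<close>, \<open>h * j\<close> and \<open>h * (i * j)\<close>. These
  are integers because \<open>i\<close> and \<open>j\<close> lie in the group.\<close>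

lemma (in finite_quaternion_group) subset_hurwitz:
  assumes "a = - 1" "b = - 1" "i \<in> H" "j \<in> H"
  shows "H \<subseteq> hurwitz_elt i j ` hurwitz_coords"
proof
  fix h assume h: "h \<in> H"
  obtain t x y z where q: "h = quat i j t x y z" by (rule quat_cases)
  have ij: "i = quat i j 0 1 0 0" "j = quat i j 0 0 1 0" "i * j = quat i j 0 0 0 1"
    by (simp_all add: quat_def)
  have "trd (h * quat i j 0 1 0 0) = - 2 * x" "trd (h * quat i j 0 0 1 0) = - 2 * y"
    "trd (h * quat i j 0 0 0 1) = - 2 * z"
    unfolding q using assms(1,2) by (simp_all add: quat_simps)
  then have "trd (h * i) = - 2 * x" "trd (h * j) = - 2 * y" "trd (h * (i * j)) = - 2 * z"
    by (simp_all only: ij[symmetric])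
  moreover obtain m1 m2 m3 m4 :: int where m: "trd h = of_int m1" "trd (h * i) = of_int m2"
    "trd (h * j) = of_int m3" "trd (h * (i * j)) = of_int m4"
    using trd_finite[of h] trd_finite[of "h * i"] trd_finite[of "h * j"] trd_finite[of "h * (i * j)"]
      closed h assms(3,4) by metis
  ultimately have eq: "t = of_int m1 / 2" "x = of_int (- m2) / 2" "y = of_int (- m3) / 2" "z = of_int (- m4) / 2"
    using q by (auto simp: trd_quat)
  have "t * t + x * x + y * y + z * z = 1"
    using nrd_finite[OF h] assms(1,2) unfolding q nrd_quat by simp
  then have "of_int (m1 * m1 + m2 * m2 + m3 * m3 + m4 * m4) = (of_int 4 :: rat)"
    unfolding eq by (simp add: field_simps)
  then have "(m1, - m2, - m3, - m4) \<in> hurwitz_coords"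
    unfolding hurwitz_coords_def by (simp only: of_int_eq_iff) simp
  moreover have "h = hurwitz_elt i j (m1, - m2, - m3, - m4)"
    unfolding hurwitz_elt_def q eq by simp
  ultimately show "h \<in> hurwitz_elt i j ` hurwitz_coords" by blast
qed

lemma (in definite_quaternions) hurwitz_elt_mult:
  assumes "a = - 1" "b = - 1" "p \<in> hurwitz_coords" "q \<in> hurwitz_coords"
  shows "hurwitz_elt i j p * hurwitz_elt i j q = hurwitz_elt i j (hurwitz_mult p q)"
proof -
  obtain t x y z t' x' y' z' where pq: "p = (t, x, y, z)" "q = (t', x', y', z')" by (metis prod_cases4)
  obtain k l m n where r: "hurwitz_mult p q = (k, l, m, n)" by (metis prod_cases4)
  note tw = hurwitz_mult_twice[OF assms(3,4)[unfolded pq] r[unfolded pq], THEN arg_cong[where f = "of_int :: int \<Rightarrow> rat"]]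
  have half: "(of_int c :: rat) / 2 = of_int (2 * c) / 4" for c by simp
  show ?thesis
    unfolding r unfolding pq hurwitz_elt_def case_prod_conv half[of k] half[of l] half[of m] half[of n] tw
    unfolding qmult quat_eq_iff assms(1,2) by (simp add: field_simps)
qed

text \<open>The map inverts reduction modulo 3 and then halves the coordinates; both halves of it
  turn \<open>hurwitz_mult\<close> into the respective product.\<close>

lemma (in definite_quaternions) SL_representation:
  assumes "a = - 1" "b = - 1"
  shows "\<exists>\<phi>. ring_representation (SL TYPE(3) 2) \<phi> \<and>
    \<phi> ` carrier (SL TYPE(3) 2) = hurwitz_elt i j ` hurwitz_coords"
proof -
  let ?S = "SL TYPE(3) 2"
  let ?r = "inv_into hurwitz_coords hurwitz_mod_3"
  define \<phi> where "\<phi> A = hurwitz_elt i j (?r A)" for A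
  have r: "bij_betw ?r (carrier ?S) hurwitz_coords"
    using bij_betw_hurwitz_mod_3 by (rule bij_betw_inv_into)
  then have img: "\<phi> ` carrier ?S = hurwitz_elt i j ` hurwitz_coords"
    unfolding \<phi>_def by (metis bij_betw_imp_surj_on image_image)
  have inj: "inj_on (hurwitz_elt i j) hurwitz_coords"
    by (rule inj_onI) (auto simp: hurwitz_elt_def quat_eq_iff)
  have "inj_on \<phi> (carrier ?S)"
    using comp_inj_on[OF bij_betw_imp_inj_on[OF r], of "hurwitz_elt i j"] inj bij_betw_imp_surj_on[OF r]
    by (simp add: \<phi>_def[abs_def] comp_def)
  moreover have "finite (carrier ?S)" using r finite_hurwitz_coords bij_betw_finite by blast
  moreover have "A \<otimes>\<^bsub>?S\<^esub> B \<in> carrier ?S \<and> \<phi> (A \<otimes>\<^bsub>?S\<^esub> B) = \<phi> A * \<phi> B"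
    if "A \<in> carrier ?S" "B \<in> carrier ?S" for A B
  proof -
    have AB: "A = hurwitz_mod_3 (?r A)" "B = hurwitz_mod_3 (?r B)" "?r A \<in> hurwitz_coords" "?r B \<in> hurwitz_coords"
      using that bij_betw_hurwitz_mod_3 r
      by (simp_all add: bij_betw_inv_into_right bij_betwE)
    then have mult: "A \<otimes>\<^bsub>?S\<^esub> B = hurwitz_mod_3 (hurwitz_mult (?r A) (?r B))"
      by (simp add: SL_def hurwitz_mod_3_mult)
    have cl: "hurwitz_mult (?r A) (?r B) \<in> hurwitz_coords" using AB hurwitz_mult_closed by blast
    then have "?r (A \<otimes>\<^bsub>?S\<^esub> B) = hurwitz_mult (?r A) (?r B)"
      unfolding mult using inj_on_hurwitz_mod_3 by (simp add: inv_into_f_f)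
    then show ?thesis
      using hurwitz_elt_mult[OF assms AB(3,4)] hurwitz_mod_3_in_SL[OF cl] by (simp add: \<phi>_def mult[symmetric])
  qed
  moreover have "1 = hurwitz_elt i j (2, 0, 0, 0)" "(2, 0, 0, 0) \<in> hurwitz_coords"
    by (simp_all add: hurwitz_elt_def one_quat hurwitz_coords_def)
  then have "1 \<in> \<phi> ` carrier ?S" unfolding img by blast
  moreover have "0 \<notin> \<phi> ` carrier ?S" unfolding img
    by (auto simp: hurwitz_elt_def zero_quat quat_eq_iff hurwitz_coords_def)
  ultimately show ?thesis unfolding ring_representation_def using img by blast
qed

section \<open>Quaternions with the relations of the dicyclic group of order 12\<close>

context definite_quaternions
begin

context
  fixes w y :: 'd
  assumes ww: "w * w = w - 1" and yy: "y * y = - 1" and yw: "y * w = (1 - w) * y"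
begin

text \<open>The trace of \<open>y * w * y\<close> is \<open>trd w - 2\<close> by the commutation
  rule and \<open>- trd w\<close> by cyclicity.\<close>

lemma trd_dic_generator: "trd w = 1"
proof -
  have "y * w * y = w - 1" by (simp add: yw mult.assoc yy)
  then have "trd (y * (w * y)) = trd w - 2" by (simp add: mult.assoc trd_diff trd_one)
  moreover have "trd (y * (w * y)) = - trd w"
    by (simp add: trd_mult_commute[of y] mult.assoc yy trd_uminus)
  ultimately show ?thesis by simp
qed

lemma double_dic_generator: "w + w \<noteq> 1"
proof
  assume "w + w = 1"
  then have "trd (w * (w + w)) = trd w" by simp
  then show False by (simp add: distrib_left ww trd_add trd_diff trd_one trd_dic_generator)
qed

lemma dic_powers: "w ^ 2 = w - 1" "w ^ 3 = - 1" "w ^ 4 = - w" "w ^ 5 = 1 - w" "w ^ 6 = 1"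
proof -
  show w2: "w ^ 2 = w - 1" by (simp add: power2_eq_square ww)
  show w3: "w ^ 3 = - 1" by (simp add: power3_eq_cube ww left_diff_distrib)
  have "w ^ 4 = w ^ 3 * w" "w ^ 5 = w ^ 3 * w ^ 2" "w ^ 6 = w ^ 3 * w ^ 3"
    by (simp_all add: power_add[symmetric] power_Suc2[symmetric])
  then show "w ^ 4 = - w" "w ^ 5 = 1 - w" "w ^ 6 = 1" by (simp_all add: w2 w3)
qed

lemma dic_power_mod: "w ^ nat (int n mod 6) = w ^ n"
proof -
  have "w ^ n = w ^ (6 * (n div 6) + n mod 6)" by simp
  also have "\<dots> = w ^ (n mod 6)" by (simp only: power_add power_mult dic_powers power_one mult_1_left)
  finally show ?thesis by (simp add: nat_mod_distrib)
qed

lemma dic_power_add: "w ^ nat ((k + l) mod 6) = w ^ nat (k mod 6) * w ^ nat (l mod 6)"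
proof -
  have "w ^ nat (k mod 6) * w ^ nat (l mod 6) = w ^ nat (int (nat (k mod 6) + nat (l mod 6)) mod 6)"
    by (simp only: dic_power_mod power_add)
  also have "int (nat (k mod 6) + nat (l mod 6)) mod 6 = (k + l) mod 6" by (simp add: mod_add_eq)
  finally show ?thesis by simp
qed

lemma dic_power_conj: "y * w ^ nat (k mod 6) = w ^ nat ((- k) mod 6) * y"
proof -
  have "y * w ^ n = (w ^ 5) ^ n * y" for n
  proof (induction n)
    case (Suc n)
    have "y * w ^ Suc n = y * w ^ n * w" by (simp add: power_Suc2 mult.assoc del: power_Suc)
    also have "\<dots> = (w ^ 5) ^ n * (w ^ 5) * y" by (simp only: Suc mult.assoc yw dic_powers)
    finally show ?case by (simp add: power_Suc2 del: power_Suc)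
  qed simp
  then have "y * w ^ nat (k mod 6) = w ^ (5 * nat (k mod 6)) * y" by (simp only: power_mult)
  also have "w ^ (5 * nat (k mod 6)) = w ^ nat (int (5 * nat (k mod 6)) mod 6)" by (simp only: dic_power_mod)
  also have "int (5 * nat (k mod 6)) mod 6 = (- k) mod 6" by simp presburger
  finally show ?thesis .
qed

lemma dic_elt_mult:
  assumes "p \<in> carrier Dic12" "q \<in> carrier Dic12"
  shows "dic_elt w y (p \<otimes>\<^bsub>Dic12\<^esub> q) = dic_elt w y p * dic_elt w y q"
proof -
  obtain k s l t where pq: "p = (k, s)" "q = (l, t)" by fastforce
  have "k mod 6 = k" "l mod 6 = l" using assms pq by (simp_all add: dicyclic_group_def)
  then have p: "dic_elt w y p = w ^ nat (k mod 6) * (if s then y else 1)"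
    and q: "dic_elt w y q = w ^ nat (l mod 6) * (if t then y else 1)"
    using pq by (simp_all add: dic_elt_def)
  have prod: "dic_elt w y (p \<otimes>\<^bsub>Dic12\<^esub> q) =
    w ^ nat ((k + (if s then - l else l) + (if s \<and> t then 3 else 0)) mod 6) * (if s \<noteq> t then y else 1)"
    by (simp add: pq dicyclic_group_def dic_elt_def)
  show ?thesis
  proof (cases s)
    case False
    then show ?thesis unfolding prod p q by (simp add: dic_power_add mult.assoc)
  next
    case True
    have *: "w ^ nat (k mod 6) * y * (w ^ nat (l mod 6) * c) = w ^ nat ((k - l) mod 6) * y * c" for c
      using dic_power_add[of k "- l"]
      by (simp only: mult.assoc[symmetric]) (simp add: mult.assoc dic_power_conj)
    show ?thesis
    proof (cases t)
      case False
      then show ?thesis using True *[of 1] unfolding prod p q by simp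
    next
      case t: True
      \<comment> \<open>The shift by 3 in the dicyclic product accounts for
        \<open>y * y = - 1\<close>, because \<open>w ^ 3 = - 1\<close>.\<close>
      have "w ^ nat ((k - l + 3) mod 6) = - (w ^ nat ((k - l) mod 6))"
        by (subst dic_power_add) (simp add: dic_powers)
      then show ?thesis using True t *[of y] unfolding prod p q by (simp add: mult.assoc yy)
    qed
  qed
qed

lemma inj_on_dic_elt: "inj_on (dic_elt w y) (carrier Dic12)"
proof (rule inj_onI)
  fix p q assume p: "p \<in> carrier Dic12" and q: "q \<in> carrier Dic12" and eq: "dic_elt w y p = dic_elt w y q"
  have inv: "w ^ nat (l mod 6) * (w ^ nat ((- l) mod 6) * c) = c" for l c
    using dic_power_add[of l "- l"] by (simp add: mult.assoc[symmetric])
  have cancel: "k = l" if "w ^ nat (k mod 6) = w ^ nat (l mod 6)" "0 \<le> k" "k < 6" "0 \<le> l" "l < 6" for k l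
  proof -
    have one: "w ^ nat ((k - l) mod 6) = 1"
      using dic_power_add[of k "- l"] dic_power_add[of l "- l"] that(1) by simp
    have "(k - l) mod 6 \<in> {0..<6}" by simp
    then consider "(k - l) mod 6 = 0" | "(k - l) mod 6 = 1" | "(k - l) mod 6 = 2" | "(k - l) mod 6 = 3"
      | "(k - l) mod 6 = 4" | "(k - l) mod 6 = 5" by fastforce
    \<comment> \<open>The powers of \<open>w\<close> have traces 2, 1, -1, -2, -1, 1, and only the
      trace of exponent 0 is that of the unit.\<close>
    then have "(k - l) mod 6 = 0"
      using arg_cong[OF one, of trd] trd_dic_generator
      by cases (simp_all add: dic_powers trd_one trd_diff trd_uminus)
    then show ?thesis using that by presburger
  qed
  have y: "y \<noteq> w ^ n" for n
  proof
    assume "y = w ^ n"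
    then have "y * w = w * y" by (metis power_commutes)
    then have "(w + w - 1) * y = 0" using yw by (simp add: algebra_simps)
    then show False using double_dic_generator yy by (auto simp: mult_eq_0_iff)
  qed
  obtain k s l t where pq: "p = (k, s)" "q = (l, t)" by fastforce
  have bounds: "0 \<le> k" "k < 6" "0 \<le> l" "l < 6" using p q pq by (simp_all add: dicyclic_group_def)
  have eq': "w ^ nat (k mod 6) * (if s then y else 1) = w ^ nat (l mod 6) * (if t then y else 1)"
    using eq bounds by (simp add: pq dic_elt_def)
  have no: False if "w ^ nat (k mod 6) = w ^ nat (l mod 6) * y" for k l
  proof -
    have "w ^ nat ((- l) mod 6) * w ^ nat (k mod 6) = y"
      using inv[of "- l" y] that by simp
    then show False using y by (metis power_add)
  qed
  have "s = t" using eq' by (cases s; cases t) (auto dest: no no[OF sym])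
  moreover have "c = d" if "c * y = d * y" for c d
  proof -
    have "c * y * y = d * y * y" using that by simp
    then show ?thesis by (simp add: mult.assoc yy)
  qed
  ultimately have "w ^ nat (k mod 6) = w ^ nat (l mod 6)" using eq' by (cases t) simp_all
  then show "p = q" using cancel[of k l] bounds pq \<open>s = t\<close> by blast
qed

lemma Dic12_representation: "ring_representation Dic12 (dic_elt w y)"
proof -
  have "p \<otimes>\<^bsub>Dic12\<^esub> q \<in> carrier Dic12" for p q
    by (cases p; cases q) (simp add: dicyclic_group_def)
  moreover have "finite (carrier Dic12)" by (simp add: dicyclic_group_def)
  moreover have "1 \<in> dic_elt w y ` carrier Dic12"
    by (rule image_eqI[of _ _ "(0, False)"]) (simp_all add: dic_elt_def dicyclic_group_def)
  moreover have "w \<noteq> 0" "y \<noteq> 0" using ww yy by auto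
  then have "w ^ n * (if s then y else 1) \<noteq> 0" for n s
    using power_not_zero by (induction n) (auto simp: mult_eq_0_iff)
  then have "0 \<notin> dic_elt w y ` carrier Dic12" by (auto simp: dic_elt_def)
  ultimately show ?thesis
    unfolding ring_representation_def using inj_on_dic_elt dic_elt_mult by blast
qed

text \<open>\<open>w + w - 1\<close> is a square root of -3 in \<open>\<rat>(w)\<close>. It
  anticommutes with \<open>y\<close> because conjugation by \<open>y\<close> exchanges
  \<open>w\<close> and \<open>1 - w\<close>.\<close>

lemma dic_change_generators: "definite_quaternions scale (- 1) (- 3) y (w + w - 1)"
proof (rule change_generators)
  have "scale 3 (1::'d) = 1 + 1 + 1"
    using scale_left_distrib[of 2 1 "1::'d"] scale_left_distrib[of 1 1 "1::'d"] by simp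
  then show "(w + w - 1) * (w + w - 1) = scale (- 3) 1"
    by (simp add: algebra_simps ww)
  show "(w + w - 1) * y = - (y * (w + w - 1))"
    by (simp add: algebra_simps yw)
qed (simp_all add: yy)

end

text \<open>An inclusion of \<open>H\<close> in one of the two models is enough, as the maximality
  of the matrix group will fill the gap. Negatives are adjoined first; in the first case the pair
  found in the enlarged group becomes the new pair of generators, so that integrality of traces
  applies to the new coordinates.\<close>

theorem finite_noncommutative_embedding:
  fixes H :: "'d set"
  assumes fin: "finite H" and closed: "\<And>x y. x \<in> H \<Longrightarrow> y \<in> H \<Longrightarrow> x * y \<in> H"
    and one: "1 \<in> H" and zero: "0 \<notin> H" and xy: "x \<in> H" "y \<in> H" "x * y \<noteq> y * x"
  shows "(\<exists>u v \<phi>. definite_quaternions scale (- 1) (- 1) u v \<and>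
      ring_representation (SL TYPE(3) 2) \<phi> \<and> H \<subseteq> \<phi> ` carrier (SL TYPE(3) 2)) \<or>
    (\<exists>u v \<phi>. definite_quaternions scale (- 1) (- 3) u v \<and>
      ring_representation Dic12 \<phi> \<and> H \<subseteq> \<phi> ` carrier Dic12)"
proof -
  define H' where "H' = H \<union> uminus ` H"
  have closed': "x * y \<in> H'" if "x \<in> H'" "y \<in> H'" for x y
    using that closed unfolding H'_def by (auto simp: image_iff)
  have fin': "finite H'" and one': "1 \<in> H'" and zero': "0 \<notin> H'" using fin one zero by (auto simp: H'_def)
  interpret finite_symmetric_quaternion_group scale a b i j H'
    using fin' one' zero' closed' by unfold_locales (auto simp: H'_def)
  have "x \<in> H'" "y \<in> H'" using xy by (simp_all add: H'_def)
  from finite_noncommutative_cases[OF this xy(3)] show ?thesis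
  proof
    assume "\<exists>u\<in>H'. \<exists>v\<in>H'. u * u = - 1 \<and> v * v = - 1 \<and> v * u = - (u * v)"
    then obtain u v where uv: "u \<in> H'" "v \<in> H'" "u * u = - 1" "v * v = - 1" "v * u = - (u * v)" by blast
    have new: "definite_quaternions scale (- 1) (- 1) u v"
      by (rule change_generators) (simp_all add: uv)
    then interpret N: definite_quaternions scale "- 1" "- 1" u v .
    interpret N: finite_quaternion_group scale "- 1" "- 1" u v H'
      using fin' one' zero' closed' by unfold_locales auto
    have "H \<subseteq> hurwitz_elt u v ` hurwitz_coords"
      using N.subset_hurwitz uv(1,2) by (auto simp: H'_def)
    then show ?thesis using N.SL_representation new by metis
  next
    assume "\<exists>w y. w * w = w - 1 \<and> y * y = - 1 \<and> y * w = (1 - w) * y \<and> H' \<subseteq> dic_elt w y ` ({0..<6} \<times> UNIV)"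
    then obtain w y where wy: "w * w = w - 1" "y * y = - 1" "y * w = (1 - w) * y"
      "H' \<subseteq> dic_elt w y ` ({0..<6} \<times> UNIV)" by blast
    have "carrier Dic12 = {0..<6} \<times> UNIV" by (simp add: dicyclic_group_def)
    then have "H \<subseteq> dic_elt w y ` carrier Dic12" using wy(4) by (auto simp: H'_def)
    then show ?thesis using Dic12_representation[OF wy(1-3)] dic_change_generators[OF wy(1-3)] by blast
  qed
qed

end

section \<open>The field of p-adic numbers\<close>

locale padic =
  fixes p :: nat
  assumes prime: "Factorial_Ring.prime p"
begin

abbreviation v :: "rat \<Rightarrow> rat" where "v \<equiv> padic_abs p"

lemma p_gt_1: "1 < p" using prime prime_gt_1_nat by blast

lemma prime_elem: "prime_elem (int p)" using prime by simp

text \<open>Frees the absolute value from lowest terms: a common factor contributes equally to both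
  multiplicities.\<close>

lemma v_fraction:
  assumes "m \<noteq> 0" "n \<noteq> 0"
  shows "v (of_int m / of_int n) = of_nat p powi (int (multiplicity (int p) n) - int (multiplicity (int p) m))"
proof -
  obtain m' n' where q: "quotient_of (of_int m / of_int n) = (m', n')" by (cases "quotient_of (of_int m / of_int n)")
  have n': "n' > 0" "of_int m / of_int n = (of_int m' / of_int n' :: rat)"
    using q quotient_of_denom_pos quotient_of_div by blast+
  then have "(of_int (m * n') :: rat) = of_int (m' * n)" using assms by (simp add: field_simps)
  then have eq: "m * n' = m' * n" by (simp only: of_int_eq_iff)
  then have "m' \<noteq> 0" using assms n' by auto
  then have "multiplicity (int p) m + multiplicity (int p) n' = multiplicity (int p) m' + multiplicity (int p) n"
    using arg_cong[OF eq, of "multiplicity (int p)"] assms n'(1)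
    by (simp add: prime_elem_multiplicity_mult_distrib[OF prime_elem])
  then have "int (multiplicity (int p) n) - int (multiplicity (int p) m)
      = int (multiplicity (int p) n') - int (multiplicity (int p) m')" by linarith
  then show ?thesis using assms q by (simp add: padic_abs_def)
qed

lemma rat_fraction_cases:
  fixes x :: rat obtains m n :: int where "n > 0" "x = of_int m / of_int n" 
  by (metis quotient_of_denom_pos quotient_of_div surj_pair)

lemma v_0 [simp]: "v 0 = 0" by (simp add: padic_abs_def)

lemma v_pos: "x \<noteq> 0 \<Longrightarrow> 0 < v x"
  using p_gt_1 by (simp add: padic_abs_def)

lemma v_nonneg: "0 \<le> v x"
  using v_pos[of x] by (cases "x = 0") auto

lemma v_mult: "v (x * y) = v x * v y"
proof (cases "x = 0 \<or> y = 0")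
  case False
  obtain m n k l where mn: "n > 0" "x = of_int m / of_int n" "l > 0" "y = of_int k / of_int l"
    using rat_fraction_cases[of x] rat_fraction_cases[of y] by metis
  then have nz: "m \<noteq> 0" "k \<noteq> 0" "n \<noteq> 0" "l \<noteq> 0" using False by auto
  have "x * y = of_int (m * k) / of_int (n * l)" using mn by simp
  then have "v (x * y) = of_nat p powi (int (multiplicity (int p) (n * l)) - int (multiplicity (int p) (m * k)))"
    using v_fraction[of "m * k" "n * l"] nz by simp
  also have "\<dots> = of_nat p powi ((int (multiplicity (int p) n) - int (multiplicity (int p) m))
      + (int (multiplicity (int p) l) - int (multiplicity (int p) k)))"
    using nz by (simp add: prime_elem_multiplicity_mult_distrib[OF prime_elem] algebra_simps)
  also have "\<dots> = v x * v y"
    unfolding mn(2,4) v_fraction[OF nz(1,3)] v_fraction[OF nz(2,4)] using p_gt_1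
    by (intro power_int_add) auto
  finally show ?thesis .
qed auto

lemma v_int:
  assumes "m \<noteq> 0" shows "v (of_int m) = 1 / of_nat p ^ multiplicity (int p) m"
proof -
  have "v (of_int m) = of_nat p powi (- int (multiplicity (int p) m))"
    using v_fraction[OF assms, of 1] by simp
  also have "\<dots> = 1 / of_nat p ^ multiplicity (int p) m" by (simp add: power_int_minus divide_inverse)
  finally show ?thesis .
qed

lemma v_int_le_iff:
  assumes "m \<noteq> 0"
  shows "v (of_int m) \<le> 1 / of_nat p ^ k \<longleftrightarrow> int p ^ k dvd m"
proof -
  have "v (of_int m) \<le> 1 / of_nat p ^ k \<longleftrightarrow> (of_nat p ^ k :: rat) \<le> of_nat p ^ multiplicity (int p) m"
    unfolding v_int[OF assms] using p_gt_1 by (simp add: field_simps)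
  also have "\<dots> \<longleftrightarrow> k \<le> multiplicity (int p) m" using p_gt_1 by simp
  also have "\<dots> \<longleftrightarrow> int p ^ k dvd m"
    using assms prime_elem by (subst power_dvd_iff_le_multiplicity) auto
  finally show ?thesis .
qed

lemma v_int_le: "int p ^ k dvd m \<Longrightarrow> v (of_int m) \<le> 1 / of_nat p ^ k"
  using v_int_le_iff[of m k] by (cases "m = 0") auto

lemma v_1 [simp]: "v 1 = 1"
  using v_fraction[of 1 1] by simp

lemma v_uminus [simp]: "v (- x) = v x"
proof -
  have "v (- 1) * v (- 1) = 1" using v_mult[of "- 1" "- 1"] by simp
  then have "v (- 1) = 1" using v_nonneg[of "- 1"] power2_eq_1_iff[of "v (- 1)"]
    by (auto simp: power2_eq_square)
  then show ?thesis using v_mult[of "- 1" x] by simp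
qed

lemma v_int_le_1: "v (of_int m) \<le> 1"
  using v_int_le[of 0 m] by simp

text \<open>Clearing denominators turns the inequality into divisibility: if \<open>p ^ e\<close> is
  the exact power of \<open>p\<close> in the numerator with the larger absolute value, it divides
  both numerators and hence their sum.\<close>

lemma v_ultrametric: "v (x + y) \<le> max (v x) (v y)"
proof -
  have le: "v (x + y) \<le> v y" if "v x \<le> v y" for x y
  proof (cases "y = 0 \<or> x = 0")
    case True
    then show ?thesis using that v_pos[of x] by fastforce
  next
    case False
    obtain m n k l where mn: "n > 0" "x = of_int m / of_int n" "l > 0" "y = of_int k / of_int l"
      using rat_fraction_cases[of x] rat_fraction_cases[of y] by metis
    define D :: rat where "D = of_int (n * l)"
    have D: "D \<noteq> 0" using mn by (simp add: D_def)
    have ints: "x * D = of_int (m * l)" "y * D = of_int (k * n)" using mn by (simp_all add: D_def)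
    have nz: "m * l \<noteq> 0" "k * n \<noteq> 0" using False mn by auto
    define e where "e = multiplicity (int p) (k * n)"
    have yD: "v (y * D) = 1 / of_nat p ^ e"
      unfolding ints e_def by (rule v_int[OF nz(2)])
    have "v (x * D) \<le> v (y * D)" using that v_nonneg by (simp add: v_mult mult_right_mono)
    then have "v (of_int (m * l)) \<le> 1 / of_nat p ^ e" unfolding yD ints(1) .
    then have "int p ^ e dvd m * l" using v_int_le_iff nz by blast
    moreover have "int p ^ e dvd k * n" unfolding e_def by (rule multiplicity_dvd)
    ultimately have "int p ^ e dvd m * l + k * n" by (rule dvd_add)
    then have "v (of_int (m * l + k * n)) \<le> v (y * D)" unfolding yD by (rule v_int_le)
    moreover have "of_int (m * l + k * n) = (x + y) * D" using ints by (simp add: distrib_right)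
    ultimately have "v (x + y) * v D \<le> v y * v D" by (simp only: v_mult)
    then show ?thesis using v_pos[OF D] by simp
  qed
  show ?thesis using le[of x y] le[of y x] by (cases "v x \<le> v y") (auto simp: add.commute max_def)
qed

lemma v_add_less: "v x < e \<Longrightarrow> v y < e \<Longrightarrow> v (x + y) < e"
  using v_ultrametric[of x y] by simp

lemma v_diff_less: "v x < e \<Longrightarrow> v y < e \<Longrightarrow> v (x - y) < e"
  using v_add_less[of x e "- y"] by simp

abbreviation "C \<equiv> padic_cauchy p"
abbreviation "N \<equiv> padic_null p"

lemma C_D: "u \<in> C \<Longrightarrow> e > 0 \<Longrightarrow> \<exists>M. \<forall>m\<ge>M. \<forall>n\<ge>M. v (u m - u n) < e"
  by (simp add: padic_cauchy_def)

lemma N_D: "u \<in> N \<Longrightarrow> e > 0 \<Longrightarrow> \<exists>M. \<forall>n\<ge>M. v (u n) < e"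
  by (simp add: padic_null_def)

lemma bounded: assumes "u \<in> C" obtains B where "B > 0" "\<And>n. v (u n) \<le> B"
proof -
  obtain M where M: "\<forall>m\<ge>M. \<forall>n\<ge>M. v (u m - u n) < 1" using C_D[OF assms, of 1] by auto
  define B where "B = Max (insert 1 ((\<lambda>n. v (u n)) ` {..M}))"
  have B: "1 \<le> B" "n \<le> M \<Longrightarrow> v (u n) \<le> B" for n unfolding B_def by (intro Max_ge; simp)+
  have "v (u n) \<le> B" for n
  proof (cases "n \<le> M")
    case False
    then have "v (u n - u M) < 1" using M by simp
    then show ?thesis using v_ultrametric[of "u n - u M" "u M"] B(1) B(2)[of M] by simp
  qed (rule B(2))
  then show ?thesis using that[of B] B(1) by simp
qed

lemma N_subset_C: "N \<subseteq> C"
proof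
  fix u assume u: "u \<in> N"
  have "\<exists>M. \<forall>m\<ge>M. \<forall>n\<ge>M. v (u m - u n) < e" if e: "e > 0" for e
  proof -
    obtain M where "\<forall>n\<ge>M. v (u n) < e" using N_D[OF u e] by auto
    then show ?thesis using v_diff_less by blast
  qed
  then show "u \<in> C" by (simp add: padic_cauchy_def)
qed

lemma const_C [simp]: "(\<lambda>n. c) \<in> C"
  by (simp add: padic_cauchy_def)

lemma add_C [simp]: assumes "u \<in> C" "w \<in> C" shows "(\<lambda>n. u n + w n) \<in> C"
  unfolding padic_cauchy_def
proof (clarify)
  fix e :: rat assume e: "e > 0"
  obtain M1 M2 where M: "\<forall>m\<ge>M1. \<forall>n\<ge>M1. v (u m - u n) < e" "\<forall>m\<ge>M2. \<forall>n\<ge>M2. v (w m - w n) < e"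
    using C_D[OF assms(1) e] C_D[OF assms(2) e] by auto
  have "v (u m + w m - (u n + w n)) < e" if "m \<ge> max M1 M2" "n \<ge> max M1 M2" for m n
    using v_add_less[of "u m - u n" e "w m - w n"] M that by (simp add: add_diff_add)
  then show "\<exists>M. \<forall>m\<ge>M. \<forall>n\<ge>M. v (u m + w m - (u n + w n)) < e" by blast
qed

lemma mult_C [simp]: assumes "u \<in> C" "w \<in> C" shows "(\<lambda>n. u n * w n) \<in> C"
  unfolding padic_cauchy_def
proof (clarify)
  fix e :: rat assume e: "e > 0"
  obtain A B where A: "A > 0" "\<And>n. v (u n) \<le> A" and B: "B > 0" "\<And>n. v (w n) \<le> B"
    using bounded assms by metis
  have "e / A > 0" "e / B > 0" using e A B by simp_all
  then obtain M1 M2 where M: "\<forall>m\<ge>M1. \<forall>n\<ge>M1. v (u m - u n) < e / B" "\<forall>m\<ge>M2. \<forall>n\<ge>M2. v (w m - w n) < e / A"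
    using C_D[OF assms(1)] C_D[OF assms(2)] by meson
  have "v (u m * w m - u n * w n) < e" if "m \<ge> max M1 M2" "n \<ge> max M1 M2" for m n
  proof -
    have "v ((u m - u n) * w m) \<le> v (u m - u n) * B" using B v_nonneg by (simp add: v_mult mult_left_mono)
    also have "\<dots> < e" using M(1) that B(1) by (simp add: pos_less_divide_eq)
    finally have 1: "v ((u m - u n) * w m) < e" .
    have "v (u n * (w m - w n)) \<le> A * v (w m - w n)" using A v_nonneg by (simp add: v_mult mult_right_mono)
    also have "\<dots> < e" using M(2) that A(1) by (simp add: pos_less_divide_eq mult.commute)
    finally have 2: "v (u n * (w m - w n)) < e" .
    have "u m * w m - u n * w n = (u m - u n) * w m + u n * (w m - w n)" by (simp add: algebra_simps)
    then show ?thesis using v_add_less[OF 1 2] by simp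
  qed
  then show "\<exists>M. \<forall>m\<ge>M. \<forall>n\<ge>M. v (u m * w m - u n * w n) < e" by blast
qed

lemma uminus_C [simp]: "u \<in> C \<Longrightarrow> (\<lambda>n. - u n) \<in> C"
  using mult_C[of "\<lambda>n. - 1" u] by simp

lemma diff_C [simp]: "u \<in> C \<Longrightarrow> w \<in> C \<Longrightarrow> (\<lambda>n. u n - w n) \<in> C"
  using add_C[of u "\<lambda>n. - w n"] by simp

lemma add_N: assumes "u \<in> N" "w \<in> N" shows "(\<lambda>n. u n + w n) \<in> N"
  unfolding padic_null_def
proof (clarify)
  fix e :: rat assume e: "e > 0"
  obtain M1 M2 where M: "\<forall>n\<ge>M1. v (u n) < e" "\<forall>n\<ge>M2. v (w n) < e"
    using N_D[OF assms(1) e] N_D[OF assms(2) e] by auto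
  have "v (u n + w n) < e" if "n \<ge> max M1 M2" for n
    using v_add_less M that by simp
  then show "\<exists>M. \<forall>n\<ge>M. v (u n + w n) < e" by blast
qed

lemma mult_N: assumes "u \<in> C" "w \<in> N" shows "(\<lambda>n. u n * w n) \<in> N"
  unfolding padic_null_def
proof (clarify)
  fix e :: rat assume e: "e > 0"
  obtain A where A: "A > 0" "\<And>n. v (u n) \<le> A" using bounded assms(1) by metis
  have "e / A > 0" using e A by simp
  then obtain M where M: "\<forall>n\<ge>M. v (w n) < e / A" using N_D[OF assms(2)] by blast
  have "v (u n * w n) < e" if "n \<ge> M" for n
  proof -
    have "v (u n * w n) \<le> A * v (w n)" using A v_nonneg by (simp add: v_mult mult_right_mono)
    also have "\<dots> < e" using M that A(1) by (simp add: pos_less_divide_eq mult.commute)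
    finally show ?thesis .
  qed
  then show "\<exists>M. \<forall>n\<ge>M. v (u n * w n) < e" by blast
qed

lemma const_N_iff: "(\<lambda>n. c) \<in> N \<longleftrightarrow> c = 0"
proof
  assume "(\<lambda>n. c) \<in> N"
  then show "c = 0" using N_D[of "\<lambda>n. c" "v c"] v_pos[of c] by (cases "c = 0") auto
qed (simp add: padic_null_def)

text \<open>A Cauchy sequence that is not null stays away from 0: by the ultrametric inequality
  \<open>v (u n) \<ge> e\<close> from some index on. The inverse is taken termwise; earlier terms
  that are 0 get inverse 0, which does not affect limits.\<close>

lemma nonnull_inverse:
  assumes u: "u \<in> C" "u \<notin> N"
  obtains w where "w \<in> C" "(\<lambda>n. u n * w n - 1) \<in> N"
proof -
  obtain e where e: "e > 0" "\<And>M. \<exists>n\<ge>M. v (u n) \<ge> e"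
    using u(2) unfolding padic_null_def by (auto simp: not_less)
  obtain M where M: "\<forall>m\<ge>M. \<forall>n\<ge>M. v (u m - u n) < e" using C_D[OF u(1) e(1)] by auto
  obtain n0 where n0: "n0 \<ge> M" "v (u n0) \<ge> e" using e(2) by blast
  have ge: "v (u m) \<ge> e" if "m \<ge> M" for m
    using v_ultrametric[of "u n0 - u m" "u m"] M[rule_format, OF n0(1) that] n0(2) by simp
  define w where "w n = inverse (u n)" for n
  have "(\<lambda>n. w n) \<in> C" unfolding padic_cauchy_def
  proof (clarify)
    fix d :: rat assume d: "d > 0"
    then have "d * (e * e) > 0" using e by simp
    then obtain M' where M': "\<forall>m\<ge>M'. \<forall>n\<ge>M'. v (u m - u n) < d * (e * e)" using C_D[OF u(1)] by blast
    have "v (w m - w n) < d" if "m \<ge> max M M'" "n \<ge> max M M'" for m n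
    proof -
      have mn: "v (u m) \<ge> e" "v (u n) \<ge> e" using ge that by simp_all
      then have nz: "u m \<noteq> 0" "u n \<noteq> 0" using e by auto
      have "(w m - w n) * (u m * u n) = u n - u m" using nz by (simp add: w_def field_simps)
      then have "v (w m - w n) * (v (u m) * v (u n)) = v (u n - u m)" by (metis v_mult)
      also have "\<dots> < d * (e * e)" using M' that by simp
      also have "\<dots> \<le> d * (v (u m) * v (u n))" using mn e d by (intro mult_left_mono mult_mono) auto
      finally have "v (w m - w n) * (v (u m) * v (u n)) < d * (v (u m) * v (u n))" .
      then show ?thesis by (rule mult_right_less_imp_less) (simp add: v_nonneg)
    qed
    then show "\<exists>M. \<forall>m\<ge>M. \<forall>n\<ge>M. v (w m - w n) < d" by blast
  qed
  moreover have "(\<lambda>n. u n * w n - 1) \<in> N" unfolding padic_null_def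
  proof (clarify)
    fix d :: rat assume d: "d > 0"
    have "v (u n * w n - 1) < d" if "n \<ge> M" for n
    proof -
      have "u n \<noteq> 0" using ge[OF that] e by auto
      then show ?thesis using d by (simp add: w_def)
    qed
    then show "\<exists>M. \<forall>n\<ge>M. v (u n * w n - 1) < d" by blast
  qed
  ultimately show ?thesis using that by simp
qed

end

section \<open>Quaternion algebras over the field of p-adic numbers\<close>

context padic
begin

abbreviation "R \<equiv> padic_cauchy_ring p"
abbreviation "K \<equiv> padic_field p"

lemma R_simps: "carrier R = C" "x \<otimes>\<^bsub>R\<^esub> y = (\<lambda>n. x n * y n)" "x \<oplus>\<^bsub>R\<^esub> y = (\<lambda>n. x n + y n)"
  "\<one>\<^bsub>R\<^esub> = (\<lambda>n. 1)" "\<zero>\<^bsub>R\<^esub> = (\<lambda>n. 0)"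
  by (simp_all add: padic_cauchy_ring_def)

lemma cring_R: "cring R"
proof (rule cringI)
  show "abelian_group R"
    by (rule abelian_groupI) (auto simp: R_simps add.assoc add.commute intro!: bexI[of _ "\<lambda>n. - _ n"] ext)
  show "comm_monoid R"
    by (rule comm_monoidI) (auto simp: R_simps mult.assoc mult.commute)
qed (auto simp: R_simps distrib_right)

interpretation R: cring R by (rule cring_R)

lemma minus_R: "u \<in> C \<Longrightarrow> \<ominus>\<^bsub>R\<^esub> u = (\<lambda>n. - u n)"
  by (rule R.minus_equality) (auto simp: R_simps)

lemma ideal_N: "ideal N R"
proof (rule idealI)
  show "Ring.ring R" by (rule R.ring_axioms)
  show "subgroup N (add_monoid R)"
  proof (rule R.add.subgroupI)
    show "N \<subseteq> carrier R" using N_subset_C by (simp add: R_simps)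
    show "N \<noteq> {}" using const_N_iff[of 0] by auto
    show "\<ominus>\<^bsub>R\<^esub> u \<in> N" if "u \<in> N" for u
      using mult_N[of "\<lambda>n. - 1" u] minus_R[of u] N_subset_C that by auto
    show "u \<oplus>\<^bsub>R\<^esub> w \<in> N" if "u \<in> N" "w \<in> N" for u w
      using add_N that by (simp add: R_simps)
  qed
  show "x \<otimes>\<^bsub>R\<^esub> a \<in> N" "a \<otimes>\<^bsub>R\<^esub> x \<in> N" if "a \<in> N" "x \<in> carrier R" for a x
    using mult_N[of x a] that by (simp_all add: R_simps mult.commute)
qed

interpretation N: ideal N R by (rule ideal_N)

definition cl :: "(nat \<Rightarrow> rat) \<Rightarrow> (nat \<Rightarrow> rat) set" where
  "cl u = N +>\<^bsub>R\<^esub> u"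

lemma hom: "ring_hom_ring R K cl"
  unfolding padic_field_def cl_def[abs_def] by (rule N.rcos_ring_hom_ring)

interpretation cl: ring_hom_ring R K cl by (rule hom)

lemma cring_K: "cring K"
  unfolding padic_field_def by (rule N.quotient_is_cring[OF cring_R])

interpretation K: cring K by (rule cring_K)

lemma padic_of_rat_eq: "padic_of_rat p x = cl (\<lambda>n. x)"
  by (simp add: padic_of_rat_def cl_def)

lemma K_cases: assumes "x \<in> carrier K" obtains u where "u \<in> C" "x = cl u"
  using assms unfolding padic_field_def cl_def FactRing_def A_RCOSETS_defs a_r_coset_def
  by (auto simp: R_simps RCOSETS_def)

lemma cl_closed [simp]: "u \<in> C \<Longrightarrow> cl u \<in> carrier K"
  using cl.hom_closed by (simp add: R_simps)

lemma cl_add: "u \<in> C \<Longrightarrow> w \<in> C \<Longrightarrow> cl u \<oplus>\<^bsub>K\<^esub> cl w = cl (\<lambda>n. u n + w n)"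
  using cl.hom_add[of u w] by (simp add: R_simps)

lemma cl_mult: "u \<in> C \<Longrightarrow> w \<in> C \<Longrightarrow> cl u \<otimes>\<^bsub>K\<^esub> cl w = cl (\<lambda>n. u n * w n)"
  using cl.hom_mult[of u w] by (simp add: R_simps)

lemma cl_diff: "u \<in> C \<Longrightarrow> w \<in> C \<Longrightarrow> cl u \<ominus>\<^bsub>K\<^esub> cl w = cl (\<lambda>n. u n - w n)"
  using cl.hom_a_inv[of w] minus_R[of w] cl_add[of u "\<lambda>n. - w n"]
  by (simp add: R_simps a_minus_def)

lemma cl_zero: "\<zero>\<^bsub>K\<^esub> = cl (\<lambda>n. 0)" and cl_one: "\<one>\<^bsub>K\<^esub> = cl (\<lambda>n. 1)"
  using cl.hom_zero cl.hom_one by (simp_all add: R_simps)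

lemma cl_eq_iff: assumes "u \<in> C" "w \<in> C" shows "cl u = cl w \<longleftrightarrow> (\<lambda>n. u n - w n) \<in> N"
proof -
  have "cl u = cl w \<longleftrightarrow> u \<ominus>\<^bsub>R\<^esub> w \<in> N"
    unfolding cl_def using R.quotient_eq_iff_same_a_r_cos[OF ideal_N] assms by (simp add: R_simps)
  also have "u \<ominus>\<^bsub>R\<^esub> w = (\<lambda>n. u n - w n)"
    using assms minus_R[of w] by (simp add: a_minus_def R_simps)
  finally show ?thesis .
qed

lemma cl_eq_zero_iff: "u \<in> C \<Longrightarrow> cl u = \<zero>\<^bsub>K\<^esub> \<longleftrightarrow> u \<in> N"
  unfolding cl_zero using cl_eq_iff[of u "\<lambda>n. 0"] by simp

context
  fixes a b :: rat
begin

abbreviation "Q \<equiv> quat_alg K (padic_of_rat p a) (padic_of_rat p b)"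

text \<open>Quaternions over the quotient are handled through representatives:
  \<open>Q_carrier\<close> supplies Cauchy sequences, and the ring laws become termwise identities
  between rationals.\<close>

definition qcl :: "(nat \<Rightarrow> rat) \<Rightarrow> (nat \<Rightarrow> rat) \<Rightarrow> (nat \<Rightarrow> rat) \<Rightarrow> (nat \<Rightarrow> rat) \<Rightarrow> _" where
  "qcl t x y z = (cl t, cl x, cl y, cl z)"

lemma Q_carrier: "q \<in> carrier Q \<longleftrightarrow> (\<exists>t\<in>C. \<exists>x\<in>C. \<exists>y\<in>C. \<exists>z\<in>C. q = qcl t x y z)"
proof -
  obtain t x y z where q: "q = (t, x, y, z)" by (metis prod_cases4)
  show ?thesis unfolding q quat_alg_def qcl_def
    by (auto elim!: K_cases)
qed

lemma Q_mult:
  assumes "t \<in> C" "x \<in> C" "y \<in> C" "z \<in> C" "t' \<in> C" "x' \<in> C" "y' \<in> C" "z' \<in> C"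
  shows "qcl t x y z \<otimes>\<^bsub>Q\<^esub> qcl t' x' y' z' = qcl
    (\<lambda>n. t n * t' n + a * x n * x' n + b * y n * y' n - a * b * z n * z' n)
    (\<lambda>n. t n * x' n + x n * t' n + b * z n * y' n - b * y n * z' n)
    (\<lambda>n. t n * y' n + y n * t' n + a * x n * z' n - a * z n * x' n)
    (\<lambda>n. t n * z' n + z n * t' n + x n * y' n - y n * x' n)"
  using assms by (simp add: quat_alg_def qcl_def padic_of_rat_eq cl_add cl_mult cl_diff)

lemma Q_add:
  assumes "t \<in> C" "x \<in> C" "y \<in> C" "z \<in> C" "t' \<in> C" "x' \<in> C" "y' \<in> C" "z' \<in> C"
  shows "qcl t x y z \<oplus>\<^bsub>Q\<^esub> qcl t' x' y' z' =
    qcl (\<lambda>n. t n + t' n) (\<lambda>n. x n + x' n) (\<lambda>n. y n + y' n) (\<lambda>n. z n + z' n)"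
  using assms by (simp add: quat_alg_def qcl_def cl_add)

lemma Q_one: "\<one>\<^bsub>Q\<^esub> = qcl (\<lambda>n. 1) (\<lambda>n. 0) (\<lambda>n. 0) (\<lambda>n. 0)"
  and Q_zero: "\<zero>\<^bsub>Q\<^esub> = qcl (\<lambda>n. 0) (\<lambda>n. 0) (\<lambda>n. 0) (\<lambda>n. 0)"
  by (simp_all add: quat_alg_def qcl_def cl_zero cl_one)

lemma qcl_closed:
  "t \<in> C \<Longrightarrow> x \<in> C \<Longrightarrow> y \<in> C \<Longrightarrow> z \<in> C \<Longrightarrow> qcl t x y z \<in> carrier Q"
  using Q_carrier by blast

lemma qcl_eq_zero_iff:
  assumes "t \<in> C" "x \<in> C" "y \<in> C" "z \<in> C"
  shows "qcl t x y z = \<zero>\<^bsub>Q\<^esub> \<longleftrightarrow> t \<in> N \<and> x \<in> N \<and> y \<in> N \<and> z \<in> N"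
  using assms by (simp add: Q_zero qcl_def cl_eq_zero_iff[unfolded cl_zero])

lemma Q_ring: "Ring.ring Q"
proof (rule ringI)
  show "abelian_group Q"
  proof (rule abelian_groupI)
    show "p \<oplus>\<^bsub>Q\<^esub> q \<in> carrier Q" if "p \<in> carrier Q" "q \<in> carrier Q" for p q
      using that unfolding Q_carrier by (elim bexE) (simp add: Q_add, blast intro: add_C)
    show "p \<oplus>\<^bsub>Q\<^esub> q \<oplus>\<^bsub>Q\<^esub> r = p \<oplus>\<^bsub>Q\<^esub> (q \<oplus>\<^bsub>Q\<^esub> r)" if "p \<in> carrier Q" "q \<in> carrier Q" "r \<in> carrier Q" for p q r
      using that unfolding Q_carrier by (elim bexE) (simp add: Q_add add.assoc)
    show "p \<oplus>\<^bsub>Q\<^esub> q = q \<oplus>\<^bsub>Q\<^esub> p" if "p \<in> carrier Q" "q \<in> carrier Q" for p q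
      using that unfolding Q_carrier by (elim bexE) (simp add: Q_add add.commute)
    show "\<zero>\<^bsub>Q\<^esub> \<in> carrier Q" unfolding Q_zero by (rule qcl_closed) auto
    show "\<zero>\<^bsub>Q\<^esub> \<oplus>\<^bsub>Q\<^esub> q = q" if "q \<in> carrier Q" for q
      using that unfolding Q_carrier Q_zero by (elim bexE) (simp add: Q_add)
    show "\<exists>r\<in>carrier Q. r \<oplus>\<^bsub>Q\<^esub> q = \<zero>\<^bsub>Q\<^esub>" if q: "q \<in> carrier Q" for q
    proof -
      obtain t x y z where "t \<in> C" "x \<in> C" "y \<in> C" "z \<in> C" "q = qcl t x y z" using q Q_carrier by blast
      then show ?thesis unfolding Q_zero
        by (intro bexI[of _ "qcl (\<lambda>n. - t n) (\<lambda>n. - x n) (\<lambda>n. - y n) (\<lambda>n. - z n)"])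
          (simp_all add: Q_add qcl_closed)
    qed
  qed
  show "Group.monoid Q"
  proof (rule monoidI)
    show "p \<otimes>\<^bsub>Q\<^esub> q \<in> carrier Q" if pq: "p \<in> carrier Q" "q \<in> carrier Q" for p q
    proof -
      obtain t x y z where "t \<in> C" "x \<in> C" "y \<in> C" "z \<in> C" "p = qcl t x y z" using pq Q_carrier by blast
      moreover obtain t x y z where "t \<in> C" "x \<in> C" "y \<in> C" "z \<in> C" "q = qcl t x y z" using pq Q_carrier by blast
      ultimately show ?thesis by (simp add: Q_mult qcl_closed)
    qed
    show "p \<otimes>\<^bsub>Q\<^esub> q \<otimes>\<^bsub>Q\<^esub> r = p \<otimes>\<^bsub>Q\<^esub> (q \<otimes>\<^bsub>Q\<^esub> r)" if "p \<in> carrier Q" "q \<in> carrier Q" "r \<in> carrier Q" for p q r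
      using that unfolding Q_carrier by (elim bexE) (simp add: Q_mult, simp add: algebra_simps)
    show "\<one>\<^bsub>Q\<^esub> \<in> carrier Q" unfolding Q_one by (rule qcl_closed) auto
    show "\<one>\<^bsub>Q\<^esub> \<otimes>\<^bsub>Q\<^esub> q = q" if "q \<in> carrier Q" for q
      using that unfolding Q_carrier Q_one by (elim bexE) (simp add: Q_mult)
    show "q \<otimes>\<^bsub>Q\<^esub> \<one>\<^bsub>Q\<^esub> = q" if "q \<in> carrier Q" for q
      using that unfolding Q_carrier Q_one by (elim bexE) (simp add: Q_mult)
  qed
  show "(p \<oplus>\<^bsub>Q\<^esub> q) \<otimes>\<^bsub>Q\<^esub> r = p \<otimes>\<^bsub>Q\<^esub> r \<oplus>\<^bsub>Q\<^esub> q \<otimes>\<^bsub>Q\<^esub> r" if "p \<in> carrier Q" "q \<in> carrier Q" "r \<in> carrier Q" for p q r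
    using that unfolding Q_carrier by (elim bexE) (simp add: Q_mult Q_add, simp add: algebra_simps)
  show "r \<otimes>\<^bsub>Q\<^esub> (p \<oplus>\<^bsub>Q\<^esub> q) = r \<otimes>\<^bsub>Q\<^esub> p \<oplus>\<^bsub>Q\<^esub> r \<otimes>\<^bsub>Q\<^esub> q" if "p \<in> carrier Q" "q \<in> carrier Q" "r \<in> carrier Q" for p q r
    using that unfolding Q_carrier by (elim bexE) (simp add: Q_mult Q_add, simp add: algebra_simps)
qed

abbreviation "norm_form t x y z \<equiv> \<lambda>n. t n * t n - a * x n * x n - b * y n * y n + a * b * z n * z n"

text \<open>A quaternion times its conjugate is its norm. If \<open>?u\<close> had norm 0 and were
  invertible, its conjugate would vanish, and with it \<open>?u\<close>.\<close>

lemma isotropic_not_division: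
  assumes C: "t \<in> C" "x \<in> C" "y \<in> C" "z \<in> C" and null: "norm_form t x y z \<in> N"
    and nz: "\<not> (t \<in> N \<and> x \<in> N \<and> y \<in> N \<and> z \<in> N)"
  shows "\<not> division_algebra Q"
proof
  assume div: "division_algebra Q"
  interpret Q: Ring.ring Q by (rule Q_ring)
  let ?u = "qcl t x y z" and ?v = "qcl t (\<lambda>n. - x n) (\<lambda>n. - y n) (\<lambda>n. - z n)"
  have u: "?u \<in> carrier Q" and v: "?v \<in> carrier Q" using C by (simp_all add: qcl_closed)
  have "?u \<in> Units Q" using div u nz qcl_eq_zero_iff[OF C] by (simp add: division_algebra_def)
  then obtain w where w: "w \<in> carrier Q" "w \<otimes>\<^bsub>Q\<^esub> ?u = \<one>\<^bsub>Q\<^esub>" by (auto simp: Units_def)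
  have "?u \<otimes>\<^bsub>Q\<^esub> ?v = qcl (norm_form t x y z) (\<lambda>n. 0) (\<lambda>n. 0) (\<lambda>n. 0)"
    using C by (simp add: Q_mult algebra_simps)
  also have "\<dots> = \<zero>\<^bsub>Q\<^esub>" using C null by (subst qcl_eq_zero_iff) (simp_all add: const_N_iff)
  finally have uv: "?u \<otimes>\<^bsub>Q\<^esub> ?v = \<zero>\<^bsub>Q\<^esub>" .
  have "?v = w \<otimes>\<^bsub>Q\<^esub> ?u \<otimes>\<^bsub>Q\<^esub> ?v" using w v by simp
  also have "\<dots> = w \<otimes>\<^bsub>Q\<^esub> (?u \<otimes>\<^bsub>Q\<^esub> ?v)" by (rule Q.m_assoc[OF w(1) u v])
  also have "\<dots> = \<zero>\<^bsub>Q\<^esub>" using w(1) by (simp only: uv Q.r_null)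
  finally have "t \<in> N \<and> (\<lambda>n. - x n) \<in> N \<and> (\<lambda>n. - y n) \<in> N \<and> (\<lambda>n. - z n) \<in> N"
    using C by (simp add: qcl_eq_zero_iff)
  then show False using nz mult_N[of "\<lambda>n. - 1"] by force
qed

text \<open>The inverse is the conjugate divided by the norm; anisotropy makes the norm a non-null
  sequence, which \<open>nonnull_inverse\<close> inverts.\<close>

lemma anisotropic_division:
  assumes anisotropic: "\<And>t x y z. t \<in> C \<Longrightarrow> x \<in> C \<Longrightarrow> y \<in> C \<Longrightarrow> z \<in> C \<Longrightarrow>
    norm_form t x y z \<in> N \<Longrightarrow> t \<in> N \<and> x \<in> N \<and> y \<in> N \<and> z \<in> N"
  shows "division_algebra Q"
proof -
  interpret Q: Ring.ring Q by (rule Q_ring)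
  have one: "\<one>\<^bsub>Q\<^esub> \<noteq> \<zero>\<^bsub>Q\<^esub>"
    unfolding Q_one by (subst qcl_eq_zero_iff) (simp_all add: const_N_iff)
  have "q \<in> Units Q" if q: "q \<in> carrier Q" "q \<noteq> \<zero>\<^bsub>Q\<^esub>" for q
  proof -
    obtain t x y z where C: "t \<in> C" "x \<in> C" "y \<in> C" "z \<in> C" and q': "q = qcl t x y z" using q Q_carrier by blast
    then have "norm_form t x y z \<notin> N" using anisotropic[OF C] q(2) qcl_eq_zero_iff[OF C] by blast
    moreover have "norm_form t x y z \<in> C" using C by simp
    ultimately obtain w where w: "w \<in> C" "(\<lambda>n. norm_form t x y z n * w n - 1) \<in> N" using nonnull_inverse by blast
    let ?w = "qcl (\<lambda>n. t n * w n) (\<lambda>n. - x n * w n) (\<lambda>n. - y n * w n) (\<lambda>n. - z n * w n)"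
    have wc: "?w \<in> carrier Q" using C w by (simp add: qcl_closed)
    have eq: "cl (\<lambda>n. norm_form t x y z n * w n) = cl (\<lambda>n. 1)"
      using C w by (subst cl_eq_iff) simp_all
    have "q \<otimes>\<^bsub>Q\<^esub> ?w = qcl (\<lambda>n. norm_form t x y z n * w n) (\<lambda>n. 0) (\<lambda>n. 0) (\<lambda>n. 0)"
      using C w(1) by (simp add: q' Q_mult algebra_simps)
    moreover have "?w \<otimes>\<^bsub>Q\<^esub> q = qcl (\<lambda>n. norm_form t x y z n * w n) (\<lambda>n. 0) (\<lambda>n. 0) (\<lambda>n. 0)"
      using C w(1) by (simp add: q' Q_mult algebra_simps)
    ultimately show ?thesis using q(1) wc eq by (auto simp: Units_def Q_one qcl_def)
  qed
  moreover have "\<zero>\<^bsub>Q\<^esub> \<notin> Units Q"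
  proof
    assume "\<zero>\<^bsub>Q\<^esub> \<in> Units Q"
    then obtain w where "w \<in> carrier Q" "w \<otimes>\<^bsub>Q\<^esub> \<zero>\<^bsub>Q\<^esub> = \<one>\<^bsub>Q\<^esub>" by (auto simp: Units_def)
    then show False using one by simp
  qed
  ultimately have "Units Q = carrier Q - {\<zero>\<^bsub>Q\<^esub>}" by (auto simp: Units_def)
  then show ?thesis using one Q_ring by (simp add: division_algebra_def)
qed

end

end

section \<open>Ramification\<close>

text \<open>If \<open>a \<ge> 0\<close>, then \<open>sqrt a + i\<close> and
  \<open>sqrt a - i\<close> are nonzero with product 0; likewise for \<open>b\<close> and
  \<open>j\<close>.\<close>

lemma real_quaternions_definite:
  fixes a b :: rat
  assumes div: "division_algebra (quat_alg (ring_of_type_algebra :: real ring) (of_rat a) (of_rat b))"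
    and nz: "a \<noteq> 0" "b \<noteq> 0"
  shows "a < 0" "b < 0"
proof -
  let ?Q = "quat_alg (ring_of_type_algebra :: real ring) (of_rat a) (of_rat b)"
  interpret Q: Ring.ring ?Q using div by (simp add: division_algebra_def)
  have K: "cring (ring_of_type_algebra :: real ring)" by (rule cring_from_type_algebra)
  interpret K: cring "ring_of_type_algebra :: real ring" by (rule K)
  have simps: "x \<otimes>\<^bsub>ring_of_type_algebra\<^esub> y = x * y" "x \<oplus>\<^bsub>ring_of_type_algebra\<^esub> y = x + y"
    "\<zero>\<^bsub>ring_of_type_algebra\<^esub> = (0::real)" "\<one>\<^bsub>ring_of_type_algebra\<^esub> = (1::real)"
    "carrier (ring_of_type_algebra :: real ring) = UNIV" for x y :: real
    by (simp_all add: ring_of_type_algebra_def)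
  have "\<ominus>\<^bsub>ring_of_type_algebra\<^esub> y = - y" for y :: real
    by (rule K.minus_equality) (simp_all add: simps)
  then have minus: "x \<ominus>\<^bsub>ring_of_type_algebra\<^esub> y = x - y" for x y :: real
    by (simp add: a_minus_def simps)
  have mult: "(t, x, y, z) \<otimes>\<^bsub>?Q\<^esub> (t', x', y', z') =
    (t * t' + of_rat a * x * x' + of_rat b * y * y' - of_rat a * of_rat b * z * z',
     t * x' + x * t' + of_rat b * z * y' - of_rat b * y * z',
     t * y' + y * t' + of_rat a * x * z' - of_rat a * z * x',
     t * z' + z * t' + x * y' - y * x')" for t x y z t' x' y' z' :: real
    by (simp add: quat_alg_def simps minus)
  have no_zero_divisors: "p = (0, 0, 0, 0) \<or> q = (0, 0, 0, 0)" if "p \<otimes>\<^bsub>?Q\<^esub> q = (0, 0, 0, 0)" for p q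
  proof (rule ccontr)
    have zero: "\<zero>\<^bsub>?Q\<^esub> = (0, 0, 0, 0)" and carrier: "carrier ?Q = UNIV" by (simp_all add: quat_alg_def simps)
    assume "\<not> (p = (0, 0, 0, 0) \<or> q = (0, 0, 0, 0))"
    then have "p \<in> Units ?Q" "q \<noteq> \<zero>\<^bsub>?Q\<^esub>" using div zero carrier by (simp_all add: division_algebra_def)
    then obtain r where r: "r \<otimes>\<^bsub>?Q\<^esub> p = \<one>\<^bsub>?Q\<^esub>" by (auto simp: Units_def)
    have in_carrier: "x \<in> carrier ?Q" for x using carrier by blast
    have "q = r \<otimes>\<^bsub>?Q\<^esub> p \<otimes>\<^bsub>?Q\<^esub> q" using r by (simp only: Q.l_one[OF in_carrier])
    also have "\<dots> = r \<otimes>\<^bsub>?Q\<^esub> (p \<otimes>\<^bsub>?Q\<^esub> q)" by (rule Q.m_assoc[OF in_carrier in_carrier in_carrier])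
    also have "\<dots> = \<zero>\<^bsub>?Q\<^esub>" unfolding that zero[symmetric] by (rule Q.r_null[OF in_carrier])
    finally show False using \<open>q \<noteq> \<zero>\<^bsub>?Q\<^esub>\<close> by simp
  qed
  show "a < 0"
  proof (rule ccontr)
    assume "\<not> a < 0"
    then have "of_rat a \<ge> (0::real)" by simp
    then have "(sqrt (of_rat a), 1, 0, 0) \<otimes>\<^bsub>?Q\<^esub> (sqrt (of_rat a), - 1, 0, 0) = (0, 0, 0, 0)"
      by (simp add: mult)
    then show False using no_zero_divisors by fastforce
  qed
  show "b < 0"
  proof (rule ccontr)
    assume "\<not> b < 0"
    then have "of_rat b \<ge> (0::real)" by simp
    then have "(sqrt (of_rat b), 0, 1, 0) \<otimes>\<^bsub>?Q\<^esub> (sqrt (of_rat b), 0, - 1, 0) = (0, 0, 0, 0)"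
      by (simp add: mult)
    then show False using no_zero_divisors by fastforce
  qed
qed

lemma totally_definite_obtains:
  assumes "totally_definite_quaternion_algebra scale"
  obtains a b i j where "definite_quaternions scale a b i j"
proof -
  have alg: "rational_algebra scale"
    using assms unfolding totally_definite_quaternion_algebra_def quaternion_algebra_def rat_algebra_def
      rational_algebra_def rational_algebra_axioms_def by metis
  obtain a b i j where gen: "quaternion_generators scale a b i j"
    and div: "division_algebra (quat_alg (ring_of_type_algebra :: real ring) (of_rat a) (of_rat b))"
    using assms unfolding totally_definite_quaternion_algebra_def ramified_at_infinity_def division_over_def by blast
  have "a \<noteq> 0" "b \<noteq> 0" using gen by (simp_all add: quaternion_generators_def)
  then have "a < 0" "b < 0" using real_quaternions_definite[OF div] by blast+
  then have "definite_quaternions scale a b i j"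
    using alg gen unfolding definite_quaternions_def definite_quaternions_axioms_def by blast
  then show ?thesis by (rule that)
qed

context definite_quaternions
begin

text \<open>The reduced norm does not depend on the presentation. \<open>c\<close> and
  \<open>e\<close> are minus the norms of \<open>u\<close> and \<open>w\<close>, hence negative as
  well, and the conjugate is determined by the trace, for which the coordinate formula in new
  generators is known.\<close>

lemma other_generators:
  assumes gen: "quaternion_generators scale c e u w"
  shows "definite_quaternions scale c e u w"
    "\<And>t x y z. nrd (quat u w t x y z) = t * t - c * x * x - e * y * y + c * e * z * z"
proof -
  have rel: "u * u = scale c 1" "w * w = scale e 1" "w * u = - (u * w)" and nz: "c \<noteq> 0" "e \<noteq> 0"
    using gen by (simp_all add: quaternion_generators_def)
  have rel': "u * w = - (w * u)" using rel(3) by simp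
  have "trd u = 0" "trd w = 0"
    using trd_generator[OF rel(2) nz(2) rel(3)] trd_generator[OF rel(1) nz(1) rel'] .
  then have "scale c 1 = scale (- nrd u) (1::'d)" "scale e 1 = scale (- nrd w) (1::'d)"
    using square_eq[of u] square_eq[of w] rel by simp_all
  then have "c = - nrd u" "e = - nrd w" by (simp_all only: scale_one_eq_iff)
  then have neg: "c < 0" "e < 0" using nz nrd_nonneg[of u] nrd_nonneg[of w] by auto
  show "definite_quaternions scale c e u w" by (rule change_generators[OF rel neg])
  fix t x y z
  have "conjq (quat u w t x y z) = quat u w t (- x) (- y) (- z)"
    unfolding conjq_eq trd_quat'[OF rel neg] by (simp add: quat_def scale_left_distrib[symmetric] algebra_simps)
  then have "scale (nrd (quat u w t x y z)) 1 = quat u w t x y z * quat u w t (- x) (- y) (- z)"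
    using mult_conjq[of "quat u w t x y z"] by simp
  also have "\<dots> = scale (t * t - c * x * x - e * y * y + c * e * z * z) 1"
    unfolding quat_mult[OF rel] by (simp add: quat_def algebra_simps)
  finally show "nrd (quat u w t x y z) = t * t - c * x * x - e * y * y + c * e * z * z"
    by (simp only: scale_one_eq_iff)
qed

lemma trd_quat_times:
  "trd (quat u w t x y z * d) = t * trd d + x * trd (u * d) + y * trd (w * d) + z * trd (u * w * d)"
  by (simp add: quat_def distrib_right trd_add scale_mult_left trd_scale)

end

locale definite_quaternions_at_prime = definite_quaternions scale a b i j + padic p
  for scale :: "rat \<Rightarrow> 'd::ring_1 \<Rightarrow> 'd" and a b i j p
begin

text \<open>One presentation suffices for ramification by definition, and the given one is
  taken.\<close>

lemma ramified:
  assumes "\<And>t x y z. t \<in> C \<Longrightarrow> x \<in> C \<Longrightarrow> y \<in> C \<Longrightarrow> z \<in> C \<Longrightarrow>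
    (\<lambda>n. t n * t n - a * x n * x n - b * y n * y n + a * b * z n * z n) \<in> N \<Longrightarrow> t \<in> N \<and> x \<in> N \<and> y \<in> N \<and> z \<in> N"
  shows "ramified_at_prime scale p"
  unfolding ramified_at_prime_def division_over_def
  using anisotropic_division[of a b] assms generators by blast

lemma linear_combination_N:
  assumes "t \<in> N" "x \<in> N" "y \<in> N" "z \<in> N"
  shows "(\<lambda>n. t n * k + x n * l + y n * m + z n * r) \<in> N"
proof -
  have "(\<lambda>n. w n * c) \<in> N" if "w \<in> N" for w and c :: rat
    using mult_N[of "\<lambda>n. c" w] that by (simp add: mult.commute)
  then show ?thesis using assms by (intro add_N)
qed

text \<open>Isotropy over \<open>\<rat>\<^sub>p\<close> is transported to every presentation of the algebra by expressing the
  terms of a sequence of quaternions, and its reduced norms, in the new generators.\<close>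

lemma not_ramified:
  assumes C: "t \<in> C" "x \<in> C" "y \<in> C" "z \<in> C"
    and null: "(\<lambda>n. t n * t n - a * x n * x n - b * y n * y n + a * b * z n * z n) \<in> N"
    and nz: "\<not> (t \<in> N \<and> x \<in> N \<and> y \<in> N \<and> z \<in> N)"
  shows "\<not> ramified_at_prime scale p"
proof
  assume "ramified_at_prime scale p"
  then obtain c e u w where gen: "quaternion_generators scale c e u w"
    and div: "division_algebra (quat_alg (padic_field p) (padic_of_rat p c) (padic_of_rat p e))"
    unfolding ramified_at_prime_def division_over_def by blast
  note new = other_generators[OF gen]
  interpret new: definite_quaternions scale c e u w by (rule new(1))
  define d where "d n = quat i j (t n) (x n) (y n) (z n)" for n
  \<comment> \<open>Coordinates in the new generators, from \<open>orthogonal_expansion\<close>.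
    They are linear in the old ones with rational coefficients independent of \<open>n\<close>, so
    they are Cauchy.\<close>
  define t' x' y' z' where "t' n = trd (d n) / 2" and "x' n = trd (d n * u) / (2 * c)"
    and "y' n = trd (d n * w) / (2 * e)" and "z' n = - trd (d n * (u * w)) / (2 * (c * e))" for n
  have d': "d n = quat u w (t' n) (x' n) (y' n) (z' n)" for n
    unfolding t'_def x'_def y'_def z'_def by (rule orthogonal_expansion[OF new.relations new.neg])
  have tr: "(\<lambda>n. trd (d n * q)) \<in> C" for q
    unfolding d_def trd_quat_times using C by simp
  have C': "t' \<in> C" "x' \<in> C" "y' \<in> C" "z' \<in> C"
    using tr[of 1] mult_C[OF const_C[of "1 / (2 * c)"] tr[of u]] mult_C[OF const_C[of "1 / (2 * e)"] tr[of w]]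
      mult_C[OF const_C[of "- 1 / (2 * (c * e))"] tr[of "u * w"]] mult_C[OF const_C[of "1 / 2"] tr[of 1]]
    unfolding t'_def[abs_def] x'_def[abs_def] y'_def[abs_def] z'_def[abs_def] by simp_all
  have "nrd (d n) = t n * t n - a * x n * x n - b * y n * y n + a * b * z n * z n" for n
    by (simp only: d_def nrd_quat)
  moreover have "nrd (d n) = t' n * t' n - c * x' n * x' n - e * y' n * y' n + c * e * z' n * z' n" for n
    by (simp only: d' new(2))
  ultimately have null': "(\<lambda>n. t' n * t' n - c * x' n * x' n - e * y' n * y' n + c * e * z' n * z' n) \<in> N"
    using null by simp
  \<comment> \<open>The change back to the old generators is linear too, so null new coordinates
    would make the old ones null.\<close>
  have "\<not> (t' \<in> N \<and> x' \<in> N \<and> y' \<in> N \<and> z' \<in> N)"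
  proof
    assume "t' \<in> N \<and> x' \<in> N \<and> y' \<in> N \<and> z' \<in> N"
    then have trN: "(\<lambda>n. trd (d n * q)) \<in> N" for q
      unfolding d' trd_quat_times using linear_combination_N by blast
    have "t n = 1 / 2 * trd (d n * 1)" "x n = 1 / (2 * a) * trd (d n * i)"
      "y n = 1 / (2 * b) * trd (d n * j)" "z n = - 1 / (2 * (a * b)) * trd (d n * (i * j))" for n
      using trd_quat_mult'[OF relations neg, of "t n" "x n" "y n" "z n"]
        trd_quat'[OF relations neg, of "t n" "x n" "y n" "z n"] neg by (simp_all add: d_def)
    then have "t = (\<lambda>n. 1 / 2 * trd (d n * 1))" "x = (\<lambda>n. 1 / (2 * a) * trd (d n * i))"
      "y = (\<lambda>n. 1 / (2 * b) * trd (d n * j))" "z = (\<lambda>n. - 1 / (2 * (a * b)) * trd (d n * (i * j)))" by blast+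
    then have "t \<in> N \<and> x \<in> N \<and> y \<in> N \<and> z \<in> N"
      using mult_N[OF const_C trN] by metis
    then show False using nz by blast
  qed
  then show False using isotropic_not_division[OF C' null'] div by blast
qed

end

context padic
begin

text \<open>Infinite descent on divisibility of an integral form by powers of \<open>p\<close>.\<close>

lemma anisotropic_form:
  fixes A B :: int
  assumes base: "\<And>T0 X0 Y0 Z0. int p ^ 3 dvd T0 * T0 + A * X0 * X0 + B * Y0 * Y0 + A * B * Z0 * Z0 \<Longrightarrow>
      int p dvd T0 \<and> int p dvd X0 \<and> int p dvd Y0 \<and> int p dvd Z0"
    and null: "(\<lambda>n. t n * t n - of_int (- A) * x n * x n - of_int (- B) * y n * y n
        + of_int (- A) * of_int (- B) * z n * z n) \<in> N"
  shows "t \<in> N \<and> x \<in> N \<and> y \<in> N \<and> z \<in> N"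
proof -
  \<comment> \<open>Each step divides the variables by \<open>p\<close> and the form by
    \<open>p ^ 2\<close>. The base needs the modulus \<open>p ^ 3\<close> because of the sum of four
    squares at 2, where four odd squares have a sum divisible by 4.\<close>
  have descent: "int p ^ Suc k dvd T0 \<and> int p ^ Suc k dvd X0 \<and> int p ^ Suc k dvd Y0 \<and> int p ^ Suc k dvd Z0"
    if "int p ^ (2 * k + 3) dvd T0 * T0 + A * X0 * X0 + B * Y0 * Y0 + A * B * Z0 * Z0" for k T0 X0 Y0 Z0
    using that
  proof (induction k arbitrary: T0 X0 Y0 Z0)
    case 0
    then show ?case using base[of T0 X0 Y0 Z0] by simp
  next
    case (Suc k)
    have "int p ^ 3 dvd int p ^ (2 * Suc k + 3)" by (rule le_imp_power_dvd) simp
    then have "int p ^ 3 dvd T0 * T0 + A * X0 * X0 + B * Y0 * Y0 + A * B * Z0 * Z0" using Suc.prems dvd_trans by blast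
    then obtain T0' X0' Y0' Z0' where eq: "T0 = int p * T0'" "X0 = int p * X0'" "Y0 = int p * Y0'" "Z0 = int p * Z0'"
      using base by (meson dvdE)
    have "T0 * T0 + A * X0 * X0 + B * Y0 * Y0 + A * B * Z0 * Z0
        = int p ^ 2 * (T0' * T0' + A * X0' * X0' + B * Y0' * Y0' + A * B * Z0' * Z0')"
      by (simp add: eq power2_eq_square algebra_simps)
    moreover have "int p ^ (2 * Suc k + 3) = int p ^ 2 * int p ^ (2 * k + 3)"
      by (simp only: power_add[symmetric]) simp
    ultimately have "int p ^ (2 * k + 3) dvd T0' * T0' + A * X0' * X0' + B * Y0' * Y0' + A * B * Z0' * Z0'"
      using Suc.prems p_gt_1 by simp
    then show ?case using Suc.IH[of T0' X0' Y0' Z0'] by (simp add: eq)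
  qed
  define S where "S t x y z = t * t - of_int (- A) * x * x - of_int (- B) * y * y + of_int (- A) * of_int (- B) * z * z"
    for t x y z :: rat
  \<comment> \<open>If \<open>e0\<close> is the exponent of \<open>p\<close> in \<open>U\<close>,
    the descent limits the exponent in the value of the form to \<open>2 * e0 + 2\<close>; this
    explains the factor \<open>p ^ 2\<close>.\<close>
  have bound_int: "v (of_int U) * v (of_int U) \<le> of_nat p ^ 2 * v (of_int (T0 * T0 + A * X0 * X0 + B * Y0 * Y0 + A * B * Z0 * Z0))"
    if U: "U \<in> {T0, X0, Y0, Z0}" for U T0 X0 Y0 Z0
  proof (cases "U = 0")
    case False
    define e0 where "e0 = multiplicity (int p) U"
    define s where "s = multiplicity (int p) (T0 * T0 + A * X0 * X0 + B * Y0 * Y0 + A * B * Z0 * Z0)"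
    have not_dvd: "\<not> int p ^ Suc e0 dvd U"
      unfolding e0_def using False prime_elem by (subst power_dvd_iff_le_multiplicity) auto
    then have nd: "\<not> int p ^ (2 * e0 + 3) dvd T0 * T0 + A * X0 * X0 + B * Y0 * Y0 + A * B * Z0 * Z0"
      using descent[of e0 T0 X0 Y0 Z0] U by blast
    then have Snz: "T0 * T0 + A * X0 * X0 + B * Y0 * Y0 + A * B * Z0 * Z0 \<noteq> 0" by (metis dvd_0_right)
    then have "s < 2 * e0 + 3"
      using nd prime_elem unfolding s_def by (subst (asm) power_dvd_iff_le_multiplicity) auto
    then have "(of_nat p :: rat) ^ s \<le> of_nat p ^ (2 + (e0 + e0))" using p_gt_1 by (intro power_increasing) auto
    then show ?thesis unfolding v_int[OF False] v_int[OF Snz] e0_def[symmetric] s_def[symmetric] using p_gt_1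
      by (simp add: field_simps power_add power2_eq_square)
  qed (simp add: v_nonneg)
  \<comment> \<open>The form is homogeneous of degree 2, so a common denominator carries the
    estimate over to rational arguments.\<close>
  have bound: "v c * v c \<le> of_nat p ^ 2 * v (S t x y z)" if c: "c \<in> {t, x, y, z}" for c t x y z
  proof -
    obtain T0 X0 Y0 Z0 D1 D2 D3 D4 where D: "D1 > 0" "D2 > 0" "D3 > 0" "D4 > (0::int)" and
      frac: "t = of_int T0 / of_int D1" "x = of_int X0 / of_int D2" "y = of_int Y0 / of_int D3" "z = of_int Z0 / of_int D4"
      using rat_fraction_cases[of t] rat_fraction_cases[of x] rat_fraction_cases[of y] rat_fraction_cases[of z] by metis
    define D :: rat where "D = of_int (D1 * D2 * D3 * D4)"
    have Dnz: "D \<noteq> 0" using D by (simp add: D_def)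
    obtain U T0' X0' Y0' Z0' where ints: "t * D = of_int T0'" "x * D = of_int X0'" "y * D = of_int Y0'" "z * D = of_int Z0'"
      and U: "c * D = of_int U" "U \<in> {T0', X0', Y0', Z0'}"
    proof -
      have "t * D = of_int (T0 * D2 * D3 * D4)" "x * D = of_int (X0 * D1 * D3 * D4)"
        "y * D = of_int (Y0 * D1 * D2 * D4)" "z * D = of_int (Z0 * D1 * D2 * D3)"
        using D by (simp_all add: frac D_def)
      then show ?thesis using that c by blast
    qed
    have "S t x y z * (D * D) = of_int (T0' * T0' + A * X0' * X0' + B * Y0' * Y0' + A * B * Z0' * Z0')"
      unfolding of_int_add of_int_mult ints[symmetric] by (simp add: S_def algebra_simps)
    then have "v (c * D) * v (c * D) \<le> of_nat p ^ 2 * v (S t x y z * (D * D))"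
      unfolding U(1) using bound_int[OF U(2)] by simp
    then have "(v c * v c) * (v D * v D) \<le> (of_nat p ^ 2 * v (S t x y z)) * (v D * v D)"
      by (simp add: v_mult mult_ac)
    then show ?thesis using v_pos[OF Dnz] by simp
  qed
  have "c \<in> N" if c: "\<And>n. c n \<in> {t n, x n, y n, z n}" for c
    unfolding padic_null_def
  proof (clarify)
    fix e :: rat assume e: "e > 0"
    then have "e * e / of_nat p ^ 2 > 0" using p_gt_1 by simp
    then obtain M where M: "\<forall>n\<ge>M. v (S (t n) (x n) (y n) (z n)) < e * e / of_nat p ^ 2"
      using N_D[OF null] unfolding S_def by blast
    have "v (c n) < e" if "n \<ge> M" for n
    proof -
      have "v (c n) * v (c n) < e * e"
        using bound[OF c[of n]] M that p_gt_1 by (simp add: field_simps) (meson le_less_trans)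
      then show ?thesis using e v_nonneg[of "c n"] by (meson mult_mono not_le less_imp_le)
    qed
    then show "\<exists>M. \<forall>n\<ge>M. v (c n) < e" by blast
  qed
  then show ?thesis by blast
qed

text \<open>Newton iteration at a simple root. Coprimality of the derivative
  \<open>2 * x + \<beta>\<close> to \<open>p\<close> is part of the invariant \<open>?P\<close>, and
  its clause for \<open>n = 0\<close> fixes the start at \<open>r\<close>.\<close>

lemma hensel_quadratic:
  fixes r \<beta> \<gamma> :: int
  assumes "int p dvd r * r + \<beta> * r + \<gamma>" "coprime (2 * r + \<beta>) (int p)"
  obtains u :: "nat \<Rightarrow> int" where "u 0 = r" "\<And>n. int p ^ Suc n dvd u n * u n + \<beta> * u n + \<gamma>"
    "\<And>n. int p ^ Suc n dvd u (Suc n) - u n"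
proof -
  let ?P = "\<lambda>n x. int p ^ Suc n dvd x * x + \<beta> * x + \<gamma> \<and> coprime (2 * x + \<beta>) (int p) \<and> (n = 0 \<longrightarrow> x = r)"
  have "\<exists>u. \<forall>n. ?P n (u n) \<and> int p ^ Suc n dvd u (Suc n) - u n"
  proof (rule dependent_nat_choice)
    show "\<exists>x. ?P 0 x" using assms by (intro exI[of _ r]) simp
  next
    fix x n assume x: "?P n x"
    then obtain k where k: "x * x + \<beta> * x + \<gamma> = int p ^ Suc n * k" by (auto elim: dvdE)
    obtain y w where "y * (2 * x + \<beta>) + w * int p = 1"
      using bezout_int[of "2 * x + \<beta>" "int p"] x by auto
    then have "(2 * x + \<beta>) * y - 1 = int p * - w" by (simp add: algebra_simps)
    then have y: "int p dvd (2 * x + \<beta>) * y - 1" by simp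
    define q where "q = int p ^ Suc n"
    \<comment> \<open>The Newton correction: the value \<open>q * k\<close> of the polynomial times
      an inverse \<open>y\<close> of the derivative modulo \<open>p\<close>. The linear terms then
      cancel modulo \<open>q * p\<close>.\<close>
    define x' where "x' = x + q * (- k * y)"
    have "k + (2 * x + \<beta>) * (- k * y) = - k * ((2 * x + \<beta>) * y - 1)" by (simp add: algebra_simps)
    then have "int p dvd k + (2 * x + \<beta>) * (- k * y)" using y by simp
    moreover have "int p dvd q" by (simp add: q_def)
    ultimately have "int p dvd k + (2 * x + \<beta>) * (- k * y) + q * ((- k * y) * (- k * y))" by (simp add: dvd_add)
    moreover have "x' * x' + \<beta> * x' + \<gamma> = (x * x + \<beta> * x + \<gamma>) + q * ((2 * x + \<beta>) * (- k * y) + q * ((- k * y) * (- k * y)))"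
      by (simp add: x'_def algebra_simps)
    then have "x' * x' + \<beta> * x' + \<gamma> = q * (k + (2 * x + \<beta>) * (- k * y) + q * ((- k * y) * (- k * y)))"
      unfolding k q_def[symmetric] by (simp only: distrib_left add.assoc)
    ultimately have "q * int p dvd x' * x' + \<beta> * x' + \<gamma>" by simp
    then have 1: "int p ^ Suc (Suc n) dvd x' * x' + \<beta> * x' + \<gamma>" by (simp add: q_def mult.commute)
    have "2 * x' + \<beta> = 2 * x + \<beta> + int p * (int p ^ n * (2 * (- k * y)))" by (simp add: x'_def q_def algebra_simps)
    then have 2: "coprime (2 * x' + \<beta>) (int p)" using x
      by (metis coprime_iff_gcd_eq_1 gcd.commute gcd_add_mult mult.commute add.commute)
    have "q dvd x' - x" by (simp add: x'_def)
    then show "\<exists>x'. ?P (Suc n) x' \<and> int p ^ Suc n dvd x' - x" using 1 2 unfolding q_def by blast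
  qed
  then show ?thesis using that by metis
qed

lemma null_sequence:
  assumes "\<And>n. int p ^ Suc n dvd u n" shows "(\<lambda>n. of_int (u n)) \<in> N"
  unfolding padic_null_def
proof (clarify)
  fix e :: rat assume e: "e > 0"
  obtain M where M: "1 / e < of_nat M" using reals_Archimedean2 by blast
  have "v (of_int (u n)) < e" if "n \<ge> M" for n
  proof -
    have "of_nat n < (of_nat p ^ Suc n :: rat)"
      using p_gt_1 power_gt_expt[of p "Suc n"] by (simp flip: of_nat_power of_nat_mult add: less_imp_of_nat_less)
    then have "1 / e < of_nat p ^ Suc n" using M that by (meson less_trans of_nat_mono le_less_trans less_le_trans)
    then have "1 / of_nat p ^ Suc n < e" using e p_gt_1 by (simp add: field_simps)
    then show ?thesis using v_int_le[OF assms[of n]] by linarith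
  qed
  then show "\<exists>M. \<forall>n\<ge>M. v (of_int (u n)) < e" by blast
qed

lemma cauchy_sequence:
  assumes "\<And>n. int p ^ Suc n dvd u (Suc n) - u n" shows "(\<lambda>n. of_int (u n)) \<in> C"
  unfolding padic_cauchy_def
proof (clarify)
  fix e :: rat assume e: "e > 0"
  have dvd: "int p ^ Suc m dvd u (m + k) - u m" for m k
  proof (induction k)
    case (Suc k)
    have "int p ^ Suc m dvd int p ^ Suc (m + k)" by (rule le_imp_power_dvd) simp
    then have "int p ^ Suc m dvd (u (Suc (m + k)) - u (m + k)) + (u (m + k) - u m)"
      using Suc assms[of "m + k"] dvd_trans dvd_add by blast
    then show ?case by simp
  qed simp
  have "(\<lambda>n. of_int (int p ^ Suc n)) \<in> N" by (rule null_sequence) simp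
  then obtain M where M: "v (of_int (int p ^ Suc M)) < e" using N_D[OF _ e] by blast
  have "v (of_int (u m) - of_int (u n)) < e" if "m \<ge> M" "n \<ge> M" for m n
  proof -
    have "int p ^ Suc M dvd (u m - u M) - (u n - u M)"
      using dvd[of M "m - M"] dvd[of M "n - M"] that dvd_diff[of "int p ^ Suc M" "u m - u M" "u n - u M"] by simp
    then obtain c where "u m - u n = int p ^ Suc M * c" by (auto elim: dvdE)
    then have "v (of_int (u m) - of_int (u n)) = v (of_int (int p ^ Suc M)) * v (of_int c)"
      by (metis of_int_diff of_int_mult v_mult)
    also have "\<dots> \<le> v (of_int (int p ^ Suc M))" using v_int_le_1[of c] v_nonneg by (simp add: mult_left_le)
    finally show ?thesis using M by simp
  qed
  then show "\<exists>M. \<forall>m\<ge>M. \<forall>n\<ge>M. v (of_int (u m) - of_int (u n)) < e" by blast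
qed

end

section \<open>Squares modulo primes and modulo 8\<close>

lemma inj_on_squares_mod:
  fixes q h :: int
  assumes "Factorial_Ring.prime q" "q = 2 * h + 1"
  shows "inj_on (\<lambda>t. t * t mod q) {0..h}"
proof (rule inj_onI)
  fix t s assume ts: "t \<in> {0..h}" "s \<in> {0..h}" "t * t mod q = s * s mod q"
  then have "q dvd t * t - s * s" by (simp add: mod_eq_dvd_iff)
  then have "q dvd (t - s) * (t + s)" by (simp add: algebra_simps)
  then have "q dvd t - s \<or> q dvd t + s" using assms(1) prime_dvd_mult_iff by blast
  then show "t = s"
  proof
    assume "q dvd t - s"
    then show ?thesis using ts(1,2) assms(2) dvd_imp_le_int[of "t - s" q] by fastforce
  next
    assume "q dvd t + s"
    then have "t + s = 0" using ts(1,2) assms(2) zdvd_not_zless[of "t + s" q] by fastforce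
    then show ?thesis using ts(1,2) by simp
  qed
qed

text \<open>Pigeonhole: the squares and the values \<open>- c - x * x\<close> each fill
  \<open>h + 1\<close> of the \<open>2 * h + 1\<close> residue classes, so they meet. As
  \<open>q\<close> does not divide \<open>c\<close>, it does not divide both \<open>t\<close> and
  \<open>x\<close>, and by symmetry the good one may be called \<open>t\<close>; lifting it requires
  a simple root.\<close>

lemma sum_two_squares_mod_prime:
  fixes q c :: int
  assumes q: "Factorial_Ring.prime q" "odd q" and c: "\<not> q dvd c"
  obtains t x where "q dvd t * t + (x * x + c)" "\<not> q dvd t"
proof -
  obtain h where h: "q = 2 * h + 1" using q(2) by (elim oddE)
  have pos: "q > 0" using q(1) prime_gt_0_int by blast
  have h0: "h \<ge> 0" using pos h by simp
  let ?A = "(\<lambda>t. t * t mod q) ` {0..h}" and ?B = "(\<lambda>x. (- c - x * x) mod q) ` {0..h}"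
  note inj = inj_on_squares_mod[OF q(1) h]
  have "inj_on (\<lambda>x. (- c - x * x) mod q) {0..h}"
  proof (rule inj_onI)
    fix x y assume xy: "x \<in> {0..h}" "y \<in> {0..h}" "(- c - x * x) mod q = (- c - y * y) mod q"
    then have "q dvd (- c - x * x) - (- c - y * y)" by (simp only: mod_eq_dvd_iff)
    then have "q dvd y * y - x * x" by simp
    then have "y * y mod q = x * x mod q" by (simp only: mod_eq_dvd_iff)
    then show "x = y" using inj_onD[OF inj, of y x] xy by simp
  qed
  then have card: "card ?A = nat (h + 1)" "card ?B = nat (h + 1)" using inj by (simp_all add: card_image)
  have "?A \<inter> ?B \<noteq> {}"
  proof
    assume "?A \<inter> ?B = {}"
    then have "card (?A \<union> ?B) = nat (h + 1) + nat (h + 1)" using card by (simp add: card_Un_disjoint)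
    moreover have "?A \<union> ?B \<subseteq> {0..<q}" using pos by auto
    then have "card (?A \<union> ?B) \<le> nat q" using card_mono[of "{0..<q}" "?A \<union> ?B"] by simp
    ultimately show False using h h0 by simp
  qed
  then obtain t x where tx: "t * t mod q = (- c - x * x) mod q" by auto
  then have "q dvd t * t - (- c - x * x)" by (simp only: mod_eq_dvd_iff)
  then have dvd: "q dvd t * t + (x * x + c)" by (simp add: algebra_simps)
  show ?thesis
  proof (cases "q dvd t")
    case True
    then have "q dvd t * t" by simp
    then have "q dvd x * x + c" using dvd by (simp add: dvd_add_right_iff)
    then have "\<not> q dvd x" using c by (metis dvd_add_right_iff dvd_mult)
    then show ?thesis using that[of x t] dvd by (simp add: algebra_simps)
  qed (use that dvd in blast)
qed

lemma square_mod_8: "(odd t \<and> t * t mod 8 = 1) \<or> (even t \<and> t * t mod 8 \<in> {0, 4})" for t :: int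
proof (cases "even t")
  case True
  then obtain k where "t = 2 * k" by (elim evenE)
  moreover have "(4 * m) mod 8 = 0 \<or> (4 * m) mod 8 = 4" for m :: int by presburger
  from this[of "k * k"] have "(4 * (k * k)) mod 8 \<in> {0, 4}" by blast
  ultimately show ?thesis by simp
next
  case False
  then obtain k where k: "t = 2 * k + 1" by (elim oddE)
  have "even (k * (k + 1))" by simp
  then obtain l where "k * (k + 1) = 2 * l" by (elim evenE)
  then have "t * t = 8 * l + 1" using k by (simp add: algebra_simps)
  then show ?thesis using False by simp
qed

text \<open>Odd squares are 1 and even squares 0 or 4 modulo 8. A sum divisible by 4 contains none
  or four odd squares, and four of them give 4 modulo 8.\<close>

lemma four_squares_mod_8:
  fixes t x y z :: int
  assumes "8 dvd t * t + x * x + y * y + z * z"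
  shows "even t \<and> even x \<and> even y \<and> even z"
proof -
  have "\<exists>k r. u * u = 8 * k + r \<and> r \<in> {0, 1, 4} \<and> (r \<noteq> 1 \<longrightarrow> even u)" for u :: int
    using square_mod_8[of u] by (intro exI[of _ "u * u div 8"] exI[of _ "u * u mod 8"]) auto
  note ex = this
  obtain k1 r1 where 1: "t * t = 8 * k1 + r1" "r1 \<in> {0, 1, 4}" "r1 \<noteq> 1 \<Longrightarrow> even t" using ex by meson
  obtain k2 r2 where 2: "x * x = 8 * k2 + r2" "r2 \<in> {0, 1, 4}" "r2 \<noteq> 1 \<Longrightarrow> even x" using ex by meson
  obtain k3 r3 where 3: "y * y = 8 * k3 + r3" "r3 \<in> {0, 1, 4}" "r3 \<noteq> 1 \<Longrightarrow> even y" using ex by meson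
  obtain k4 r4 where 4: "z * z = 8 * k4 + r4" "r4 \<in> {0, 1, 4}" "r4 \<noteq> 1 \<Longrightarrow> even z" using ex by meson
  have eq: "r1 + r2 + r3 + r4 = (t * t + x * x + y * y + z * z) - 8 * (k1 + k2 + k3 + k4)"
    unfolding 1(1) 2(1) 3(1) 4(1) by simp
  have "8 dvd r1 + r2 + r3 + r4"
    unfolding eq by (rule dvd_diff[OF assms dvd_triv_left])
  then have "r1 \<noteq> 1 \<and> r2 \<noteq> 1 \<and> r3 \<noteq> 1 \<and> r4 \<noteq> 1"
    using 1(2) 2(2) 3(2) 4(2) by auto
  then show ?thesis using 1(3) 2(3) 3(3) 4(3) by blast
qed

lemma two_squares_mod_3:
  fixes t x :: int
  assumes "3 dvd t * t + x * x"
  shows "3 dvd t \<and> 3 dvd x"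
proof -
  have sq: "(3 dvd t \<and> t * t mod 3 = 0) \<or> (\<not> 3 dvd t \<and> t * t mod 3 = 1)" for t :: int
  proof -
    have "t mod 3 = 0 \<or> t mod 3 = 1 \<or> t mod 3 = 2" by presburger
    moreover have "t * t mod 3 = (t mod 3) * (t mod 3) mod 3" by (simp add: mod_simps)
    ultimately show ?thesis by auto
  qed
  have "(t * t mod 3 + x * x mod 3) mod 3 = 0" using assms by (simp add: mod_simps)
  then show ?thesis using sq[of t] sq[of x] by auto
qed

section \<open>Ramified primes of the two algebras\<close>

context definite_quaternions_at_prime
begin

lemma ramified_2:
  assumes "a = - 1" "b = - 1" "p = 2"
  shows "ramified_at_prime scale p"
proof (rule ramified)
  fix t x y z assume "(\<lambda>n. t n * t n - a * x n * x n - b * y n * y n + a * b * z n * z n) \<in> N"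
  then show "t \<in> N \<and> x \<in> N \<and> y \<in> N \<and> z \<in> N"
    using four_squares_mod_8 assms by (intro anisotropic_form[of 1 1]) auto
qed

text \<open>Modulo 3 the form is \<open>t * t + x * x\<close>, which is anisotropic because -1 is
  not a square. Once 3 divides \<open>t\<close> and \<open>x\<close>, dividing by 3 leaves the same
  form in \<open>y\<close> and \<open>z\<close>.\<close>

lemma ramified_3:
  assumes "a = - 1" "b = - 3" "p = 3"
  shows "ramified_at_prime scale p"
proof (rule ramified)
  have base: "3 dvd t \<and> 3 dvd x \<and> 3 dvd y \<and> 3 dvd z" if dvd: "27 dvd t * t + x * x + 3 * y * y + 3 * z * z" for t x y z :: int
  proof -
    have "3 dvd t * t + x * x + 3 * y * y + 3 * z * z" using dvd by (rule dvd_trans[rotated]) simp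
    moreover have "3 dvd m + n + 3 * k + 3 * l \<Longrightarrow> 3 dvd m + n" for m n k l :: int by presburger
    ultimately have "3 dvd t * t + x * x" by (simp only: mult.assoc)
    then have tx: "3 dvd t" "3 dvd x" using two_squares_mod_3 by blast+
    then obtain k l where "t = 3 * k" "x = 3 * l" by (elim dvdE)
    then have "27 dvd 3 * (3 * (k * k + l * l) + (y * y + z * z))" using dvd by (simp add: algebra_simps)
    moreover have "27 dvd 3 * (3 * m + n) \<Longrightarrow> 3 dvd n" for m n :: int
    proof (elim dvdE)
      fix c assume "3 * (3 * m + n) = 27 * c"
      then have "n = 3 * (3 * c - m)" by simp
      then show "3 dvd n" by simp
    qed
    ultimately have "3 dvd y * y + z * z" by blast
    then show ?thesis using tx two_squares_mod_3 by blast
  qed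
  fix t x y z assume "(\<lambda>n. t n * t n - a * x n * x n - b * y n * y n + a * b * z n * z n) \<in> N"
  then show "t \<in> N \<and> x \<in> N \<and> y \<in> N \<and> z \<in> N"
    using base assms by (intro anisotropic_form[of 1 3]) auto
qed

text \<open>Produces an isotropic quaternion whose last three coordinates are constant; only the
  first is a limit, given by a Hensel sequence of integers. The shift \<open>s\<close> admits a
  half-integral first coordinate, which is how the prime 2 is treated.\<close>

lemma not_ramified_quadratic:
  assumes root: "int p dvd r * r + \<beta> * r + \<gamma>" "coprime (2 * r + \<beta>) (int p)"
    and form: "\<And>u :: rat. (u + s) * (u + s) - a * x * x - b * y * y + a * b * z * z = u * u + of_int \<beta> * u + of_int \<gamma>"
    and nz: "y \<noteq> 0"
  shows "\<not> ramified_at_prime scale p"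
proof -
  obtain u :: "nat \<Rightarrow> int" where u: "\<And>n. int p ^ Suc n dvd u n * u n + \<beta> * u n + \<gamma>"
    "\<And>n. int p ^ Suc n dvd u (Suc n) - u n" using hensel_quadratic[OF root] by metis
  have "(\<lambda>n. of_int (u n * u n + \<beta> * u n + \<gamma>)) \<in> N" by (rule null_sequence[OF u(1)])
  then have "(\<lambda>n. (of_int (u n) + s) * (of_int (u n) + s) - a * x * x - b * y * y + a * b * z * z) \<in> N"
    unfolding form by simp
  moreover have "(\<lambda>n. of_int (u n) + s) \<in> C" using cauchy_sequence[OF u(2)] by simp
  ultimately show ?thesis
    using not_ramified[of "\<lambda>n. of_int (u n) + s" "\<lambda>n. x" "\<lambda>n. y" "\<lambda>n. z"] nz const_N_iff[of y] by simp
qed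

lemma odd_prime_coprime:
  assumes "p \<noteq> 2" "\<not> int p dvd t"
  shows "coprime (2 * t + 0) (int p)"
proof -
  have "\<not> int p dvd 2"
  proof
    assume "int p dvd 2"
    then have "int p \<le> 2" by (rule zdvd_imp_le) simp
    then show False using p_gt_1 assms(1) by linarith
  qed
  then have "\<not> int p dvd 2 * t" using assms(2) prime prime_dvd_mult_iff[of "int p"] by simp
  then show ?thesis using prime_imp_coprime[of "int p" "2 * t"] prime by (simp add: coprime_commute)
qed

lemma odd_prime: "p \<noteq> 2 \<Longrightarrow> odd (int p)"
  using prime prime_odd_nat p_gt_1 by fastforce

text \<open>The norm of \<open>t + x * i + j\<close> is \<open>t * t + x * x + 1\<close>. It
  vanishes modulo \<open>p\<close> for some \<open>t\<close> prime to \<open>p\<close>, and such a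
  \<open>t\<close> lifts.\<close>

lemma not_ramified_odd:
  assumes "a = - 1" "b = - 1" "p \<noteq> 2"
  shows "\<not> ramified_at_prime scale p"
proof -
  have "\<not> int p dvd 1" using p_gt_1 by simp
  then obtain t x where tx: "int p dvd t * t + (x * x + 1)" "\<not> int p dvd t"
    using sum_two_squares_mod_prime[of "int p" 1] odd_prime[OF assms(3)] prime by auto
  show ?thesis
    by (rule not_ramified_quadratic[of t 0 "x * x + 1" 0 "of_int x" 1 0])
      (use tx odd_prime_coprime[OF assms(3) tx(2)] assms(1,2) in simp_all)
qed

lemma not_ramified_away_from_3:
  assumes "a = - 1" "b = - 3" "p \<noteq> 3"
  shows "\<not> ramified_at_prime scale p"
proof (cases "p = 2")
  case True
  \<comment> \<open>With all coordinates half-integral the norm is (u + 1/2)^2 + 1/4 + 3/4 + 3/4 =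
    u^2 + u + 2, which has the simple root 0 modulo 2. An integral first coordinate would have an
    even derivative.\<close>
  show ?thesis
    by (rule not_ramified_quadratic[of 0 1 2 "1 / 2" "1 / 2" "1 / 2" "1 / 2"])
      (use True assms in \<open>simp_all add: algebra_simps\<close>)
next
  case False
  have "\<not> int p dvd 3"
  proof
    assume "int p dvd 3"
    then have "p dvd 3" by (metis of_nat_dvd_iff of_nat_numeral)
    moreover have "Factorial_Ring.prime (3::nat)" by simp
    ultimately show False using assms(3) prime primes_dvd_imp_eq by blast
  qed
  then obtain t x where tx: "int p dvd t * t + (x * x + 3)" "\<not> int p dvd t"
    using sum_two_squares_mod_prime[of "int p" 3] odd_prime[OF False] prime by auto
  show ?thesis
    by (rule not_ramified_quadratic[of t 0 "x * x + 3" 0 "of_int x" 1 0])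
      (use tx odd_prime_coprime[OF False tx(2)] assms(1,2) in simp_all)
qed

end

theorem quaternion_D_2_inf:
  assumes "totally_definite_quaternion_algebra scale" "definite_quaternions scale (- 1) (- 1) u v"
  shows "is_quaternion_D_p_inf scale 2"
proof -
  have "ramified_at_prime scale q \<longleftrightarrow> q = 2" if "Factorial_Ring.prime q" for q
  proof -
    interpret definite_quaternions_at_prime scale "- 1" "- 1" u v q
      using assms(2) that by (simp add: definite_quaternions_at_prime_def padic_def)
    show ?thesis using ramified_2 not_ramified_odd by blast
  qed
  then show ?thesis using assms(1)
    by (simp add: is_quaternion_D_p_inf_def totally_definite_quaternion_algebra_def)
qed

theorem quaternion_D_3_inf:
  assumes "totally_definite_quaternion_algebra scale" "definite_quaternions scale (- 1) (- 3) u v"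
  shows "is_quaternion_D_p_inf scale 3"
proof -
  have "ramified_at_prime scale q \<longleftrightarrow> q = 3" if "Factorial_Ring.prime q" for q
  proof -
    interpret definite_quaternions_at_prime scale "- 1" "- 3" u v q
      using assms(2) that by (simp add: definite_quaternions_at_prime_def padic_def)
    show ?thesis using ramified_3 not_ramified_away_from_3 by blast
  qed
  then show ?thesis using assms(1)
    by (simp add: is_quaternion_D_p_inf_def totally_definite_quaternion_algebra_def)
qed

section \<open>Systems of imprimitivity of row vectors\<close>

text \<open>Gaussian elimination over a division ring with scalars on the left: a row
  \<open>q\<close> with nonzero last coordinate serves as pivot, is moved to the end by the
  transposition \<open>\<sigma>\<close>, and clears that coordinate in the other rows.\<close>

lemma left_dependent:
  fixes v :: "nat \<Rightarrow> nat \<Rightarrow> 'd::ring_1"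
  assumes inverse: "\<And>x::'d. x \<noteq> 0 \<Longrightarrow> \<exists>y. y * x = 1"
  shows "\<exists>c. (\<exists>i\<le>n. c i \<noteq> 0) \<and> (\<forall>k<n. (\<Sum>i\<le>n. c i * v i k) = 0)"
proof (induction n arbitrary: v)
  case 0
  show ?case by (intro exI[of _ "\<lambda>_. 1"]) simp
next
  case (Suc n)
  show ?case
  proof (cases "\<forall>i\<le>Suc n. v i n = 0")
    case True
    obtain c where c: "\<exists>i\<le>n. c i \<noteq> 0" "\<forall>k<n. (\<Sum>i\<le>n. c i * v i k) = 0" using Suc.IH by blast
    let ?c = "\<lambda>i. if i \<le> n then c i else 0"
    have "(\<Sum>i\<le>Suc n. ?c i * v i k) = 0" if "k < Suc n" for k
    proof (cases "k = n")
      case False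
      then have "(\<Sum>i\<le>n. ?c i * v i k) = (\<Sum>i\<le>n. c i * v i k)" by (intro sum.cong) auto
      then show ?thesis using c(2) that False by simp
    qed (use True in \<open>simp add: sum.neutral\<close>)
    moreover have "\<exists>i\<le>Suc n. ?c i \<noteq> 0" using c(1) by (metis le_SucI)
    ultimately show ?thesis by (intro exI[of _ ?c]) blast
  next
    case False
    then obtain q where q: "q \<le> Suc n" "v q n \<noteq> 0" by blast
    then obtain w where w: "w * v q n = 1" using inverse by blast
    define \<sigma> where "\<sigma> = Transposition.transpose q (Suc n)"
    have \<sigma>: "\<sigma> (Suc n) = q" "\<sigma> (\<sigma> i) = i" "i \<le> Suc n \<Longrightarrow> \<sigma> i \<le> Suc n" for i
      using q(1) by (auto simp: \<sigma>_def Transposition.transpose_def)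
    have bij: "bij_betw \<sigma> {..Suc n} {..Suc n}"
      by (rule bij_betw_byWitness[of _ \<sigma>]) (auto simp: \<sigma>)
    obtain d where d: "\<exists>i\<le>n. d i \<noteq> 0"
      "\<forall>k<n. (\<Sum>i\<le>n. d i * (v (\<sigma> i) k - v (\<sigma> i) n * w * v q k)) = 0"
      using Suc.IH[of "\<lambda>i k. v (\<sigma> i) k - v (\<sigma> i) n * w * v q k"] by blast
    \<comment> \<open>The coefficient of the pivot row collects the multiples of it that the
      elimination subtracted.\<close>
    define c where "c i = (if i \<le> n then d i else - (\<Sum>i\<le>n. d i * (v (\<sigma> i) n * w)))" for i
    have "(\<Sum>i\<le>Suc n. c (\<sigma> i) * v i k) = 0" if k: "k < Suc n" for k
    proof -
      have "(\<Sum>i\<le>Suc n. c (\<sigma> i) * v i k) = (\<Sum>i\<le>Suc n. c i * v (\<sigma> i) k)"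
        using sum.reindex_bij_betw[OF bij, of "\<lambda>i. c (\<sigma> i) * v i k"] unfolding \<sigma>(2) by (rule sym)
      also have "\<dots> = (\<Sum>i\<le>n. d i * v (\<sigma> i) k) - (\<Sum>i\<le>n. d i * (v (\<sigma> i) n * w)) * v q k"
        by (simp add: c_def \<sigma>(1))
      also have "\<dots> = (\<Sum>i\<le>n. d i * (v (\<sigma> i) k - v (\<sigma> i) n * w * v q k))"
        by (simp add: sum_distrib_right right_diff_distrib sum_subtractf mult.assoc)
      also have "\<dots> = 0"
      proof (cases "k = n")
        case True
        then show ?thesis using w by (simp add: mult.assoc)
      qed (use d(2) k in simp)
      finally show ?thesis .
    qed
    moreover have "\<exists>i\<le>Suc n. c (\<sigma> i) \<noteq> 0"
    proof -
      obtain i where "i \<le> n" "d i \<noteq> 0" using d(1) by blast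
      then show ?thesis using \<sigma> by (intro exI[of _ "\<sigma> i"]) (simp add: c_def)
    qed
    ultimately show ?thesis by (intro exI[of _ "\<lambda>i. c (\<sigma> i)"]) blast
  qed
qed

text \<open>Row vectors of length 3 are functions on the natural numbers that vanish from 3 on.\<close>

definition row3 :: "(nat \<Rightarrow> 'd::ring_1) set" where
  "row3 = {r. \<forall>k\<ge>3. r k = 0}"

definition act :: "(nat \<Rightarrow> 'd::ring_1) \<Rightarrow> 'd mat \<Rightarrow> nat \<Rightarrow> 'd" where
  "act r x = (\<lambda>k. if k < 3 then \<Sum>l<3. r l * x $$ (l, k) else 0)"

definition row_of_mat :: "'d::ring_1 mat \<Rightarrow> nat \<Rightarrow> 'd" where
  "row_of_mat A = (\<lambda>k. if k < 3 then A $$ (0, k) else 0)"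

lemma row_eqI: "r \<in> row3 \<Longrightarrow> s \<in> row3 \<Longrightarrow> (\<And>k. k < 3 \<Longrightarrow> r k = s k) \<Longrightarrow> r = s"
  unfolding row3_def by (rule ext, case_tac "x < 3") auto

lemma act_row3 [simp]: "act r x \<in> row3"
  by (simp add: act_def row3_def)

lemma act_scale: "act (\<lambda>k. c * r k) x = (\<lambda>k. c * act r x k)"
  by (rule ext) (simp add: act_def sum_distrib_left mult.assoc)

lemma act_add: "act (\<lambda>k. r k + s k) x = (\<lambda>k. act r x k + act s x k)"
  by (rule ext) (simp add: act_def distrib_right sum.distrib)

lemma act_zero: "act (\<lambda>k. 0) x = (\<lambda>k. 0)"
  by (rule ext) (simp add: act_def)

lemma index_mult_mat_3:
  fixes A B :: "'d::ring_1 mat"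
  assumes "A \<in> carrier_mat m 3" "B \<in> carrier_mat 3 n" "i < m" "j < n"
  shows "(A * B) $$ (i, j) = (\<Sum>l<3. A $$ (i, l) * B $$ (l, j))"
  using assms unfolding lessThan_atLeast0 by (simp add: scalar_prod_def)

lemma act_mult:
  assumes "x \<in> carrier_mat 3 3" "y \<in> carrier_mat 3 3"
  shows "act r (x * y) = act (act r x) y"
proof (rule row_eqI)
  fix k :: nat assume k: "k < 3"
  have "act r (x * y) k = (\<Sum>l<3. \<Sum>m<3. r l * (x $$ (l, m) * y $$ (m, k)))"
    using k assms by (simp add: act_def index_mult_mat_3 sum_distrib_left del: index_mult_mat(1))
  also have "\<dots> = (\<Sum>m<3. \<Sum>l<3. r l * (x $$ (l, m) * y $$ (m, k)))" by (rule sum.swap)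
  also have "\<dots> = act (act r x) y k"
    using k by (simp add: act_def sum_distrib_right mult.assoc)
  finally show "act r (x * y) k = act (act r x) y k" .
qed auto

lemma act_one: assumes "r \<in> row3" shows "act r (1\<^sub>m 3) = r"
proof (rule row_eqI)
  fix k :: nat assume k: "k < 3"
  have "act r (1\<^sub>m 3) k = (\<Sum>l<3. if l = k then r l else 0)"
    unfolding act_def if_P[OF k] by (rule sum.cong) (use k in auto)
  then show "act r (1\<^sub>m 3) k = r k" using k by simp
qed (use assms in auto)

lemma row_of_mat_row3: "row_of_mat A \<in> row3"
  by (simp add: row_of_mat_def row3_def)

lemma row_of_mat_add:
  assumes "A \<in> carrier_mat 1 3" "B \<in> carrier_mat 1 3"
  shows "row_of_mat (A + B) = (\<lambda>k. row_of_mat A k + row_of_mat B k)"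
  using carrier_matD[OF assms(1)] carrier_matD[OF assms(2)] by (intro ext) (simp add: row_of_mat_def)

lemma row_of_mat_mult:
  assumes "A \<in> carrier_mat 1 3" "x \<in> carrier_mat 3 3"
  shows "row_of_mat (A * x) = act (row_of_mat A) x"
proof (rule row_eqI)
  fix k :: nat assume k: "k < 3"
  show "row_of_mat (A * x) k = act (row_of_mat A) x k"
    using index_mult_mat_3[OF assms _ k, of 0] k by (simp add: row_of_mat_def act_def del: index_mult_mat(1))
qed (simp_all add: row_of_mat_row3)

text \<open>Connects the two languages: the action of \<open>x\<close> on the rows of
  \<open>B\<close>, expressed in these rows, is the matrix of \<open>x\<close> in that
  basis.\<close>

lemma act_eq_scaled_row_iff:
  assumes "x \<in> carrier_mat 3 3" "B \<in> carrier_mat 3 3" "M \<in> carrier_mat 3 3"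
  shows "B * x = M * B \<longleftrightarrow> (\<forall>i<3. act (\<lambda>k. if k < 3 then B $$ (i, k) else 0) x
    = (\<lambda>k. if k < 3 then \<Sum>j<3. M $$ (i, j) * B $$ (j, k) else 0))"
proof -
  have "B * x = M * B \<longleftrightarrow> (\<forall>i<3. \<forall>k<3. (B * x) $$ (i, k) = (M * B) $$ (i, k))"
    using assms by (auto intro!: eq_matI simp del: index_mult_mat(1))
  also have "\<dots> \<longleftrightarrow> (\<forall>i<3. \<forall>k<3. (\<Sum>l<3. B $$ (i, l) * x $$ (l, k)) = (\<Sum>j<3. M $$ (i, j) * B $$ (j, k)))"
    using assms by (simp add: index_mult_mat_3 del: index_mult_mat(1))
  also have "\<dots> \<longleftrightarrow> (\<forall>i<3. act (\<lambda>k. if k < 3 then B $$ (i, k) else 0) x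
    = (\<lambda>k. if k < 3 then \<Sum>j<3. M $$ (i, j) * B $$ (j, k) else 0))"
    by (auto simp: act_def fun_eq_iff)
  finally show ?thesis .
qed

lemma row_of_mat_bij:
  assumes "r \<in> row3" obtains A where "A \<in> carrier_mat 1 3" "row_of_mat A = r"
proof
  show "row_of_mat (mat 1 3 (\<lambda>(i, k). r k)) = r"
    using assms by (auto simp: row_of_mat_def row3_def)
qed simp

lemma row_of_mat_inj:
  assumes "A \<in> carrier_mat 1 3" "B \<in> carrier_mat 1 3" "row_of_mat A = row_of_mat B"
  shows "A = B"
proof (rule eq_matI)
  fix i j assume "i < dim_row B" "j < dim_col B"
  then show "A $$ (i, j) = B $$ (i, j)" using assms(1,2) fun_cong[OF assms(3), of j] by (simp add: row_of_mat_def)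
qed (use assms in auto)

lemma finsum_ring_mat_index:
  fixes f :: "'b \<Rightarrow> 'd::ring_1 mat"
  assumes "finite A" "\<And>x. x \<in> A \<Longrightarrow> f x \<in> carrier_mat n n" "i < n" "j < n"
  shows "(\<Oplus>\<^bsub>ring_mat TYPE('d) n ()\<^esub>x\<in>A. f x) $$ (i, j) = (\<Sum>x\<in>A. f x $$ (i, j))"
proof -
  interpret semiring "ring_mat TYPE('d) n ()" by (rule semiring_mat)
  show ?thesis using assms(1,2)
  proof (induction A rule: finite_induct)
    case empty
    show ?case using assms(3,4) by (simp add: ring_mat_simps)
  next
    case (insert x A)
    have "(\<Oplus>\<^bsub>ring_mat TYPE('d) n ()\<^esub>x\<in>A. f x) \<in> carrier_mat n n"
      using finsum_closed[of f A] insert.prems by (auto simp: ring_mat_simps)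
    then show ?case using insert assms(3,4) by (simp add: ring_mat_simps Pi_def)
  qed
qed

lemma abelian_monoid_module_mat: "abelian_monoid (module_mat TYPE('d::ring_1) m n)"
proof (rule abelian_monoidI)
  fix A B C :: "'d mat"
  assume "A \<in> carrier (module_mat TYPE('d) m n)" "B \<in> carrier (module_mat TYPE('d) m n)" "C \<in> carrier (module_mat TYPE('d) m n)"
  then show "A \<oplus>\<^bsub>module_mat TYPE('d) m n\<^esub> B \<oplus>\<^bsub>module_mat TYPE('d) m n\<^esub> C
    = A \<oplus>\<^bsub>module_mat TYPE('d) m n\<^esub> (B \<oplus>\<^bsub>module_mat TYPE('d) m n\<^esub> C)"
    unfolding module_mat_simps by (rule assoc_add_mat)
next
  fix A B :: "'d mat"
  assume "A \<in> carrier (module_mat TYPE('d) m n)" "B \<in> carrier (module_mat TYPE('d) m n)"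
  then show "A \<oplus>\<^bsub>module_mat TYPE('d) m n\<^esub> B = B \<oplus>\<^bsub>module_mat TYPE('d) m n\<^esub> A"
    unfolding module_mat_simps by (rule comm_add_mat)
qed (simp_all add: module_mat_simps)

lemma finsum_module_mat_row:
  fixes f :: "'b \<Rightarrow> 'd::ring_1 mat"
  assumes "finite A" "\<And>x. x \<in> A \<Longrightarrow> f x \<in> carrier_mat 1 3"
  shows "row_of_mat (\<Oplus>\<^bsub>module_mat TYPE('d) 1 3\<^esub>x\<in>A. f x) = (\<lambda>k. \<Sum>x\<in>A. row_of_mat (f x) k)"
proof -
  interpret abelian_monoid "module_mat TYPE('d) 1 3" by (rule abelian_monoid_module_mat)
  show ?thesis using assms
  proof (induction A rule: finite_induct)
    case empty
    show ?case by (simp only: finsum_empty) (simp add: module_mat_simps row_of_mat_def fun_eq_iff)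
  next
    case (insert x A)
    have cl: "(\<Oplus>\<^bsub>module_mat TYPE('d) 1 3\<^esub>x\<in>A. f x) \<in> carrier_mat 1 3"
      using finsum_closed[of f A] insert.prems by (auto simp: module_mat_simps)
    have "(\<Oplus>\<^bsub>module_mat TYPE('d) 1 3\<^esub>x\<in>insert x A. f x) = f x + (\<Oplus>\<^bsub>module_mat TYPE('d) 1 3\<^esub>x\<in>A. f x)"
      using finsum_insert[OF insert.hyps(1,2), of f] insert.prems
      unfolding module_mat_simps by (simp add: Pi_def del: One_nat_def)
    moreover have "row_of_mat (f x + (\<Oplus>\<^bsub>module_mat TYPE('d) 1 3\<^esub>x\<in>A. f x))
      = (\<lambda>k. row_of_mat (f x) k + row_of_mat (\<Oplus>\<^bsub>module_mat TYPE('d) 1 3\<^esub>x\<in>A. f x) k)"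
      by (rule row_of_mat_add[OF insert.prems[OF insertI1] cl])
    ultimately show ?case using insert by simp
  qed
qed

section \<open>Lines permuted by the group\<close>

lemma (in definite_quaternions) left_dependent_rows:
  fixes v :: "nat \<Rightarrow> nat \<Rightarrow> 'd"
  shows "\<exists>c. (\<exists>m\<le>n. c m \<noteq> 0) \<and> (\<forall>k<n. (\<Sum>m\<le>n. c m * v m k) = 0)"
proof (rule left_dependent)
  show "\<exists>y. y * x = 1" if "x \<noteq> 0" for x :: 'd using inverse_exists[OF that] by blast
qed

text \<open>The hypotheses on the group and the summands, restated for plain functions. Absolute
  irreducibility appears as \<open>G_span\<close>, and directness is kept as uniqueness of the
  decomposition of the zero row.\<close>

locale imprimitive_rows = definite_quaternions scale a b i j
  for scale :: "rat \<Rightarrow> 'd::ring_1 \<Rightarrow> 'd" and a b i j +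
  fixes G :: "'d mat set" and s :: nat and W :: "nat \<Rightarrow> (nat \<Rightarrow> 'd) set"
  assumes finite_G: "finite G" and G_carrier: "G \<subseteq> carrier_mat 3 3"
    and G_mult: "\<And>x y. x \<in> G \<Longrightarrow> y \<in> G \<Longrightarrow> x * y \<in> G" and G_one: "1\<^sub>m 3 \<in> G"
    and G_inverse: "\<And>x. x \<in> G \<Longrightarrow> \<exists>y\<in>G. x * y = 1\<^sub>m 3 \<and> y * x = 1\<^sub>m 3"
    and G_span: "\<And>r u. r \<in> row3 \<Longrightarrow> r \<noteq> (\<lambda>k. 0) \<Longrightarrow> u \<in> row3 \<Longrightarrow>
      \<exists>l. u = (\<lambda>k. \<Sum>x\<in>G. scale (l x) (act r x k))"
    and s: "1 < s"
    and W_row3: "\<And>m. m < s \<Longrightarrow> W m \<subseteq> row3"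
    and W_zero: "\<And>m. m < s \<Longrightarrow> (\<lambda>k. 0) \<in> W m"
    and W_add: "\<And>m r u. m < s \<Longrightarrow> r \<in> W m \<Longrightarrow> u \<in> W m \<Longrightarrow> (\<lambda>k. r k + u k) \<in> W m"
    and W_scale: "\<And>m r c. m < s \<Longrightarrow> r \<in> W m \<Longrightarrow> (\<lambda>k. c * r k) \<in> W m"
    and W_nonzero: "\<And>m. m < s \<Longrightarrow> \<exists>r\<in>W m. r \<noteq> (\<lambda>k. 0)"
    and W_span: "\<And>r. r \<in> row3 \<Longrightarrow> \<exists>f. (\<forall>m<s. f m \<in> W m) \<and> r = (\<lambda>k. \<Sum>m<s. f m k)"
    and W_direct: "\<And>f. (\<And>m. m < s \<Longrightarrow> f m \<in> W m) \<Longrightarrow> (\<And>k. (\<Sum>m<s. f m k) = 0) \<Longrightarrow> m < s \<Longrightarrow> f m = (\<lambda>k. 0)"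
    and W_permuted: "\<And>x m. x \<in> G \<Longrightarrow> m < s \<Longrightarrow> \<exists>n<s. \<forall>r\<in>W m. act r x \<in> W n"
begin

lemma act_inverse:
  assumes "x \<in> G" "y \<in> G" "x * y = 1\<^sub>m 3" "r \<in> row3" shows "act (act r x) y = r"
  using act_mult[of x y r] assms(3,4) subsetD[OF G_carrier assms(1)] subsetD[OF G_carrier assms(2)]
  by (simp add: act_one)

lemma W_sum: "m < s \<Longrightarrow> (\<And>x. x \<in> A \<Longrightarrow> r x \<in> W m) \<Longrightarrow> (\<lambda>k. \<Sum>x\<in>A. r x k) \<in> W m"
  by (induction A rule: infinite_finite_induct) (auto simp: W_zero W_add)

lemma W_disjoint:
  assumes "m < s" "n < s" "m \<noteq> n" "r \<in> W m" "u \<in> W n" "\<And>k. r k + u k = 0"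
  shows "r = (\<lambda>k. 0) \<and> u = (\<lambda>k. 0)"
proof -
  define f where "f l = (if l = m then r else if l = n then u else (\<lambda>k. 0))" for l
  have sum: "(\<Sum>l<s. f l k) = r k + u k" for k
  proof -
    have "(\<Sum>l<s. f l k) = (\<Sum>l\<in>{m, n}. f l k)"
      using assms(1,2) by (intro sum.mono_neutral_right) (auto simp: f_def)
    then show ?thesis using assms(3) by (simp add: f_def)
  qed
  have "f l \<in> W l" if "l < s" for l using that assms W_zero by (auto simp: f_def)
  then have "f m = (\<lambda>k. 0)" "f n = (\<lambda>k. 0)" using W_direct[of f] sum assms by simp_all
  then show ?thesis using assms(3) by (simp add: f_def)
qed

text \<open>A nonzero row \<open>u\<close> of \<open>W n\<close> is a rational combination of the
  orbit of a row of \<open>W m\<close>. If no group element carried \<open>W m\<close> into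
  \<open>W n\<close>, no term of it would lie in \<open>W n\<close>, against directness.\<close>

lemma transitive:
  assumes "m < s" "n < s"
  obtains x where "x \<in> G" "\<forall>r\<in>W m. act r x \<in> W n"
proof -
  have "\<exists>x\<in>G. \<forall>r\<in>W m. act r x \<in> W n"
  proof (rule ccontr)
    assume no: "\<not> (\<exists>x\<in>G. \<forall>r\<in>W m. act r x \<in> W n)"
    obtain r where r: "r \<in> W m" "r \<noteq> (\<lambda>k. 0)" using W_nonzero assms by blast
    obtain u where u: "u \<in> W n" "u \<noteq> (\<lambda>k. 0)" using W_nonzero assms by blast
    have "r \<in> row3" "u \<in> row3" using r u W_row3 assms by blast+
    then obtain l where l: "u = (\<lambda>k. \<Sum>x\<in>G. scale (l x) (act r x k))" using G_span r(2) by blast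
    have "\<forall>x\<in>G. \<exists>k<s. \<forall>r\<in>W m. act r x \<in> W k" using W_permuted[OF _ assms(1)] by blast
    then obtain \<tau> where \<tau>: "\<And>x. x \<in> G \<Longrightarrow> \<tau> x < s" "\<And>x. x \<in> G \<Longrightarrow> \<forall>r\<in>W m. act r x \<in> W (\<tau> x)"
      by metis
    have \<tau>n: "\<tau> x \<noteq> n" if "x \<in> G" for x using no \<tau>(2)[OF that] that by metis
    define f where "f k = (\<lambda>c. \<Sum>x\<in>{x \<in> G. \<tau> x = k}. scale (l x) (act r x c))" for k
    have scaled: "(\<lambda>c. scale (l x) (act r x c)) \<in> W (\<tau> x)" if "x \<in> G" for x
      using W_scale[OF \<tau>(1)[OF that], of "act r x" "scale (l x) 1"] \<tau>(2)[OF that] r(1) by (simp add: scale_mult_left)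
    have f: "f k \<in> W k" if "k < s" for k
      unfolding f_def by (rule W_sum[OF that]) (use scaled in auto)
    have fn: "f n = (\<lambda>c. 0)"
    proof -
      have empty: "{x \<in> G. \<tau> x = n} = {}" using \<tau>n by blast
      show ?thesis unfolding f_def empty by simp
    qed
    have "(\<Sum>k<s. f k c) = u c" for c
      unfolding l f_def by (rule sum.group) (use finite_G \<tau>(1) in auto)
    \<comment> \<open>Subtracting \<open>u\<close> at place \<open>n\<close>, where \<open>f\<close>
      vanishes, gives a decomposition of the zero row.\<close>
    moreover define g where "g k = (if k = n then (\<lambda>c. - 1 * u c) else f k)" for k
    have sum_g: "(\<Sum>k<s. g k c) = (\<Sum>k<s. f k c) - u c" for c
    proof -
      have "(\<Sum>k<s. g k c) = (\<Sum>k<s. f k c + (if k = n then - u c else 0))"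
        using fn by (intro sum.cong) (auto simp: g_def)
      then show ?thesis using assms(2) by (simp add: sum.distrib)
    qed
    moreover have "g k \<in> W k" if "k < s" for k
      using f[OF that] W_scale[OF assms(2) u(1), of "- 1"] by (auto simp: g_def)
    ultimately have "g n = (\<lambda>c. 0)" using W_direct[of g n] assms(2) by simp
    then have "- 1 * u c = 0" for c unfolding g_def by (metis)
    then show False using u(2) by auto
  qed
  then show ?thesis using that by blast
qed

lemma four_rows_dependent:
  assumes "r0 \<in> row3" "r1 \<in> row3" "r2 \<in> row3" "r3 \<in> row3"
  obtains c0 c1 c2 c3 :: 'd where "\<not> (c0 = 0 \<and> c1 = 0 \<and> c2 = 0 \<and> c3 = 0)"
    "\<And>k. c0 * r0 k + c1 * r1 k + c2 * r2 k + c3 * r3 k = 0"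
proof -
  define v where "v m = (if m = 0 then r0 else if m = 1 then r1 else if m = 2 then r2 else r3)" for m :: nat
  obtain c where c: "\<exists>m\<le>3. c m \<noteq> 0" "\<forall>k<3. (\<Sum>m\<le>3. c m * v m k) = 0"
    using left_dependent_rows[of 3 v] by blast
  have three: "{..3} = {0, 1, 2, 3::nat}" by auto
  have "\<not> (c 0 = 0 \<and> c 1 = 0 \<and> c 2 = 0 \<and> c 3 = 0)"
  proof
    assume zero: "c 0 = 0 \<and> c 1 = 0 \<and> c 2 = 0 \<and> c 3 = 0"
    obtain m where m: "m \<in> {..3}" "c m \<noteq> 0" using c(1) by auto
    then show False using zero unfolding three by auto
  qed
  moreover have "c 0 * r0 k + c 1 * r1 k + c 2 * r2 k + c 3 * r3 k = 0" for k
  proof (cases "k < 3")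
    case True
    then show ?thesis using c(2) unfolding three by (simp add: v_def add.assoc)
  qed (use assms in \<open>simp add: row3_def\<close>)
  ultimately show ?thesis using that by blast
qed

lemma scaled_row_zero:
  assumes "r \<noteq> (\<lambda>k. 0)" "\<And>k. c * r k = 0" shows "c = (0 :: 'd)"
  using assms mult_eq_0_iff[of c] by blast

text \<open>By \<open>s > 1\<close> and transitivity, two independent rows of \<open>W m\<close>
  have independent images in another summand. That makes four independent rows in a space of
  dimension 3.\<close>

lemma W_line:
  assumes m: "m < s" and r: "r \<in> W m" "r \<noteq> (\<lambda>k. 0)" and u: "u \<in> W m"
  obtains c where "u = (\<lambda>k. c * r k)"
proof -
  have "\<exists>c. u = (\<lambda>k. c * r k)"
  proof (rule ccontr)
    assume no: "\<not> (\<exists>c. u = (\<lambda>k. c * r k))"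
    have independent: "c = 0 \<and> d = 0" if zero: "\<And>k. c * r k + d * u k = 0" for c d
    proof (cases "d = 0")
      case True
      then show ?thesis using zero scaled_row_zero[OF r(2)] by simp
    next
      case False
      then obtain d' where d': "d' * d = 1" using inverse_exists by blast
      have "u k = - (d' * c) * r k" for k
      proof -
        have "d' * (c * r k + d * u k) = 0" using zero by simp
        then have "d' * c * r k + u k = 0" using d' by (simp add: distrib_left mult.assoc[symmetric])
        then show ?thesis by (simp add: eq_neg_iff_add_eq_0 add.commute)
      qed
      then show ?thesis using no by blast
    qed
    have "(if m = 0 then 1 else 0) < s" "(if m = 0 then 1 else 0) \<noteq> m" using s by auto
    then obtain n where n: "n < s" "n \<noteq> m" by blast
    obtain x where x: "x \<in> G" "\<forall>r\<in>W m. act r x \<in> W n" by (rule transitive[OF m n(1)])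
    obtain x' where x': "x' \<in> G" "x * x' = 1\<^sub>m 3" using G_inverse[OF x(1)] by blast
    have rows: "r \<in> row3" "u \<in> row3" using r u W_row3 m by blast+
    obtain c0 c1 c2 c3 where c: "\<not> (c0 = 0 \<and> c1 = 0 \<and> c2 = 0 \<and> c3 = 0)"
      "\<And>k. c0 * r k + c1 * u k + c2 * act r x k + c3 * act u x k = 0"
      using four_rows_dependent[OF rows act_row3 act_row3] by metis
    have "(\<lambda>k. c0 * r k + c1 * u k) \<in> W m" "(\<lambda>k. c2 * act r x k + c3 * act u x k) \<in> W n"
      using r u x(2) W_add W_scale m n(1) by blast+
    from W_disjoint[OF m n(1) n(2)[symmetric] this]
    have zero: "\<And>k. c0 * r k + c1 * u k = 0" "(\<lambda>k. c2 * act r x k + c3 * act u x k) = (\<lambda>k. 0)"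
      using c(2) by (simp_all add: add.assoc fun_eq_iff)
    have "act (\<lambda>k. c2 * r k + c3 * u k) x = (\<lambda>k. 0)"
      using zero(2) by (simp add: act_add act_scale)
    moreover have "(\<lambda>k. c2 * r k + c3 * u k) \<in> row3" using rows by (simp add: row3_def)
    ultimately have "(\<lambda>k. c2 * r k + c3 * u k) = (\<lambda>k. 0)"
      using act_inverse[OF x(1) x'] by (metis act_zero)
    then have "c2 * r k + c3 * u k = 0" for k by (rule fun_cong)
    then show False using independent[of c0 c1] independent[of c2 c3] zero(1) c(1) by blast
  qed
  then show ?thesis using that by blast
qed

text \<open>More than three lines are dependent, and two do not span: the coefficients
  \<open>p m\<close>, \<open>q m\<close> of the three unit rows would be three pairs in dimension 2,
  and a left relation between these pairs is one between the unit rows.\<close>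

lemma three_summands: "s = 3"
proof -
  obtain w where w: "\<And>m. m < s \<Longrightarrow> w m \<in> W m" "\<And>m. m < s \<Longrightarrow> w m \<noteq> (\<lambda>k. 0)"
    using W_nonzero by metis
  have "s \<le> 3"
  proof (rule ccontr)
    assume "\<not> s \<le> 3"
    then have s4: "m \<le> 3 \<Longrightarrow> m < s" for m by simp
    obtain c where c: "\<exists>m\<le>3. c m \<noteq> 0" "\<forall>k<3. (\<Sum>m\<le>3. c m * w m k) = 0"
      using left_dependent_rows[of 3 w] by blast
    define f where "f m = (\<lambda>k. (if m \<le> 3 then c m else 0) * w m k)" for m
    have "f m \<in> W m" if "m < s" for m unfolding f_def using W_scale w(1) that by blast
    moreover have "(\<Sum>m<s. f m k) = 0" for k
    proof (cases "k < 3")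
      case True
      have "(\<Sum>m<s. f m k) = (\<Sum>m\<le>3. f m k)"
        using s4 by (intro sum.mono_neutral_right) (auto simp: f_def)
      also have "\<dots> = (\<Sum>m\<le>3. c m * w m k)" by (intro sum.cong) (auto simp: f_def)
      finally show ?thesis using c(2) True by simp
    next
      case False
      then show ?thesis using w(1) W_row3 by (intro sum.neutral) (force simp: f_def row3_def)
    qed
    ultimately have "f m = (\<lambda>k. 0)" if "m < s" for m using W_direct[of f m] that by blast
    then have "c m * w m k = 0" if "m \<le> 3" for m k
      using that s4 unfolding f_def by (metis (mono_tags, lifting))
    then have "c m = 0" if "m \<le> 3" for m using scaled_row_zero[OF w(2)] s4 that by blast
    then show False using c(1) by blast
  qed
  moreover have "s \<noteq> 2"
  proof
    assume s2: "s = 2"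
    define e where "e m = (\<lambda>k. if k = m then 1 else 0 :: 'd)" for m :: nat
    have "\<exists>p q. e m = (\<lambda>k. p * w 0 k + q * w 1 k)" if m: "m < 3" for m
    proof -
      have "e m \<in> row3" using m by (simp add: e_def row3_def)
      then obtain f where f: "\<forall>n<s. f n \<in> W n" "e m = (\<lambda>k. \<Sum>n<s. f n k)" using W_span by blast
      obtain p where p: "f 0 = (\<lambda>k. p * w 0 k)" using W_line[of 0 "w 0" "f 0"] w f(1) s2 by auto
      obtain q where q: "f 1 = (\<lambda>k. q * w 1 k)" using W_line[of 1 "w 1" "f 1"] w f(1) s2 by auto
      have "(\<Sum>n<s. f n k) = f 0 k + f 1 k" for k unfolding s2 by (simp add: numeral_2_eq_2)
      then show ?thesis using f(2) p q by auto
    qed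
    then obtain p q where pq: "\<And>m. m < 3 \<Longrightarrow> e m = (\<lambda>k. p m * w 0 k + q m * w 1 k)" by metis
    obtain c where c: "(\<exists>m\<le>2. c m \<noteq> 0) \<and> (\<forall>k<2::nat. (\<Sum>m\<le>2. c m * (if k = 0 then p m else q m)) = 0)"
      using left_dependent_rows[of 2 "\<lambda>m k. if k = 0 then p m else q m"] ..
    have zero: "(\<Sum>m\<le>2. c m * p m) = 0" "(\<Sum>m\<le>2. c m * q m) = 0"
      using conjunct2[OF c, rule_format, of 0] conjunct2[OF c, rule_format, of 1] by simp_all
    have "c n = 0" if n: "n \<le> 2" for n
    proof -
      have "c n = (\<Sum>m\<le>2. c m * e m n)" using n by (simp add: e_def if_distrib[of "\<lambda>x. _ * x"] cong: if_cong)
      also have "\<dots> = (\<Sum>m\<le>2. c m * p m * w 0 n + c m * q m * w 1 n)"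
        by (rule sum.cong) (simp_all add: pq distrib_left mult.assoc)
      also have "\<dots> = (\<Sum>m\<le>2. c m * p m) * w 0 n + (\<Sum>m\<le>2. c m * q m) * w 1 n"
        by (simp add: sum.distrib sum_distrib_right)
      finally show ?thesis using zero by simp
    qed
    then show False using c by blast
  qed
  ultimately show ?thesis using s by linarith
qed

text \<open>The basis rows are taken in the orbit of \<open>e 0\<close> instead of arbitrarily on
  their lines. This normalisation is what puts all monomial entries into one finite group.\<close>

theorem monomial_basis:
  "\<exists>(e :: nat \<Rightarrow> nat \<Rightarrow> 'd) y. (\<forall>m<3. e m \<in> row3 \<and> y m \<in> G \<and> e m = act (e 0) (y m)) \<and>
    (\<forall>c. (\<forall>k. (\<Sum>m<3. c m * e m k) = 0) \<longrightarrow> (\<forall>m<3. c m = 0)) \<and>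
    (\<forall>r\<in>row3. \<exists>c. r = (\<lambda>k. \<Sum>m<3. c m * e m k)) \<and>
    (\<forall>x\<in>G. \<forall>m<3. \<exists>n<3. \<exists>h. act (e m) x = (\<lambda>k. h * e n k))"
proof -
  note s3 = three_summands
  obtain e0 where e0: "e0 \<in> W 0" "e0 \<noteq> (\<lambda>k. 0)" using W_nonzero[of 0] s by auto
  have e0_row: "e0 \<in> row3" using e0(1) W_row3[of 0] s by auto
  \<comment> \<open>The identity is prescribed at index 0, so that the basis starts with
    \<open>e0\<close> itself.\<close>
  have "\<exists>x. x \<in> G \<and> (\<forall>r\<in>W 0. act r x \<in> W m) \<and> (m = 0 \<longrightarrow> x = 1\<^sub>m 3)" if m: "m < 3" for m
  proof (cases "m = 0")
    case True
    have "act r (1\<^sub>m 3) = r" if "r \<in> W 0" for r using act_one that W_row3[of 0] s by auto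
    then show ?thesis using True G_one by auto
  next
    case False
    have "0 < s" "m < s" using m s3 by simp_all
    then obtain x where "x \<in> G" "\<forall>r\<in>W 0. act r x \<in> W m" by (rule transitive)
    then show ?thesis using False by blast
  qed
  then obtain y where y: "\<And>m. m < 3 \<Longrightarrow> y m \<in> G" "\<And>m. m < 3 \<Longrightarrow> \<forall>r\<in>W 0. act r (y m) \<in> W m" "y 0 = 1\<^sub>m 3"
    using zero_less_numeral by metis
  define e where "e m = act e0 (y m)" for m
  have e_0: "e 0 = e0" unfolding e_def y(3) by (rule act_one[OF e0_row])
  have eW: "e m \<in> W m" if "m < 3" for m unfolding e_def using y(2)[OF that] e0(1) by blast
  have e_nz: "e m \<noteq> (\<lambda>k. 0)" if m: "m < 3" for m
  proof
    assume zero: "e m = (\<lambda>k. 0)"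
    obtain x' where x': "x' \<in> G" "y m * x' = 1\<^sub>m 3" using G_inverse[OF y(1)[OF m]] by blast
    have "e0 = act (e m) x'" unfolding e_def using act_inverse[OF y(1)[OF m] x' e0_row] by simp
    then show False using zero e0(2) by (simp add: act_zero)
  qed
  have line: "\<exists>c. r = (\<lambda>k. c * e m k)" if "m < 3" "r \<in> W m" for m r
    using W_line[of m "e m" r] eW e_nz that s3 by metis
  show ?thesis
  proof (intro exI[of _ e] exI[of _ y] conjI)
    have "e m \<in> row3 \<and> y m \<in> G \<and> e m = act (e 0) (y m)" if "m < 3" for m
      unfolding e_0 using y(1)[OF that] by (simp add: e_def)
    then show "\<forall>m<3. e m \<in> row3 \<and> y m \<in> G \<and> e m = act (e 0) (y m)" by blast
    show "\<forall>c. (\<forall>k. (\<Sum>m<3. c m * e m k) = 0) \<longrightarrow> (\<forall>m<3. c m = 0)"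
    proof (intro allI impI)
      fix c and m :: nat assume zero: "\<forall>k. (\<Sum>m<3. c m * e m k) = 0" and m: "m < 3"
      have "(\<lambda>k. c n * e n k) \<in> W n" if "n < s" for n using W_scale[OF that] eW that s3 by blast
      then have "(\<lambda>k. c m * e m k) = (\<lambda>k. 0)"
        using W_direct[of "\<lambda>m k. c m * e m k" m] zero m s3 by blast
      then have "c m * e m k = 0" for k by (rule fun_cong)
      then show "c m = 0" using scaled_row_zero[OF e_nz[OF m]] by blast
    qed
    show "\<forall>r\<in>row3. \<exists>c. r = (\<lambda>k. \<Sum>m<3. c m * e m k)"
    proof
      fix r :: "nat \<Rightarrow> 'd" assume r: "r \<in> row3"
      obtain f where f: "\<forall>m<s. f m \<in> W m" "r = (\<lambda>k. \<Sum>m<s. f m k)" using W_span[OF r] by blast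
      have "\<forall>m<3. \<exists>c. f m = (\<lambda>k. c * e m k)" using line f(1) s3 by blast
      then obtain c where c: "\<And>m. m < 3 \<Longrightarrow> f m = (\<lambda>k. c m * e m k)" by metis
      have "(\<Sum>m<s. f m k) = (\<Sum>m<3. c m * e m k)" for k
        unfolding s3 by (rule sum.cong) (simp_all add: c)
      then show "\<exists>c. r = (\<lambda>k. \<Sum>m<3. c m * e m k)" using f(2) by auto
    qed
    show "\<forall>x\<in>G. \<forall>m<3. \<exists>n<3. \<exists>h. act (e m) x = (\<lambda>k. h * e n k)"
    proof (intro ballI allI impI)
      fix x and m :: nat assume x: "x \<in> G" and m: "m < 3"
      obtain n where "n < s" "act (e m) x \<in> W n" using W_permuted[OF x, of m] eW[OF m] m s3 by blast
      then show "\<exists>n<3. \<exists>h. act (e m) x = (\<lambda>k. h * e n k)" using line[of n] s3 by blast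
    qed
  qed
qed

end

section \<open>From the matrix group to row vectors\<close>

lemma carrier_GL: "x \<in> carrier (GL TYPE('d::ring_1) n) \<longleftrightarrow>
    x \<in> carrier_mat n n \<and> (\<exists>y\<in>carrier_mat n n. y * x = 1\<^sub>m n \<and> x * y = 1\<^sub>m n)"
  by (simp add: GL_def units_of_def Units_def ring_mat_simps)

lemma GL_mult: "x \<otimes>\<^bsub>GL TYPE('d::ring_1) n\<^esub> y = x * y" and GL_one: "\<one>\<^bsub>GL TYPE('d::ring_1) n\<^esub> = 1\<^sub>m n"
  by (simp_all add: GL_def units_of_def ring_mat_simps)

lemma group_GL: "group (GL TYPE('d::ring_1) n)"
proof -
  interpret semiring "ring_mat TYPE('d) n ()" by (rule semiring_mat)
  show ?thesis unfolding GL_def by (rule units_group)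
qed

context definite_quaternions
begin

lemma unit_row_to_row:
  assumes r: "r \<in> row3" "r \<noteq> (\<lambda>k. 0)" and u: "u \<in> row3"
  obtains E :: "'d mat" where "E \<in> carrier_mat 3 3" "act r E = u"
proof -
  obtain q where q: "r q \<noteq> 0" using r(2) by auto
  then have q3: "q < 3" using r(1) by (auto simp: row3_def not_less[symmetric])
  obtain w where w: "r q * w = 1" using inverse_exists[OF q] by blast
  define E where "E = mat 3 3 (\<lambda>(l, k). if l = q then w * u k else 0)"
  have "act r E = u"
  proof (rule row_eqI)
    fix k :: nat assume k: "k < 3"
    have "act r E k = (\<Sum>l<3. if l = q then r q * (w * u k) else 0)"
      unfolding act_def if_P[OF k] by (rule sum.cong) (use k in \<open>auto simp: E_def\<close>)
    also have "\<dots> = u k" using q3 w by (simp add: mult.assoc[symmetric])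
    finally show "act r E k = u k" .
  qed (use u in auto)
  then show ?thesis using that[of E] by (simp add: E_def)
qed

lemma act_enveloping:
  assumes "finite G" "G \<subseteq> carrier_mat 3 3"
  shows "act r (\<Oplus>\<^bsub>ring_mat TYPE('d) 3 ()\<^esub>x\<in>G. map_mat (scale (l x)) x) = (\<lambda>k. \<Sum>x\<in>G. scale (l x) (act r x k))"
proof (rule row_eqI)
  fix k :: nat assume k: "k < 3"
  have idx: "(\<Oplus>\<^bsub>ring_mat TYPE('d) 3 ()\<^esub>x\<in>G. map_mat (scale (l x)) x) $$ (m, k) = (\<Sum>x\<in>G. scale (l x) (x $$ (m, k)))"
    if m: "m < 3" for m
  proof -
    have "(\<Oplus>\<^bsub>ring_mat TYPE('d) 3 ()\<^esub>x\<in>G. map_mat (scale (l x)) x) $$ (m, k) = (\<Sum>x\<in>G. map_mat (scale (l x)) x $$ (m, k))"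
      using assms m k by (intro finsum_ring_mat_index) auto
    also have "\<dots> = (\<Sum>x\<in>G. scale (l x) (x $$ (m, k)))"
      by (rule sum.cong) (use assms m k in auto)
    finally show ?thesis .
  qed
  have "act r (\<Oplus>\<^bsub>ring_mat TYPE('d) 3 ()\<^esub>x\<in>G. map_mat (scale (l x)) x) k = (\<Sum>m<3. r m * (\<Sum>x\<in>G. scale (l x) (x $$ (m, k))))"
    unfolding act_def if_P[OF k] by (rule sum.cong) (simp_all add: idx)
  also have "\<dots> = (\<Sum>m<3. \<Sum>x\<in>G. scale (l x) (r m * x $$ (m, k)))"
    by (simp add: sum_distrib_left scale_mult_right)
  also have "\<dots> = (\<Sum>x\<in>G. \<Sum>m<3. scale (l x) (r m * x $$ (m, k)))" by (rule sum.swap)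
  also have "\<dots> = (\<Sum>x\<in>G. scale (l x) (act r x k))"
    using k by (simp add: act_def scale_sum_right)
  finally show "act r (\<Oplus>\<^bsub>ring_mat TYPE('d) 3 ()\<^esub>x\<in>G. map_mat (scale (l x)) x) k = (\<Sum>x\<in>G. scale (l x) (act r x k))" .
next
  show "(\<lambda>k. \<Sum>x\<in>G. scale (l x) (act r x k)) \<in> row3" by (simp add: row3_def act_def)
qed simp

lemma imprimitive_rows_exist:
  assumes G: "subgroup G (GL TYPE('d) 3)" "finite G" and irr: "absolutely_irreducible scale 3 G" and imp: "imprimitive 3 G"
  shows "\<exists>s W. imprimitive_rows scale a b i j G s W"
proof -
  let ?V = "module_mat TYPE('d) 1 3"
  have sub: "G \<subseteq> carrier_mat 3 3" using subgroup.subset[OF G(1)] carrier_GL by blast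
  have ex: "\<exists>s>1. \<exists>W :: nat \<Rightarrow> 'd mat set.
      (\<forall>m<s. submodule (W m) (ring_of_type_algebra :: 'd ring) ?V \<and> W m \<noteq> {0\<^sub>m 1 3}) \<and>
      (\<forall>v\<in>carrier_mat 1 3. \<exists>!f. f \<in> (\<Pi>\<^sub>E m\<in>{..<s}. W m) \<and> v = (\<Oplus>\<^bsub>?V\<^esub>m\<in>{..<s}. f m)) \<and>
      (\<forall>x\<in>G. \<forall>m<s. \<exists>n<s. (\<lambda>v. v * x) ` W m \<subseteq> W n)"
    using conjunct2[OF imp[unfolded imprimitive_def]] unfolding Let_def module_mat_simps .
  obtain s and W :: "nat \<Rightarrow> 'd mat set" where s: "1 < s"
    and W1: "\<forall>m<s. submodule (W m) (ring_of_type_algebra :: 'd ring) ?V \<and> W m \<noteq> {0\<^sub>m 1 3}"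
    and W2: "\<forall>v\<in>carrier_mat 1 3. \<exists>!f. f \<in> (\<Pi>\<^sub>E m\<in>{..<s}. W m) \<and> v = (\<Oplus>\<^bsub>?V\<^esub>m\<in>{..<s}. f m)"
    and W3: "\<forall>x\<in>G. \<forall>m<s. \<exists>n<s. (\<lambda>v. v * x) ` W m \<subseteq> W n"
    using ex by (elim exE conjE)
  have subm: "submodule (W m) (ring_of_type_algebra :: 'd ring) ?V" and nz: "W m \<noteq> {0\<^sub>m 1 3}" if "m < s" for m
    using W1 that by blast+
  note dec = bspec[OF W2]
  have perm: "\<exists>n<s. (\<lambda>v. v * x) ` W m \<subseteq> W n" if "x \<in> G" "m < s" for x m using W3 that by blast
  note sg = subm[THEN submodule.axioms(1)]
  have Wc: "W m \<subseteq> carrier_mat 1 3" if "m < s" for m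
    using subgroup.subset[OF sg[OF that]] by (simp add: module_mat_simps)
  have W0: "0\<^sub>m 1 3 \<in> W m" if "m < s" for m
    using subgroup.one_closed[OF sg[OF that]] by (simp add: module_mat_simps)
  have Wadd: "A + B \<in> W m" if "m < s" "A \<in> W m" "B \<in> W m" for m A B
    using subgroup.m_closed[OF sg[OF that(1)] that(2,3)] by (simp add: module_mat_simps)
  have Wscale: "c \<cdot>\<^sub>m A \<in> W m" if "m < s" "A \<in> W m" for m A c
    using submodule.smult_closed[OF subm[OF that(1)], of c A] that(2)
    by (simp add: module_mat_simps ring_of_type_algebra_def)
  define W' where "W' m = row_of_mat ` W m" for m
  have row_zero: "row_of_mat (0\<^sub>m 1 3) = (\<lambda>k. 0 :: 'd)" by (rule ext) (simp add: row_of_mat_def)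
  have fam: "\<exists>A. (\<forall>m<s. A m \<in> W m \<and> row_of_mat (A m) = f m)" if f: "\<forall>m<s. f m \<in> W' m" for f
  proof -
    have ex: "\<exists>A. A \<in> W m \<and> row_of_mat A = f m" if m: "m < s" for m
    proof -
      have "f m \<in> row_of_mat ` W m" using f m by (simp add: W'_def)
      then show ?thesis by (elim imageE) auto
    qed
    show ?thesis
      by (intro exI[of _ "\<lambda>m. SOME A. A \<in> W m \<and> row_of_mat A = f m"] allI impI) (rule someI_ex[OF ex])
  qed
  have sum_rows: "row_of_mat (\<Oplus>\<^bsub>?V\<^esub>m\<in>{..<s}. A m) = (\<lambda>k. \<Sum>m<s. row_of_mat (A m) k)"
    if "\<And>m. m < s \<Longrightarrow> A m \<in> W m" for A
    by (rule finsum_module_mat_row, simp, rule subsetD[OF Wc that]) simp_all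
  have "imprimitive_rows scale a b i j G s W'"
  proof (rule imprimitive_rows.intro[OF definite_quaternions_axioms imprimitive_rows_axioms.intro])
    show "finite G" by (rule G(2))
    show "G \<subseteq> carrier_mat 3 3" by (rule sub)
    show "x * y \<in> G" if "x \<in> G" "y \<in> G" for x y
      using subgroup.m_closed[OF G(1) that] by (simp add: GL_mult)
    show "1\<^sub>m 3 \<in> G" using subgroup.one_closed[OF G(1)] by (simp add: GL_one)
    show "\<exists>y\<in>G. x * y = 1\<^sub>m 3 \<and> y * x = 1\<^sub>m 3" if x: "x \<in> G" for x
    proof -
      interpret GL: group "GL TYPE('d) 3" by (rule group_GL)
      have "x \<in> carrier (GL TYPE('d) 3)" using x subgroup.subset[OF G(1)] by blast
      then show ?thesis
        using GL.r_inv[of x] GL.l_inv[of x] subgroup.m_inv_closed[OF G(1) x] unfolding GL_mult GL_one by blast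
    qed
    show "\<exists>l. u = (\<lambda>k. \<Sum>x\<in>G. scale (l x) (act r x k))" if r: "r \<in> row3" "r \<noteq> (\<lambda>k. 0)" "u \<in> row3" for r u
    proof -
      obtain E where E: "E \<in> carrier_mat 3 3" "act r E = u" using unit_row_to_row[OF r] .
      then obtain l where "E = (\<Oplus>\<^bsub>ring_mat TYPE('d) 3 ()\<^esub>x\<in>G. map_mat (scale (l x)) x)"
        using irr unfolding absolutely_irreducible_def enveloping_algebra_def by blast
      then show ?thesis using E(2) act_enveloping[OF G(2) sub] by blast
    qed
    show "1 < s" by (rule s)
    show "W' m \<subseteq> row3" if "m < s" for m unfolding W'_def using row_of_mat_row3 by blast
    show "(\<lambda>k. 0) \<in> W' m" if "m < s" for m
      unfolding W'_def using W0[OF that] row_zero by (metis image_eqI)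
    show "(\<lambda>k. r k + u k) \<in> W' m" if m: "m < s" and ru: "r \<in> W' m" "u \<in> W' m" for m r u
    proof -
      obtain A B where AB: "A \<in> W m" "B \<in> W m" "r = row_of_mat A" "u = row_of_mat B" using ru unfolding W'_def by blast
      then have "row_of_mat (A + B) = (\<lambda>k. r k + u k)"
        using row_of_mat_add Wc[OF m] by blast
      then show ?thesis unfolding W'_def using Wadd[OF m AB(1,2)] by (metis image_eqI)
    qed
    show "(\<lambda>k. c * r k) \<in> W' m" if m: "m < s" and r: "r \<in> W' m" for m r c
    proof -
      obtain A where A: "A \<in> W m" "r = row_of_mat A" using r unfolding W'_def by blast
      have "A \<in> carrier_mat 1 3" using A Wc[OF m] by blast
      then have "row_of_mat (c \<cdot>\<^sub>m A) = (\<lambda>k. c * r k)"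
        unfolding A(2) by (intro ext) (simp add: row_of_mat_def)
      then show ?thesis unfolding W'_def using Wscale[OF m A(1)] by (metis image_eqI)
    qed
    show "\<exists>r\<in>W' m. r \<noteq> (\<lambda>k. 0)" if m: "m < s" for m
    proof -
      obtain A where A: "A \<in> W m" "A \<noteq> 0\<^sub>m 1 3" using nz[OF m] W0[OF m] by blast
      then have "row_of_mat A \<noteq> (\<lambda>k. 0)" using row_of_mat_inj[of A "0\<^sub>m 1 3"] Wc[OF m] row_zero by auto
      then show ?thesis unfolding W'_def using A by blast
    qed
    show "\<exists>f. (\<forall>m<s. f m \<in> W' m) \<and> r = (\<lambda>k. \<Sum>m<s. f m k)" if r: "r \<in> row3" for r
    proof -
      obtain A where A: "A \<in> carrier_mat 1 3" "row_of_mat A = r" using row_of_mat_bij[OF r] .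
      obtain f where f: "f \<in> (\<Pi>\<^sub>E m\<in>{..<s}. W m)" "A = (\<Oplus>\<^bsub>?V\<^esub>m\<in>{..<s}. f m)" using dec[OF A(1)] by blast
      then have fW: "f m \<in> W m" if "m < s" for m using that by auto
      have "r = (\<lambda>k. \<Sum>m<s. row_of_mat (f m) k)" using sum_rows[of f] fW A(2) f(2) by simp
      moreover have "\<forall>m<s. row_of_mat (f m) \<in> W' m" using fW unfolding W'_def by blast
      ultimately show ?thesis by (intro exI[of _ "\<lambda>m. row_of_mat (f m)"]) blast
    qed
    show "f m = (\<lambda>k. 0)" if f: "\<And>m. m < s \<Longrightarrow> f m \<in> W' m" "\<And>k. (\<Sum>m<s. f m k) = 0" and m: "m < s" for f m
    proof -
      obtain A where A: "\<forall>m<s. A m \<in> W m \<and> row_of_mat (A m) = f m" using fam[of f] f(1) by blast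
      \<comment> \<open>Uniqueness is available for extensional families, hence the restrictions.
        \<open>A'\<close> and the zero family \<open>Z\<close> both sum to the zero row, so they are
        the same decomposition.\<close>
      define A' where "A' = restrict A {..<s}"
      define Z where "Z = (\<lambda>m\<in>{..<s}. 0\<^sub>m 1 3 :: 'd mat)"
      have mem: "A' \<in> (\<Pi>\<^sub>E m\<in>{..<s}. W m)" "Z \<in> (\<Pi>\<^sub>E m\<in>{..<s}. W m)"
        unfolding A'_def Z_def using A W0 by auto
      have "row_of_mat (\<Oplus>\<^bsub>?V\<^esub>m\<in>{..<s}. A' m) = (\<lambda>k. 0)" "row_of_mat (\<Oplus>\<^bsub>?V\<^esub>m\<in>{..<s}. Z m) = (\<lambda>k. 0)"
      proof -
        have "row_of_mat (\<Oplus>\<^bsub>?V\<^esub>m\<in>{..<s}. A' m) = (\<lambda>k. \<Sum>m<s. row_of_mat (A' m) k)"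
          by (rule sum_rows) (use mem in auto)
        also have "\<dots> = (\<lambda>k. \<Sum>m<s. f m k)"
          by (intro ext sum.cong) (use A in \<open>auto simp: A'_def\<close>)
        finally show "row_of_mat (\<Oplus>\<^bsub>?V\<^esub>m\<in>{..<s}. A' m) = (\<lambda>k. 0)" using f(2) by simp
        have "row_of_mat (\<Oplus>\<^bsub>?V\<^esub>m\<in>{..<s}. Z m) = (\<lambda>k. \<Sum>m<s. row_of_mat (Z m) k)"
          by (rule sum_rows) (use mem in auto)
        also have "\<dots> = (\<lambda>k. 0)"
          by (intro ext sum.neutral) (auto simp: Z_def row_zero simp del: One_nat_def)
        finally show "row_of_mat (\<Oplus>\<^bsub>?V\<^esub>m\<in>{..<s}. Z m) = (\<lambda>k. 0)" .
      qed
      moreover have "(\<Oplus>\<^bsub>?V\<^esub>m\<in>{..<s}. g m) \<in> carrier_mat 1 3" if "g \<in> (\<Pi>\<^sub>E m\<in>{..<s}. W m)" for g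
      proof -
        interpret abelian_monoid ?V by (rule abelian_monoid_module_mat)
        have "g \<in> {..<s} \<rightarrow> carrier ?V" using that Wc unfolding module_mat_simps by (auto dest: PiE_mem)
        then show ?thesis using finsum_closed[of g "{..<s}"] unfolding module_mat_simps by blast
      qed
      ultimately have "(\<Oplus>\<^bsub>?V\<^esub>m\<in>{..<s}. A' m) = (\<Oplus>\<^bsub>?V\<^esub>m\<in>{..<s}. Z m)" "(\<Oplus>\<^bsub>?V\<^esub>m\<in>{..<s}. A' m) \<in> carrier_mat 1 3"
        using row_of_mat_inj mem by metis+
      then have "A' = Z" using dec[of "\<Oplus>\<^bsub>?V\<^esub>m\<in>{..<s}. A' m"] mem by metis
      then have "A m = 0\<^sub>m 1 3" using m unfolding A'_def Z_def by (metis lessThan_iff restrict_apply')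
      then show ?thesis using A m row_zero by metis
    qed
    show "\<exists>n<s. \<forall>r\<in>W' m. act r x \<in> W' n" if x: "x \<in> G" and m: "m < s" for x m
    proof -
      obtain n where n: "n < s" "(\<lambda>v. v * x) ` W m \<subseteq> W n" using perm[OF x m] by blast
      have "act r x \<in> W' n" if r: "r \<in> W' m" for r
      proof -
        obtain A where A: "A \<in> W m" "r = row_of_mat A" using r unfolding W'_def by blast
        then have "act r x = row_of_mat (A * x)" using row_of_mat_mult[OF subsetD[OF Wc[OF m] A(1)] subsetD[OF sub x]] by simp
        then show ?thesis unfolding W'_def using n(2) A(1) by blast
      qed
      then show ?thesis using n(1) by blast
    qed
  qed
  then show ?thesis by blast
qed

end

section \<open>Monomial matrices\<close>

text \<open>The monomial matrix whose entry at position \<open>(i, k)\<close>, counted from 0, belongs to the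
  permutation \<open>\<sigma>\<close> of \<open>{1..3}\<close> when \<open>\<sigma>\<close> maps \<open>k + 1\<close> to \<open>i + 1\<close>.\<close>

definition monomial_mat :: "(nat \<Rightarrow> 'd::ring_1) \<Rightarrow> (nat \<Rightarrow> nat) \<Rightarrow> 'd mat" where
  "monomial_mat h \<sigma> = mat 3 3 (\<lambda>(i, k). if \<sigma> (Suc k) = Suc i then h (Suc i) else 0)"

lemma monomial_mat_carrier [simp]: "monomial_mat h \<sigma> \<in> carrier_mat 3 3"
  by (simp add: monomial_mat_def)

context imprimitive_rows
begin

text \<open>The rows of \<open>B\<close> are the basis rows. \<open>H\<close> consists of the
  scalars by which the stabiliser of the line of \<open>e 0\<close> acts on \<open>e 0\<close>; it
  is noncommutative because it spans the algebra over the rationals.\<close>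

theorem monomial_form:
  "\<exists>(B :: 'd mat) B' H. B \<in> carrier_mat 3 3 \<and> B' \<in> carrier_mat 3 3 \<and> B * B' = 1\<^sub>m 3 \<and> B' * B = 1\<^sub>m 3 \<and>
    finite H \<and> (\<forall>g\<in>H. \<forall>h\<in>H. g * h \<in> H) \<and> 1 \<in> H \<and> 0 \<notin> H \<and> (\<exists>g\<in>H. \<exists>h\<in>H. g * h \<noteq> h * g) \<and>
    (\<forall>x\<in>G. \<exists>h \<sigma>. \<sigma> permutes {1..3} \<and> (\<forall>m\<in>{1..3}. h m \<in> H) \<and> x = B' * monomial_mat h \<sigma> * B)"
proof -
  obtain e :: "nat \<Rightarrow> nat \<Rightarrow> 'd" and y
    where basis: "\<forall>m<3. e m \<in> row3 \<and> y m \<in> G \<and> e m = act (e 0) (y m)"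
      "\<forall>c. (\<forall>k. (\<Sum>m<3. c m * e m k) = 0) \<longrightarrow> (\<forall>m<3. c m = 0)"
      "\<forall>r\<in>row3. \<exists>c. r = (\<lambda>k. \<Sum>m<3. c m * e m k)"
      "\<forall>x\<in>G. \<forall>m<3. \<exists>n<3. \<exists>h. act (e m) x = (\<lambda>k. h * e n k)"
    using monomial_basis by (elim exE conjE)
  have e_row: "e m \<in> row3" and y: "y m \<in> G" and e_y: "e m = act (e 0) (y m)" if "m < 3" for m
    using basis(1) that by blast+
  have indep: "\<forall>m<3. c m = 0" if "\<And>k. (\<Sum>m<3. c m * e m k) = 0" for c
    using basis(2)[rule_format, of c] that by blast
  have span: "\<exists>c. r = (\<lambda>k. \<Sum>m<3. c m * e m k)" if "r \<in> row3" for r using basis(3) that by blast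
  have monomial: "\<exists>n<3. \<exists>h. act (e m) x = (\<lambda>k. h * e n k)" if "x \<in> G" "m < 3" for x m using basis(4) that by blast
  have single: "(\<Sum>l<3. (if l = m then c else 0) * e l k) = c * e m k" if "m < 3" for m k and c :: 'd
  proof -
    have "(\<Sum>l<3. (if l = m then c else 0) * e l k) = (\<Sum>l<3. if l = m then c * e m k else 0)"
      by (rule sum.cong) auto
    then show ?thesis using that by simp
  qed
  have e_scale_0: "c = 0" if "m < 3" "\<And>k. c * e m k = 0" for m c
    using indep[of "\<lambda>l. if l = m then c else 0"] single[OF that(1)] that by auto
  have e_nz: "e m \<noteq> (\<lambda>k. 0)" if m: "m < 3" for m
  proof
    assume "e m = (\<lambda>k. 0)"
    then have "\<And>k. 1 * e m k = 0" by simp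
    then show False using e_scale_0[OF m] by fastforce
  qed
  have two: "c = 0 \<and> d = 0" if mn: "m < 3" "n < 3" "m \<noteq> n" "\<And>k. c * e m k + d * e n k = 0" for m n c d
  proof -
    have "(\<Sum>l<3. ((if l = m then c else 0) + (if l = n then d else 0)) * e l k) = 0" for k
      by (simp only: distrib_right sum.distrib single[OF mn(1)] single[OF mn(2)] mn(4))
    then show ?thesis using indep[of "\<lambda>l. (if l = m then c else 0) + (if l = n then d else 0)"] mn(1-3) by fastforce
  qed
  define B where "B = mat 3 3 (\<lambda>(m, k). e m k)"
  have B: "B \<in> carrier_mat 3 3" by (simp add: B_def)
  have "\<forall>m<3. \<exists>c. (\<lambda>k. if k = m then 1 else 0) = (\<lambda>k. \<Sum>l<3. c l * e l k)"
    using span by (simp add: row3_def)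
  then obtain c where c: "\<And>m. m < 3 \<Longrightarrow> (\<lambda>k. if k = m then 1 else 0) = (\<lambda>k. \<Sum>l<3. c m l * e l k)" by metis
  define B' where "B' = mat 3 3 (\<lambda>(m, l). c m l)"
  have B': "B' \<in> carrier_mat 3 3" by (simp add: B'_def)
  have B'B: "B' * B = 1\<^sub>m 3"
  proof (rule eq_matI)
    fix m k assume "m < dim_row (1\<^sub>m 3 :: 'd mat)" "k < dim_col (1\<^sub>m 3 :: 'd mat)"
    then have mk: "m < 3" "k < 3" by simp_all
    then have "(B' * B) $$ (m, k) = (\<Sum>l<3. c m l * e l k)"
      using index_mult_mat_3[OF B' B] by (simp add: B_def B'_def)
    then show "(B' * B) $$ (m, k) = 1\<^sub>m 3 $$ (m, k)" using fun_cong[OF c[OF mk(1)], of k] mk by auto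
  qed (use B B' in auto)
  \<comment> \<open>The other side of the inverse follows from \<open>B * B' * B = B\<close>,
    because the rows of \<open>B\<close> are left independent.\<close>
  have BB': "B * B' = 1\<^sub>m 3"
  proof (rule eq_matI)
    fix m n assume "m < dim_row (1\<^sub>m 3 :: 'd mat)" "n < dim_col (1\<^sub>m 3 :: 'd mat)"
    then have mn: "m < 3" "n < 3" by simp_all
    have "B * B' * B = B" using B B' B'B by (simp add: assoc_mult_mat[of _ 3 3 _ 3 _ 3])
    then have "(B * B' * B) $$ (m, k) = B $$ (m, k)" for k by simp
    then have eq: "(\<Sum>l<3. (B * B') $$ (m, l) * e l k) = e m k" if "k < 3" for k
      using index_mult_mat_3[OF mult_carrier_mat[OF B B'] B mn(1) that] mn that by (simp add: B_def)
    have "(\<Sum>l<3. ((B * B') $$ (m, l) - (if l = m then 1 else 0)) * e l k) = 0" for k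
    proof (cases "k < 3")
      case True
      then show ?thesis using eq single[OF mn(1), of 1 k] by (simp add: left_diff_distrib sum_subtractf)
    next
      case False
      then have "e l k = 0" if "l < 3" for l using e_row[OF that] by (simp add: row3_def)
      then show ?thesis by (intro sum.neutral) auto
    qed
    then have "\<forall>l<3. (B * B') $$ (m, l) - (if l = m then 1 else 0) = 0" by (rule indep)
    then show "(B * B') $$ (m, n) = 1\<^sub>m 3 $$ (m, n)" using mn by auto
  qed (use B B' in auto)
  define H where "H = {h. \<exists>x\<in>G. act (e 0) x = (\<lambda>k. h * e 0 k)}"
  have e0: "e 0 \<in> row3" using e_row by simp
  have act_nz: "act r x \<noteq> (\<lambda>k. 0)" if "x \<in> G" "r \<in> row3" "r \<noteq> (\<lambda>k. 0)" for r x
    using G_inverse[OF that(1)] act_inverse[OF that(1) _ _ that(2)] that(3) by (metis act_zero)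
  have finite_H: "finite H"
  proof -
    have "inj_on (\<lambda>h k. h * e 0 k) H"
    proof (rule inj_onI)
      fix g h assume "(\<lambda>k. g * e 0 k) = (\<lambda>k. h * e 0 k)"
      then have "(g - h) * e 0 k = 0" for k by (metis diff_self left_diff_distrib)
      then have "g - h = 0" using e_scale_0[of 0 "g - h"] by simp
      then show "g = h" by simp
    qed
    moreover have "(\<lambda>h k. h * e 0 k) ` H \<subseteq> act (e 0) ` G"
      unfolding H_def by (auto intro: rev_image_eqI)
    ultimately show ?thesis using finite_G by (meson finite_imageD finite_imageI finite_subset)
  qed
  have H_mult: "g * h \<in> H" if gh: "g \<in> H" "h \<in> H" for g h
  proof -
    obtain x z where xz: "x \<in> G" "act (e 0) x = (\<lambda>k. g * e 0 k)" "z \<in> G" "act (e 0) z = (\<lambda>k. h * e 0 k)"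
      using gh unfolding H_def by blast
    have "act (e 0) (x * z) = act (act (e 0) x) z" using act_mult xz G_carrier by blast
    also have "\<dots> = (\<lambda>k. g * h * e 0 k)" unfolding xz(2) act_scale xz(4) by (simp add: mult.assoc)
    finally show ?thesis unfolding H_def using G_mult xz by blast
  qed
  have H_one: "1 \<in> H" unfolding H_def using G_one act_one[OF e0] by auto
  have H_zero: "0 \<notin> H"
  proof
    assume "0 \<in> H"
    then obtain x where "x \<in> G" "act (e 0) x = (\<lambda>k. 0)" unfolding H_def by auto
    then show False using act_nz[OF _ e0 e_nz] by simp
  qed
  \<comment> \<open>Since \<open>e m\<close> and \<open>e n\<close> are translates of
    \<open>e 0\<close>, the scalar \<open>h\<close> occurring between them is also the scalar by
    which \<open>y m * x * z\<close> acts on \<open>e 0\<close>.\<close>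
  have monomial_H: "\<exists>n<3. \<exists>h\<in>H. act (e m) x = (\<lambda>k. h * e n k)" if x: "x \<in> G" and m: "m < 3" for x m
  proof -
    obtain n h where n: "n < 3" "act (e m) x = (\<lambda>k. h * e n k)" using monomial[OF x m] by blast
    obtain z where z: "z \<in> G" "y n * z = 1\<^sub>m 3" using G_inverse[OF y[OF n(1)]] by blast
    have car: "y m \<in> carrier_mat 3 3" "x \<in> carrier_mat 3 3" "z \<in> carrier_mat 3 3"
      using y[OF m] x z G_carrier by blast+
    have "act (e 0) (y m * x * z) = act (act (e m) x) z"
      unfolding e_y[OF m] using car by (simp add: act_mult)
    also have "\<dots> = (\<lambda>k. h * act (e n) z k)" by (simp only: n(2) act_scale)
    also have "act (e n) z = e 0"
      unfolding e_y[OF n(1)] by (rule act_inverse[OF y[OF n(1)] z e0])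
    finally have "h \<in> H" unfolding H_def using G_mult y[OF m] x z(1) by blast
    then show ?thesis using n by blast
  qed
  have H_noncomm: "\<exists>g\<in>H. \<exists>h\<in>H. g * h \<noteq> h * g"
  proof (rule ccontr)
    assume comm: "\<not> (\<exists>g\<in>H. \<exists>h\<in>H. g * h \<noteq> h * g)"
    \<comment> \<open>Write \<open>d\<close> times \<open>e 0\<close> as a rational combination of
      the orbit of \<open>e 0\<close> and compare the components along \<open>e 0\<close>.\<close>
    have combination: "\<exists>A l g. A \<subseteq> G \<and> (\<forall>x\<in>A. g x \<in> H) \<and> d = (\<Sum>x\<in>A. scale (l x) (g x))" for d
    proof -
      have "(\<lambda>k. d * e 0 k) \<in> row3" using e0 by (simp add: row3_def)
      then obtain l where l: "(\<lambda>k. d * e 0 k) = (\<lambda>k. \<Sum>x\<in>G. scale (l x) (act (e 0) x k))"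
        using G_span[OF e0 e_nz] by force
      have "\<forall>x\<in>G. \<exists>n g. n < 3 \<and> g \<in> H \<and> act (e 0) x = (\<lambda>k. g * e n k)"
        using monomial_H[of _ 0] by (metis zero_less_numeral)
      then obtain n g where ng: "\<And>x. x \<in> G \<Longrightarrow> n x < (3::nat)" "\<And>x. x \<in> G \<Longrightarrow> g x \<in> H"
        "\<And>x. x \<in> G \<Longrightarrow> act (e 0) x = (\<lambda>k. g x * e (n x) k)" by metis
      define s where "s m = (\<Sum>x\<in>{x \<in> G. n x = m}. scale (l x) (g x))" for m
      have sum: "(\<Sum>m<3. s m * e m k) = d * e 0 k" for k
      proof -
        have "(\<Sum>m<3. s m * e m k) = (\<Sum>m<3. \<Sum>x\<in>{x \<in> G. n x = m}. scale (l x) (act (e 0) x k))"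
          unfolding s_def sum_distrib_right
          by (intro sum.cong refl) (auto simp: ng(3) scale_mult_left)
        also have "\<dots> = (\<Sum>x\<in>G. scale (l x) (act (e 0) x k))"
          by (rule sum.group) (use finite_G ng(1) in auto)
        also have "\<dots> = d * e 0 k" by (rule fun_cong[OF l, symmetric])
        finally show ?thesis .
      qed
      have "(\<Sum>m<3. (s m - (if m = 0 then d else 0)) * e m k) = 0" for k
        using sum[of k] single[of 0 d k] by (simp only: left_diff_distrib sum_subtractf) simp
      then have "\<forall>m<3. s m - (if m = 0 then d else 0) = 0" by (rule indep)
      then have "d = s 0" by simp
      then show ?thesis unfolding s_def using ng(2)
        by (intro exI[of _ "{x \<in> G. n x = 0}"] exI[of _ l] exI[of _ g]) auto
    qed
    \<comment> \<open>What commutes with \<open>H\<close> commutes with its rational span. Applied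
      twice, this would make the whole algebra commutative.\<close>
    have 1: "d * h = h * d" if h: "\<forall>g\<in>H. g * h = h * g" for d h
    proof -
      obtain A l g where d: "A \<subseteq> G" "\<forall>x\<in>A. g x \<in> H" "d = (\<Sum>x\<in>A. scale (l x) (g x))"
        using combination[of d] by (elim exE conjE)
      have "(\<Sum>x\<in>A. scale (l x) (g x) * h) = (\<Sum>x\<in>A. h * scale (l x) (g x))"
        by (rule sum.cong) (use h d(2) in \<open>simp_all add: scale_mult_left scale_mult_right\<close>)
      then show ?thesis by (simp only: d(3) sum_distrib_left sum_distrib_right)
    qed
    have "g * h = h * g" if "g \<in> H" "h \<in> H" for g h using comm that by blast
    then have "\<forall>g\<in>H. g * d = d * g" for d using 1 by metis
    then have "d * d' = d' * d" for d d' :: 'd using 1 by blast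
    then show False using noncommutative by blast
  qed
  have form: "\<exists>h \<sigma>. \<sigma> permutes {1..3} \<and> (\<forall>m\<in>{1..3}. h m \<in> H) \<and> x = B' * monomial_mat h \<sigma> * B" if x: "x \<in> G" for x
  proof -
    have "\<forall>m<3. \<exists>n h. n < 3 \<and> h \<in> H \<and> act (e m) x = (\<lambda>k. h * e n k)" using monomial_H[OF x] by metis
    then obtain \<tau> h where \<tau>: "\<And>m. m < 3 \<Longrightarrow> \<tau> m < (3::nat)" "\<And>m. m < 3 \<Longrightarrow> h m \<in> H"
      "\<And>m. m < 3 \<Longrightarrow> act (e m) x = (\<lambda>k. h m * e (\<tau> m) k)" by metis
    have inj: "m = n" if mn: "m < 3" "n < 3" "\<tau> m = \<tau> n" for m n
    proof (rule ccontr)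
      assume neq: "m \<noteq> n"
      have "h m \<noteq> 0" using \<tau>(2) mn(1) H_zero by metis
      then obtain w where w: "w * h m = 1" using inverse_exists by blast
      \<comment> \<open>If two basis rows went to the same line, the invertible \<open>x\<close>
        would kill this nonzero combination of them.\<close>
      define r where "r = (\<lambda>k. h n * w * e m k + - 1 * e n k)"
      have "act r x = (\<lambda>k. h n * w * (h m * e (\<tau> m) k) + - 1 * (h n * e (\<tau> n) k))"
        unfolding r_def act_add act_scale \<tau>(3)[OF mn(1)] \<tau>(3)[OF mn(2)] ..
      also have "\<dots> = (\<lambda>k. 0)"
      proof
        fix k
        have "h n * w * (h m * e (\<tau> m) k) = h n * (w * h m) * e (\<tau> m) k" by (simp only: mult.assoc)
        then show "h n * w * (h m * e (\<tau> m) k) + - 1 * (h n * e (\<tau> n) k) = 0" using w mn(3) by simp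
      qed
      finally have "act r x = (\<lambda>k. 0)" .
      moreover have "r \<in> row3" using e_row[OF mn(1)] e_row[OF mn(2)] by (simp add: r_def row3_def)
      ultimately have "r = (\<lambda>k. 0)" using act_nz[OF x] by blast
      then have "\<And>k. h n * w * e m k + - 1 * e n k = 0" unfolding r_def by (rule fun_cong)
      then have "- 1 = (0 :: 'd)" using two[OF mn(1,2) neq] by blast
      then show False by simp
    qed
    \<comment> \<open>Row indices 0, 1, 2 are shifted to 1, 2, 3, the points on which
      \<open>sym_group\<close> acts.\<close>
    define \<pi> where "\<pi> m = (if m \<in> {1..3} then Suc (\<tau> (m - 1)) else m)" for m
    have into: "\<pi> ` {1..3} \<subseteq> {1..3}"
    proof
      fix n assume "n \<in> \<pi> ` {1..3}"
      then obtain m where m: "m \<in> {1..3}" "n = Suc (\<tau> (m - 1))" by (auto simp: \<pi>_def)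
      then have "\<tau> (m - 1) < 3" using \<tau>(1)[of "m - 1"] by auto
      then show "n \<in> {1..3}" using m(2) by simp
    qed
    have inj\<pi>: "inj_on \<pi> {1..3}"
    proof (rule inj_onI)
      fix m n assume mn: "m \<in> {1..3}" "n \<in> {1..3}" "\<pi> m = \<pi> n"
      then have "\<tau> (m - 1) = \<tau> (n - 1)" by (simp add: \<pi>_def)
      then have "m - 1 = n - 1" using inj[of "m - 1" "n - 1"] mn(1,2) by auto
      then show "m = n" using mn(1,2) by auto
    qed
    have "\<pi> ` {1..3} = {1..3}" using endo_inj_surj[OF _ into inj\<pi>] by simp
    then have "\<pi> permutes {1..3}"
      using inj\<pi> by (intro bij_imp_permutes) (auto simp: bij_betw_def \<pi>_def)
    \<comment> \<open>\<open>\<tau>\<close> leads from row to column, while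
      \<open>monomial_mat\<close> reads its permutation from column to row; hence the inverse. In
      this form products of matrices become compositions in the same order.\<close>
    define \<sigma> where "\<sigma> = inv_into UNIV \<pi>"
    have \<sigma>: "\<sigma> permutes {1..3}" unfolding \<sigma>_def by (rule permutes_inv) fact
    have \<sigma>_iff: "\<sigma> (Suc k) = Suc m \<longleftrightarrow> k = \<tau> m" if "m < 3" for m k
    proof -
      have "\<sigma> (Suc k) = Suc m \<longleftrightarrow> \<pi> (Suc m) = Suc k"
        unfolding \<sigma>_def using permutes_inv_eq[OF \<open>\<pi> permutes {1..3}\<close>] by metis
      then show ?thesis using that by (auto simp: \<pi>_def)
    qed
    define h' where "h' m = h (m - 1)" for m
    have "B * x = monomial_mat h' \<sigma> * B"
    proof (subst act_eq_scaled_row_iff[OF _ B monomial_mat_carrier])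
      show "x \<in> carrier_mat 3 3" using x G_carrier by blast
      show "\<forall>m<3. act (\<lambda>k. if k < 3 then B $$ (m, k) else 0) x
        = (\<lambda>k. if k < 3 then \<Sum>l<3. monomial_mat h' \<sigma> $$ (m, l) * B $$ (l, k) else 0)"
      proof (intro allI impI)
        fix m :: nat assume m: "m < 3"
        have Bm: "(\<lambda>k. if k < 3 then B $$ (m, k) else 0) = e m"
        proof
          fix k show "(if k < 3 then B $$ (m, k) else 0) = e m k"
            using e_row[OF m] m by (simp add: B_def row3_def)
        qed
        show "act (\<lambda>k. if k < 3 then B $$ (m, k) else 0) x
          = (\<lambda>k. if k < 3 then \<Sum>l<3. monomial_mat h' \<sigma> $$ (m, l) * B $$ (l, k) else 0)"
          unfolding Bm
        proof
          fix k
          show "act (e m) x k = (if k < 3 then \<Sum>l<3. monomial_mat h' \<sigma> $$ (m, l) * B $$ (l, k) else 0)"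
          proof (cases "k < 3")
            case True
            have "(\<Sum>l<3. monomial_mat h' \<sigma> $$ (m, l) * B $$ (l, k)) = (\<Sum>l<3. (if l = \<tau> m then h m else 0) * e l k)"
              by (rule sum.cong) (use m True \<sigma>_iff[OF m] in \<open>auto simp: monomial_mat_def B_def h'_def\<close>)
            also have "\<dots> = act (e m) x k" using single[OF \<tau>(1)[OF m]] \<tau>(3)[OF m] by simp
            finally show ?thesis using True by simp
          qed (simp add: act_def)
        qed
      qed
    qed
    then have "B' * (B * x) = B' * (monomial_mat h' \<sigma> * B)" by simp
    moreover have "x \<in> carrier_mat 3 3" using x G_carrier by blast
    then have "B' * (B * x) = x" using assoc_mult_mat[OF B' B, of x 3] B'B by simp
    moreover have "B' * (monomial_mat h' \<sigma> * B) = B' * monomial_mat h' \<sigma> * B"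
      using assoc_mult_mat[OF B' monomial_mat_carrier B] by simp
    moreover have "\<forall>m\<in>{1..3}. h' m \<in> H" using \<tau>(2) by (auto simp: h'_def)
    ultimately show ?thesis using \<sigma> by metis
  qed
  show ?thesis
    by (intro exI[of _ B] exI[of _ B'] exI[of _ H] conjI ballI B B' BB' B'B finite_H H_mult H_one H_zero H_noncomm form)
qed

end

lemma monomial_mat_cong:
  assumes "\<And>m. m \<in> {1..3} \<Longrightarrow> h m = h' m"
  shows "monomial_mat h \<sigma> = monomial_mat h' \<sigma>"
proof -
  have "h (Suc m) = h' (Suc m)" if "m < 3" for m using assms[of "Suc m"] that by simp
  then show ?thesis unfolding monomial_mat_def by (intro cong_mat) simp_all
qed

lemma monomial_mat_one:
  fixes h :: "nat \<Rightarrow> 'd::ring_1"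
  assumes "\<And>m. m \<in> {1..3} \<Longrightarrow> h m = 1"
  shows "monomial_mat h id = 1\<^sub>m 3"
proof (rule eq_matI)
  fix m k assume "m < dim_row (1\<^sub>m 3 :: 'd mat)" "k < dim_col (1\<^sub>m 3 :: 'd mat)"
  then show "monomial_mat h id $$ (m, k) = 1\<^sub>m 3 $$ (m, k)"
    using assms[of "Suc m"] by (auto simp: monomial_mat_def)
qed (simp_all add: monomial_mat_def)

lemma permutes_Suc_cases:
  assumes "\<sigma> permutes {1..3}" "k < 3" obtains l where "l < 3" "\<sigma> (Suc k) = Suc l"
proof -
  have "\<sigma> (Suc k) \<in> {1..3}" using permutes_in_image[OF assms(1)] assms(2) by simp
  then show ?thesis using that by (cases "\<sigma> (Suc k)") auto
qed

text \<open>The twist by the inverse permutation is the one of \<open>wreath_sym\<close>; it arises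
  because \<open>monomial_mat\<close> indexes its entries by rows.\<close>

lemma monomial_mat_mult:
  fixes h g :: "nat \<Rightarrow> 'd::ring_1"
  assumes \<sigma>: "\<sigma> permutes {1..3}" and \<tau>: "\<tau> permutes {1..3}"
  shows "monomial_mat h \<sigma> * monomial_mat g \<tau> = monomial_mat (\<lambda>m. h m * g (inv_into UNIV \<sigma> m)) (\<sigma> \<circ> \<tau>)"
proof (rule eq_matI)
  fix m k
  assume "m < dim_row (monomial_mat (\<lambda>m. h m * g (inv_into UNIV \<sigma> m)) (\<sigma> \<circ> \<tau>))"
    "k < dim_col (monomial_mat (\<lambda>m. h m * g (inv_into UNIV \<sigma> m)) (\<sigma> \<circ> \<tau>))"
  then have mk: "m < 3" "k < 3" by (simp_all add: monomial_mat_def)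
  obtain l where l: "l < 3" "\<tau> (Suc k) = Suc l" using permutes_Suc_cases[OF \<tau> mk(2)] .
  have "(monomial_mat h \<sigma> * monomial_mat g \<tau>) $$ (m, k)
      = (\<Sum>n<3. monomial_mat h \<sigma> $$ (m, n) * monomial_mat g \<tau> $$ (n, k))"
    by (rule index_mult_mat_3[OF monomial_mat_carrier monomial_mat_carrier mk])
  also have "\<dots> = (\<Sum>n<3. if n = l then monomial_mat h \<sigma> $$ (m, l) * g (Suc l) else 0)"
    by (rule sum.cong) (use mk l in \<open>auto simp: monomial_mat_def\<close>)
  also have "\<dots> = monomial_mat h \<sigma> $$ (m, l) * g (Suc l)" using l(1) by simp
  also have "\<dots> = monomial_mat (\<lambda>m. h m * g (inv_into UNIV \<sigma> m)) (\<sigma> \<circ> \<tau>) $$ (m, k)"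
    using mk l permutes_inverses(2)[OF \<sigma>, of "Suc l"] by (auto simp: monomial_mat_def)
  finally show "(monomial_mat h \<sigma> * monomial_mat g \<tau>) $$ (m, k)
    = monomial_mat (\<lambda>m. h m * g (inv_into UNIV \<sigma> m)) (\<sigma> \<circ> \<tau>) $$ (m, k)" .
qed (simp_all add: monomial_mat_def)

text \<open>As the entries of \<open>h\<close> are nonzero, the support of the matrix determines the
  permutation.\<close>

lemma monomial_mat_inject:
  fixes h g :: "nat \<Rightarrow> 'd::ring_1"
  assumes \<sigma>: "\<sigma> permutes {1..3}" and \<tau>: "\<tau> permutes {1..3}" and eq: "monomial_mat h \<sigma> = monomial_mat g \<tau>"
    and nz: "\<And>m. m \<in> {1..3} \<Longrightarrow> h m \<noteq> 0"
  shows "\<sigma> = \<tau>" "\<And>m. m \<in> {1..3} \<Longrightarrow> h m = g m"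
proof -
  have key: "\<tau> (Suc k) = \<sigma> (Suc k) \<and> g (\<sigma> (Suc k)) = h (\<sigma> (Suc k))" if k: "k < 3" for k
  proof -
    obtain l where l: "l < 3" "\<sigma> (Suc k) = Suc l" using permutes_Suc_cases[OF \<sigma> k] .
    have "monomial_mat h \<sigma> $$ (l, k) = monomial_mat g \<tau> $$ (l, k)" using eq by simp
    then have e: "h (Suc l) = (if \<tau> (Suc k) = Suc l then g (Suc l) else 0)" using k l by (simp add: monomial_mat_def)
    have "h (Suc l) \<noteq> 0" by (rule nz) (use l(1) in simp)
    then have "\<tau> (Suc k) = Suc l" using e by presburger
    then show ?thesis using e unfolding l(2) by simp
  qed
  show "\<sigma> = \<tau>"
  proof
    fix m show "\<sigma> m = \<tau> m"
    proof (cases "m \<in> {1..3}")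
      case True
      then obtain k where k: "k < 3" "m = Suc k" by (cases m) auto
      show ?thesis unfolding k(2) by (rule conjunct1[OF key[OF k(1)], symmetric])
    next
      case False
      then show ?thesis by (simp only: permutes_not_in[OF \<sigma> False] permutes_not_in[OF \<tau> False])
    qed
  qed
  show "h m = g m" if m: "m \<in> {1..3}" for m
  proof -
    have "m \<in> \<sigma> ` {1..3}" using m permutes_image[OF \<sigma>] by simp
    then obtain k where k: "m = \<sigma> k" "k \<in> {1..3}" ..
    obtain l where l: "l < 3" "k = Suc l" using k(2) by (cases k) auto
    show ?thesis unfolding k(1) l(2) by (rule conjunct2[OF key[OF l(1)], symmetric])
  qed
qed

lemma conjugate_mult:
  fixes B B' M M' :: "'d::ring_1 mat"
  assumes B: "B \<in> carrier_mat n n" "B' \<in> carrier_mat n n" "B * B' = 1\<^sub>m n"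
    and M: "M \<in> carrier_mat n n" "M' \<in> carrier_mat n n"
  shows "(B' * M * B) * (B' * M' * B) = B' * (M * M') * B"
proof -
  have c: "B' * M \<in> carrier_mat n n" "M' * B \<in> carrier_mat n n" "B' * (M' * B) \<in> carrier_mat n n"
    using mult_carrier_mat[OF B(2) M(1)] mult_carrier_mat[OF M(2) B(1)]
      mult_carrier_mat[OF B(2) mult_carrier_mat[OF M(2) B(1)]] by blast+
  have "(B' * M * B) * (B' * M' * B) = (B' * M) * (B * (B' * (M' * B)))"
    unfolding assoc_mult_mat[OF B(2) M(2) B(1)] by (rule assoc_mult_mat[OF c(1) B(1) c(3)])
  also have "B * (B' * (M' * B)) = M' * B"
    unfolding assoc_mult_mat[OF B(1,2) c(2), symmetric] B(3) by (rule left_mult_one_mat[OF c(2)])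
  also have "(B' * M) * (M' * B) = B' * M * M' * B" by (rule assoc_mult_mat[OF c(1) M(2) B(1), symmetric])
  also have "B' * M * M' = B' * (M * M')" by (rule assoc_mult_mat[OF B(2) M])
  finally show ?thesis .
qed

lemma conjugate_inject:
  fixes B B' M M' :: "'d::ring_1 mat"
  assumes B: "B \<in> carrier_mat n n" "B' \<in> carrier_mat n n" "B * B' = 1\<^sub>m n"
    and M: "M \<in> carrier_mat n n" "M' \<in> carrier_mat n n"
    and eq: "B' * M * B = B' * M' * B"
  shows "M = M'"
proof -
  have id: "B * (B' * A * B) * B' = A" if A: "A \<in> carrier_mat n n" for A :: "'d mat"
  proof -
    have c: "A * B \<in> carrier_mat n n" by (rule mult_carrier_mat[OF A B(1)])
    have "B * (B' * A * B) = A * B"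
      unfolding assoc_mult_mat[OF B(2) A B(1)] assoc_mult_mat[OF B(1,2) c, symmetric] B(3)
      by (rule left_mult_one_mat[OF c])
    moreover have "A * B * B' = A"
      unfolding assoc_mult_mat[OF A B(1,2)] B(3) by (rule right_mult_one_mat[OF A])
    ultimately show ?thesis by simp
  qed
  have "M = B * (B' * M * B) * B'" by (rule id[OF M(1), symmetric])
  also have "\<dots> = B * (B' * M' * B) * B'" unfolding eq ..
  also have "\<dots> = M'" by (rule id[OF M(2)])
  finally show ?thesis .
qed

text \<open>\<open>f\<close> runs from the abstract product to the matrices, the direction in which
  it has a formula, while the isomorphism is wanted the other way. Closure of \<open>A\<close> and
  bijectivity transfer products to the inverse map.\<close>

lemma inv_into_iso:
  assumes "\<And>x y. x \<in> carrier A \<Longrightarrow> y \<in> carrier A \<Longrightarrow> x \<otimes>\<^bsub>A\<^esub> y \<in> carrier A \<and> f (x \<otimes>\<^bsub>A\<^esub> y) = f x \<otimes>\<^bsub>G\<^esub> f y"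
    and bij: "bij_betw f (carrier A) (carrier G)"
  shows "G \<cong> A"
proof -
  let ?g = "inv_into (carrier A) f"
  have g: "bij_betw ?g (carrier G) (carrier A)" using bij by (rule bij_betw_inv_into)
  have "?g (x \<otimes>\<^bsub>G\<^esub> y) = ?g x \<otimes>\<^bsub>A\<^esub> ?g y" if xy: "x \<in> carrier G" "y \<in> carrier G" for x y
  proof -
    have gx: "?g x \<in> carrier A" "?g y \<in> carrier A" using g xy by (blast dest: bij_betwE)+
    have "f (?g x \<otimes>\<^bsub>A\<^esub> ?g y) = f (?g x) \<otimes>\<^bsub>G\<^esub> f (?g y)"
      by (rule conjunct2[OF assms(1)[OF gx]])
    also have "\<dots> = x \<otimes>\<^bsub>G\<^esub> y" by (simp only: bij_betw_inv_into_right[OF bij xy(1)] bij_betw_inv_into_right[OF bij xy(2)])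
    finally show ?thesis using bij_betw_inv_into_left[OF bij conjunct1[OF assms(1)[OF gx]]] by argo
  qed
  then have "?g \<in> iso G A"
    by (intro isoI homI g) (use g in \<open>blast dest: bij_betwE\<close>)
  then show ?thesis unfolding is_iso_def by blast
qed

section \<open>The full group of monomial matrices\<close>

context definite_quaternions
begin

context
  fixes B B' :: "'d mat" and U :: "'d set"
  assumes B: "B \<in> carrier_mat 3 3" "B' \<in> carrier_mat 3 3" and BB': "B * B' = 1\<^sub>m 3" and B'B: "B' * B = 1\<^sub>m 3"
    and U: "finite U" "\<forall>g\<in>U. \<forall>h\<in>U. g * h \<in> U" "1 \<in> U" "0 \<notin> U"
begin

text \<open>Conjugation by \<open>B\<close> returns to the original basis, so that this set can be
  compared with the given group by inclusion.\<close>

definition monomial_group :: "'d mat set" where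
  "monomial_group = {B' * monomial_mat h \<sigma> * B | h \<sigma>. \<sigma> permutes {1..3} \<and> (\<forall>m\<in>{1..3}. h m \<in> U)}"

lemma monomial_groupI:
  "\<sigma> permutes {1..3} \<Longrightarrow> \<forall>m\<in>{1..3}. h m \<in> U \<Longrightarrow> B' * monomial_mat h \<sigma> * B \<in> monomial_group"
  unfolding monomial_group_def by blast

lemma monomial_group_carrier: "monomial_group \<subseteq> carrier_mat 3 3"
  unfolding monomial_group_def
  by (clarify, intro mult_carrier_mat[OF mult_carrier_mat[OF B(2) monomial_mat_carrier] B(1)])

lemma conjugate_monomial_mult:
  assumes "\<sigma> permutes {1..3}" "\<tau> permutes {1..3}"
  shows "(B' * monomial_mat h \<sigma> * B) * (B' * monomial_mat g \<tau> * B)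
    = B' * monomial_mat (\<lambda>m. h m * g (inv_into UNIV \<sigma> m)) (\<sigma> \<circ> \<tau>) * B"
  by (simp only: conjugate_mult[OF B BB' monomial_mat_carrier monomial_mat_carrier] monomial_mat_mult[OF assms])

lemma conjugate_monomial_one:
  assumes "\<And>m. m \<in> {1..3} \<Longrightarrow> h m = 1"
  shows "B' * monomial_mat h id * B = 1\<^sub>m 3"
proof -
  have "monomial_mat h id = 1\<^sub>m 3" by (rule monomial_mat_one) (rule assms)
  then show ?thesis using B B'B by simp
qed

lemma monomial_group_mult:
  assumes "x \<in> monomial_group" "y \<in> monomial_group"
  shows "x * y \<in> monomial_group"
proof -
  obtain h \<sigma> g \<tau> where x: "x = B' * monomial_mat h \<sigma> * B" "\<sigma> permutes {1..3}" "\<forall>m\<in>{1..3}. h m \<in> U"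
    and y: "y = B' * monomial_mat g \<tau> * B" "\<tau> permutes {1..3}" "\<forall>m\<in>{1..3}. g m \<in> U"
    using assms unfolding monomial_group_def by blast
  have "\<forall>m\<in>{1..3}. h m * g (inv_into UNIV \<sigma> m) \<in> U"
    using x(3) y(3) U(2) permutes_in_image[OF permutes_inv[OF x(2)]] by blast
  then show ?thesis
    unfolding x(1) y(1) conjugate_monomial_mult[OF x(2) y(2)]
    by (intro monomial_groupI permutes_compose x(2) y(2))
qed

text \<open>Entries have norm 1, so the inverse consists of their conjugates, placed according to
  the inverse permutation.\<close>

lemma monomial_group_inverse:
  assumes "x \<in> monomial_group"
  shows "\<exists>y\<in>monomial_group. x * y = 1\<^sub>m 3 \<and> y * x = 1\<^sub>m 3"
proof -
  interpret F: finite_quaternion_group scale a b i j U using U by unfold_locales blast+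
  obtain h \<sigma> where x: "x = B' * monomial_mat h \<sigma> * B" "\<sigma> permutes {1..3}" "\<forall>m\<in>{1..3}. h m \<in> U"
    using assms unfolding monomial_group_def by blast
  have inv: "inv_into UNIV \<sigma> permutes {1..3}" by (rule permutes_inv[OF x(2)])
  have \<sigma>m: "\<sigma> m \<in> {1..3}" if "m \<in> {1..3}" for m using permutes_in_image[OF x(2)] that by blast
  define g where "g m = conjq (h (\<sigma> m))" for m
  define y where "y = B' * monomial_mat g (inv_into UNIV \<sigma>) * B"
  have "g m \<in> U" if "m \<in> {1..3}" for m
    unfolding g_def using F.conjq_closed x(3) \<sigma>m[OF that] by blast
  then have y: "y \<in> monomial_group" unfolding y_def using inv by (intro monomial_groupI) blast+
  have nrd1: "nrd (h m) = 1" if "m \<in> {1..3}" for m using F.nrd_finite x(3) that by blast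
  have "x * y = B' * monomial_mat (\<lambda>m. h m * g (inv_into UNIV \<sigma> m)) id * B"
    unfolding x(1) y_def conjugate_monomial_mult[OF x(2) inv] permutes_inv_o(1)[OF x(2)] by (rule refl)
  also have "\<dots> = 1\<^sub>m 3"
    by (rule conjugate_monomial_one) (simp add: g_def permutes_inverses(1)[OF x(2)] mult_conjq nrd1)
  finally have xy: "x * y = 1\<^sub>m 3" .
  have "y * x = B' * monomial_mat (\<lambda>m. g m * h (inv_into UNIV (inv_into UNIV \<sigma>) m)) id * B"
    unfolding x(1) y_def conjugate_monomial_mult[OF inv x(2)] permutes_inv_o(2)[OF x(2)] by (rule refl)
  also have "\<dots> = 1\<^sub>m 3"
  proof (rule conjugate_monomial_one)
    fix m :: nat assume "m \<in> {1..3}"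
    then show "g m * h (inv_into UNIV (inv_into UNIV \<sigma>) m) = 1"
      using nrd1[OF \<sigma>m] by (simp add: g_def permutes_inv_inv[OF x(2)] conjq_mult_self)
  qed
  finally show ?thesis using xy y by blast
qed

lemma monomial_group_one: "1\<^sub>m 3 \<in> monomial_group"
proof -
  have "B' * monomial_mat (\<lambda>m. 1) id * B = 1\<^sub>m 3" by (rule conjugate_monomial_one) simp
  then show ?thesis using monomial_groupI[OF permutes_id, of "\<lambda>m. 1"] U(3) by simp
qed

text \<open>Only the values of \<open>h\<close> on 1, 2, 3 enter the matrix; restricting
  \<open>h\<close> to them leaves finitely many parameters.\<close>

lemma finite_monomial_group: "finite monomial_group"
proof -
  have "monomial_group \<subseteq> (\<lambda>(h, \<sigma>). B' * monomial_mat h \<sigma> * B) ` (({1..3} \<rightarrow>\<^sub>E U) \<times> {\<sigma>. \<sigma> permutes {1..3}})"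
  proof
    fix x assume "x \<in> monomial_group"
    then obtain h \<sigma> where x: "x = B' * monomial_mat h \<sigma> * B" "\<sigma> permutes {1..3}" "\<forall>m\<in>{1..3}. h m \<in> U"
      unfolding monomial_group_def by blast
    have "monomial_mat h \<sigma> = monomial_mat (restrict h {1..3}) \<sigma>" by (rule monomial_mat_cong) simp
    then have "x = (\<lambda>(h, \<sigma>). B' * monomial_mat h \<sigma> * B) (restrict h {1..3}, \<sigma>)" using x(1) by simp
    moreover have "(restrict h {1..3}, \<sigma>) \<in> ({1..3} \<rightarrow>\<^sub>E U) \<times> {\<sigma>. \<sigma> permutes {1..3}}" using x(2,3) by simp
    ultimately show "x \<in> (\<lambda>(h, \<sigma>). B' * monomial_mat h \<sigma> * B) ` (({1..3} \<rightarrow>\<^sub>E U) \<times> {\<sigma>. \<sigma> permutes {1..3}})"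
      by (rule image_eqI)
  qed
  moreover have "finite (({1..3::nat} \<rightarrow>\<^sub>E U) \<times> {\<sigma>. \<sigma> permutes {1..3::nat}})"
    using U(1) by (intro finite_cartesian_product finite_PiE finite_permutations) auto
  ultimately show ?thesis by (meson finite_imageI finite_subset)
qed

lemma subgroup_monomial_group: "subgroup monomial_group (GL TYPE('d) 3)"
proof -
  interpret GL: group "GL TYPE('d) 3" by (rule group_GL)
  have carrier: "monomial_group \<subseteq> carrier (GL TYPE('d) 3)"
    using monomial_group_inverse monomial_group_carrier by (fastforce simp: carrier_GL)
  show ?thesis
  proof (rule GL.subgroupI[OF carrier])
    show "monomial_group \<noteq> {}" using monomial_group_one by blast
    show "inv\<^bsub>GL TYPE('d) 3\<^esub> x \<in> monomial_group" if x: "x \<in> monomial_group" for x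
    proof -
      obtain y where y: "y \<in> monomial_group" "y * x = 1\<^sub>m 3" using monomial_group_inverse[OF x] by blast
      have "inv\<^bsub>GL TYPE('d) 3\<^esub> x = y"
        by (rule GL.inv_equality) (use x y carrier in \<open>auto simp: GL_mult GL_one\<close>)
      then show ?thesis using y(1) by simp
    qed
    show "x \<otimes>\<^bsub>GL TYPE('d) 3\<^esub> y \<in> monomial_group" if "x \<in> monomial_group" "y \<in> monomial_group" for x y
      unfolding GL_mult using that by (rule monomial_group_mult)
  qed
qed

lemma monomial_group_wreath:
  assumes rep: "ring_representation K \<phi>" and img: "\<phi> ` carrier K = U"
  shows "(GL TYPE('d) 3)\<lparr>carrier := monomial_group\<rparr> \<cong> wreath_sym K 3"
proof -
  define \<Phi> where "\<Phi> = (\<lambda>(f, \<sigma>). B' * monomial_mat (\<lambda>m. \<phi> (f m)) \<sigma> * B)"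
  have carrier: "(f, \<sigma>) \<in> carrier (wreath_sym K 3) \<longleftrightarrow> f \<in> {1..3} \<rightarrow>\<^sub>E carrier K \<and> \<sigma> permutes {1..3}" for f \<sigma>
    by (simp add: wreath_sym_def sym_group_def)
  have mult: "(f, \<sigma>) \<otimes>\<^bsub>wreath_sym K 3\<^esub> (g, \<tau>) = (\<lambda>m\<in>{1..3}. f m \<otimes>\<^bsub>K\<^esub> g (inv_into UNIV \<sigma> m), \<sigma> \<circ> \<tau>)" for f g \<sigma> \<tau>
    by (simp add: wreath_sym_def sym_group_def)
  have K: "x \<otimes>\<^bsub>K\<^esub> y \<in> carrier K \<and> \<phi> (x \<otimes>\<^bsub>K\<^esub> y) = \<phi> x * \<phi> y" if "x \<in> carrier K" "y \<in> carrier K" for x y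
    using rep that unfolding ring_representation_def by blast
  have inj: "inj_on \<phi> (carrier K)" using rep unfolding ring_representation_def by blast
  have hom: "p \<otimes>\<^bsub>wreath_sym K 3\<^esub> q \<in> carrier (wreath_sym K 3) \<and> \<Phi> (p \<otimes>\<^bsub>wreath_sym K 3\<^esub> q) = \<Phi> p * \<Phi> q"
    if pq: "p \<in> carrier (wreath_sym K 3)" "q \<in> carrier (wreath_sym K 3)" for p q
  proof -
    obtain f \<sigma> g \<tau> where p: "p = (f, \<sigma>)" and q: "q = (g, \<tau>)" by (cases p, cases q)
    have f: "f \<in> {1..3} \<rightarrow>\<^sub>E carrier K" and \<sigma>: "\<sigma> permutes {1..3}" and g: "g \<in> {1..3} \<rightarrow>\<^sub>E carrier K" and \<tau>: "\<tau> permutes {1..3}"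
      using pq carrier p q by blast+
    have mem: "f m \<in> carrier K" "g (inv_into UNIV \<sigma> m) \<in> carrier K" if "m \<in> {1..3}" for m
      using PiE_mem[OF f that] PiE_mem[OF g] permutes_in_image[OF permutes_inv[OF \<sigma>], of m] that by blast+
    have "(\<lambda>m\<in>{1..3}. f m \<otimes>\<^bsub>K\<^esub> g (inv_into UNIV \<sigma> m)) \<in> {1..3} \<rightarrow>\<^sub>E carrier K"
      using mem K by (intro restrict_PiE_iff[THEN iffD2]) blast
    then have cl: "p \<otimes>\<^bsub>wreath_sym K 3\<^esub> q \<in> carrier (wreath_sym K 3)"
      unfolding p q mult carrier using permutes_compose[OF \<tau> \<sigma>] by blast
    have "\<Phi> (p \<otimes>\<^bsub>wreath_sym K 3\<^esub> q)
        = B' * monomial_mat (\<lambda>m. \<phi> ((\<lambda>m\<in>{1..3}. f m \<otimes>\<^bsub>K\<^esub> g (inv_into UNIV \<sigma> m)) m)) (\<sigma> \<circ> \<tau>) * B"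
      by (simp add: p q mult \<Phi>_def)
    also have "monomial_mat (\<lambda>m. \<phi> ((\<lambda>m\<in>{1..3}. f m \<otimes>\<^bsub>K\<^esub> g (inv_into UNIV \<sigma> m)) m)) (\<sigma> \<circ> \<tau>)
        = monomial_mat (\<lambda>m. \<phi> (f m) * \<phi> (g (inv_into UNIV \<sigma> m))) (\<sigma> \<circ> \<tau>)"
      by (rule monomial_mat_cong) (use mem K in simp)
    also have "B' * \<dots> * B = \<Phi> p * \<Phi> q"
      unfolding p q \<Phi>_def case_prod_conv using conjugate_monomial_mult[OF \<sigma> \<tau>] by simp
    finally show ?thesis using cl by blast
  qed
  have "bij_betw \<Phi> (carrier (wreath_sym K 3)) monomial_group"
  proof (rule bij_betw_imageI)
    show "inj_on \<Phi> (carrier (wreath_sym K 3))"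
    proof (rule inj_onI)
      fix p q assume pq: "p \<in> carrier (wreath_sym K 3)" "q \<in> carrier (wreath_sym K 3)" "\<Phi> p = \<Phi> q"
      obtain f \<sigma> g \<tau> where p: "p = (f, \<sigma>)" and q: "q = (g, \<tau>)" by (cases p, cases q)
      have f: "f \<in> {1..3} \<rightarrow>\<^sub>E carrier K" and \<sigma>: "\<sigma> permutes {1..3}" and g: "g \<in> {1..3} \<rightarrow>\<^sub>E carrier K" and \<tau>: "\<tau> permutes {1..3}"
        using pq carrier p q by blast+
      have eq: "monomial_mat (\<lambda>m. \<phi> (f m)) \<sigma> = monomial_mat (\<lambda>m. \<phi> (g m)) \<tau>"
        using pq(3) conjugate_inject[OF B BB' monomial_mat_carrier monomial_mat_carrier]
        by (simp add: p q \<Phi>_def)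
      have nz: "\<phi> (f m) \<noteq> 0" if "m \<in> {1..3}" for m
        using imageI[OF PiE_mem[OF f that], of \<phi>] U(4) unfolding img by metis
      have "\<sigma> = \<tau>" by (rule monomial_mat_inject(1)[OF \<sigma> \<tau> eq]) (rule nz)
      moreover have "f m = g m" if m: "m \<in> {1..3}" for m
      proof -
        have "\<phi> (f m) = \<phi> (g m)" by (rule monomial_mat_inject(2)[OF \<sigma> \<tau> eq _ m]) (rule nz)
        then show ?thesis using inj_onD[OF inj] PiE_mem[OF f m] PiE_mem[OF g m] by blast
      qed
      then have "f = g" by (rule PiE_ext[OF f g])
      ultimately show "p = q" using p q by simp
    qed
    show "\<Phi> ` carrier (wreath_sym K 3) = monomial_group"
    proof
      show "\<Phi> ` carrier (wreath_sym K 3) \<subseteq> monomial_group"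
      proof
        fix x assume "x \<in> \<Phi> ` carrier (wreath_sym K 3)"
        then obtain p where "p \<in> carrier (wreath_sym K 3)" "x = \<Phi> p" by blast
        moreover obtain f \<sigma> where "p = (f, \<sigma>)" by (cases p)
        ultimately have f: "f \<in> {1..3} \<rightarrow>\<^sub>E carrier K" "\<sigma> permutes {1..3}" "x = \<Phi> (f, \<sigma>)" using carrier by blast+
        have "\<forall>m\<in>{1..3}. \<phi> (f m) \<in> U" using PiE_mem[OF f(1)] img by blast
        then show "x \<in> monomial_group" unfolding f(3) \<Phi>_def case_prod_conv by (rule monomial_groupI[OF f(2)])
      qed
      show "monomial_group \<subseteq> \<Phi> ` carrier (wreath_sym K 3)"
      proof
        fix x assume "x \<in> monomial_group"
        then obtain h \<sigma> where x: "x = B' * monomial_mat h \<sigma> * B" "\<sigma> permutes {1..3}" "\<forall>m\<in>{1..3}. h m \<in> U"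
          unfolding monomial_group_def by blast
        define f where "f = (\<lambda>m\<in>{1..3}. inv_into (carrier K) \<phi> (h m))"
        have h: "h m \<in> \<phi> ` carrier K" if "m \<in> {1..3}" for m using x(3) img that by blast
        have "f \<in> {1..3} \<rightarrow>\<^sub>E carrier K" unfolding f_def
          by (intro restrict_PiE_iff[THEN iffD2] ballI inv_into_into h)
        then have mem: "(f, \<sigma>) \<in> carrier (wreath_sym K 3)" using carrier x(2) by blast
        have "monomial_mat (\<lambda>m. \<phi> (f m)) \<sigma> = monomial_mat h \<sigma>"
          by (rule monomial_mat_cong) (use h in \<open>simp add: f_def f_inv_into_f del: atLeastAtMost_iff\<close>)
        then have "x = \<Phi> (f, \<sigma>)" using x(1) by (simp add: \<Phi>_def)
        then show "x \<in> \<Phi> ` carrier (wreath_sym K 3)" using mem by (rule image_eqI)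
      qed
    qed
  qed
  then show ?thesis by (intro inv_into_iso[of _ \<Phi>]) (use hom in \<open>simp_all add: GL_mult\<close>)
qed

end

lemma maximal_imprimitive_wreath:
  assumes maximal: "maximal_finite_subgroup G (GL TYPE('d) 3)"
    and B: "B \<in> carrier_mat 3 3" "B' \<in> carrier_mat 3 3" "B * B' = 1\<^sub>m 3" "B' * B = 1\<^sub>m 3"
    and form: "\<forall>x\<in>G. \<exists>h \<sigma>. \<sigma> permutes {1..3} \<and> (\<forall>m\<in>{1..3}. h m \<in> H) \<and> x = B' * monomial_mat h \<sigma> * B"
    and rep: "ring_representation K \<phi>" and H: "H \<subseteq> \<phi> ` carrier K"
  shows "(GL TYPE('d) 3)\<lparr>carrier := G\<rparr> \<cong> wreath_sym K 3"
proof -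
  define U where "U = \<phi> ` carrier K"
  have "g * h \<in> U" if gh: "g \<in> U" "h \<in> U" for g h
  proof -
    obtain x y where "x \<in> carrier K" "y \<in> carrier K" "g = \<phi> x" "h = \<phi> y" using gh unfolding U_def by blast
    then show ?thesis using rep unfolding ring_representation_def U_def by (metis imageI)
  qed
  then have U: "finite U" "\<forall>g\<in>U. \<forall>h\<in>U. g * h \<in> U" "1 \<in> U" "0 \<notin> U"
    using rep unfolding ring_representation_def U_def by blast+
  note facts = B U
  have "G \<subseteq> monomial_group B B' U"
  proof
    fix x assume "x \<in> G"
    then obtain h \<sigma> where x: "\<sigma> permutes {1..3}" "\<forall>m\<in>{1..3}. h m \<in> H" "x = B' * monomial_mat h \<sigma> * B" using form by blast
    have "\<forall>m\<in>{1..3}. h m \<in> U" using x(2) H unfolding U_def by blast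
    then show "x \<in> monomial_group B B' U" unfolding x(3) by (rule monomial_groupI[OF facts x(1)])
  qed
  then have "monomial_group B B' U = G"
    using maximal subgroup_monomial_group[OF facts] finite_monomial_group[OF facts]
    unfolding maximal_finite_subgroup_def by blast
  then show ?thesis using monomial_group_wreath[OF facts rep U_def[symmetric]] by simp
qed

end

theorem theorem5p13:
  fixes scale :: "rat \<Rightarrow> 'd::ring_1 \<Rightarrow> 'd" and G :: "'d mat set"
  assumes "totally_definite_quaternion_algebra scale"
    and "maximal_finite_subgroup G (GL TYPE('d) 3)"
    and "absolutely_irreducible scale 3 G"
    and "imprimitive 3 G"
  shows "(is_quaternion_D_p_inf scale 2 \<and>
            (GL TYPE('d) 3)\<lparr>carrier := G\<rparr> \<cong> wreath_sym (SL TYPE(3) 2) 3) \<or>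
         (is_quaternion_D_p_inf scale 3 \<and>
            (GL TYPE('d) 3)\<lparr>carrier := G\<rparr> \<cong> wreath_sym Dic12 3)"
proof -
  obtain a b i j where "definite_quaternions scale a b i j" using totally_definite_obtains[OF assms(1)] .
  then interpret definite_quaternions scale a b i j .
  have "subgroup G (GL TYPE('d) 3)" "finite G" using assms(2) by (simp_all add: maximal_finite_subgroup_def)
  then obtain s W where "imprimitive_rows scale a b i j G s W"
    using imprimitive_rows_exist assms(3,4) by blast
  then interpret imprimitive_rows scale a b i j G s W .
  obtain B B' :: "'d mat" and H :: "'d set" where B: "B \<in> carrier_mat 3 3" "B' \<in> carrier_mat 3 3" "B * B' = 1\<^sub>m 3" "B' * B = 1\<^sub>m 3"
    and H: "finite H" "\<forall>g\<in>H. \<forall>h\<in>H. g * h \<in> H" "1 \<in> H" "0 \<notin> H" "\<exists>g\<in>H. \<exists>h\<in>H. g * h \<noteq> h * g"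
    and form: "\<forall>x\<in>G. \<exists>h \<sigma>. \<sigma> permutes {1..3} \<and> (\<forall>m\<in>{1..3}. h m \<in> H) \<and> x = B' * monomial_mat h \<sigma> * B"
    using monomial_form by (elim exE conjE)
  obtain g h where gh: "g \<in> H" "h \<in> H" "g * h \<noteq> h * g" using H(5) by blast
  note wreath = maximal_imprimitive_wreath[OF assms(2) B form]
  have "(\<exists>u v \<phi>. definite_quaternions scale (- 1) (- 1) u v \<and>
      ring_representation (SL TYPE(3) 2) \<phi> \<and> H \<subseteq> \<phi> ` carrier (SL TYPE(3) 2)) \<or>
    (\<exists>u v \<phi>. definite_quaternions scale (- 1) (- 3) u v \<and>
      ring_representation Dic12 \<phi> \<and> H \<subseteq> \<phi> ` carrier Dic12)"
    by (rule finite_noncommutative_embedding[OF H(1) _ H(3,4) gh]) (use H(2) in blast)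
  then show ?thesis
  proof (elim disjE exE conjE)
    fix u v \<phi>
    assume "definite_quaternions scale (- 1) (- 1) u v" "ring_representation (SL TYPE(3) 2) \<phi>"
      "H \<subseteq> \<phi> ` carrier (SL TYPE(3) 2)"
    then show ?thesis
      by (intro disjI1 conjI quaternion_D_2_inf[OF assms(1)] wreath)
  next
    fix u v \<phi>
    assume "definite_quaternions scale (- 1) (- 3) u v" "ring_representation Dic12 \<phi>" "H \<subseteq> \<phi> ` carrier Dic12"
    then show ?thesis
      by (intro disjI2 conjI quaternion_D_3_inf[OF assms(1)] wreath)
  qed
qed

end
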